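(* Let $G\to G'$ be a $Y$-$\Delta$ move of graphs on a torus. Then the corresponding transformation of $\Gamma_G$ into $\Gamma_{G'}$ is a composition of four cluster mutations: there is a sequence of four spider moves (together with shrinking/expanding of 2-valent vertices) transforming $\Gamma_G$ into $\Gamma_{G'}$ such that, with $\mu_{\mathcal{A}}:\mathcal{A}'_G\dashrightarrow\mathcal{A}'_{G'}$ and $\mu_{\mathcal{X}}:\mathcal{X}'_G\dashrightarrow\mathcal{X}'_{G'}$ the corresponding compositions of four cluster $\mathcal{A}$- and $\mathcal{X}$-mutations, and with $\beta:\mathcal{B}'_G\dashrightarrow\mathcal{B}'_{G'}$ and $\rho:\mathcal{R}'_G\dashrightarrow\mathcal{R}'_{G'}$ the birational maps given by the action of the $Y$-$\Delta$ move on the $B$- and $C$-variables, the following diagrams commute: $$\mu_{\mathcal{A}}\circ j=j\circ\beta,\qquad \mu_{\mathcal{X}}\circ i=i\circ\rho .$$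
   Context: $G$ is a finite graph embedded in an oriented torus with contractible faces. $\Gamma_G$ is the bipartite graph whose white vertices are the midpoints of edges of $G$, and whose black vertices are the vertices and the faces of $G$, with edges given by incidence. Each face $f$ of $\Gamma_G$ is a quadrilateral with two black vertices. Tori: $\mathcal{A}'_G$ has $\mathbb{C}^*$-coordinates $A_f$ ($f$ faces of $\Gamma_G$); $\mathcal{B}'_G$ has coordinates $B_b$ ($b$ black vertices of $\Gamma_G$); $\mathcal{R}'_G$ has coordinates $C_w$ ($w$ white vertices, i.e. conductances on edges of $G$) up to a common scalar; $\mathcal{X}'_G$ has coordinates $X_f$ with $\prod_fX_f=1$. The map $j:\mathcal{B}'_G\to\mathcal{A}'_G$ is $j^*A_f=B_bB_{b'}$, with $b,b'$ the black vertices of $f$. The map $i:\mathcal{R}'_G\to\mathcal{X}'_G$ sends conductances to face weights: $i^*X_f=C_w/C_{w'}$ is the monodromy around the counterclockwise boundary of $f$ of the line bundle with connection in which the parallel transport from a vertex of $G$ to the midpoint $w$ of an incident edge is $C_w$ and from a face of $G$ to the midpoint of an adjacent edge is $1$ (here $w,w'$ are the white vertices of $f$). $Y$-$\Delta$ move: a triangular face with vertices $1,2,3$ is replaced by a star with a new center joined to $1,2,3$ (or conversely). On conductances: if $\alpha,\beta,\gamma$ are those of the triangle edges opposite to $1,2,3$ and $a,b,c$ those of the star edges at $1,2,3$, then $a=\frac{\alpha\beta+\beta\gamma+\gamma\alpha}{\alpha}$, $b=\frac{\alpha\beta+\beta\gamma+\gamma\alpha}{\beta}$, $c=\frac{\alpha\beta+\beta\gamma+\gamma\alpha}{\gamma}$,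 equivalently $\alpha=\frac{bc}{a+b+c}$, $\beta=\frac{ac}{a+b+c}$, $\gamma=\frac{ab}{a+b+c}$. On $B$-variables: if $B_0$ is the variable of the triangular face, $B_1,B_2,B_3$ those of the vertices $1,2,3$, $B_4,B_5,B_6$ those of the faces across the edges $23,13,12$, and $B_7$ that of the center of the star, then $B_7=\frac{B_1B_4+B_2B_5+B_3B_6}{B_0}$ (and the same relation for the inverse move); the other variables are unchanged. Spider move on a bipartite graph: inside a disc with four white vertices $1,2,3,4$ in cyclic order on its boundary, black vertices $P$ (adjacent exactly to $1,2,4$) and $Q$ (adjacent exactly to $2,3,4$) are replaced by black vertices $R$ (adjacent to $1,3,4$) and $U$ (adjacent to $1,2,3$), or the version with colors interchanged; the central quadrilateral face $F=P2Q4$ is replaced by $R1U3$ and the other faces correspond to each other. Shrinking a 2-valent vertex contracts its two edges; expanding is the inverse; these do not change face coordinates. For faces put $\varepsilon_{fg}=$ intersection number of the boundaries $\partial f,\partial g$ (counterclockwise) on the oriented surface of the ribbon graph obtained by reversing the cyclic orders at all white vertices. The $\mathcal{X}$-mutation at $F$ is $X_F'=X_F^{-1}$, $X_f'=X_f(1+X_F^{-\mathrm{sgn}\,\varepsilon_{fF}})^{-\varepsilon_{fF}}$ for $f\neq F$; the $\mathcal{A}$-mutation at $F$ is $A_FA_F'=\prod_{g:\varepsilon_{Fg}>0}A_g^{\varepsilon_{Fg}}+\prod_{g:\varepsilon_{Fg}<0}A_g^{-\varepsilon_{Fg}}$, $A_f'=A_f$ for $f\ne F$.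
   Formalization: Assumes in addition that the triangle's vertices have degree greater than 2 and that no face across a side of the triangle is bounded by a single edge; otherwise intersection contributions cancel, the X-mutation does not preserve the product condition, and the claim fails. *)

theory Defs
  imports Complex_Main "HOL-Combinatorics.Permutations" "HOL-Combinatorics.Orbits"
begin

section \<open>Graphs on the oriented torus\<close>

text \<open>
  A graph embedded in an oriented closed surface with contractible faces is given by its darts
  (oriented edges): \<open>rot\<close> sends a dart to the next dart counterclockwise around its initial vertex
  and \<open>opp\<close> reverses it.  The vertex a dart starts at and the face to its left have names
  \<open>vert\<close> and \<open>lface\<close>, so that vertices and faces which a local move does not affect keep their
  identity.
\<close>

record ('d, 'v, 'f) surface_graph =
  darts :: "'d set"
  rot :: "'d \<Rightarrow> 'd"
  opp :: "'d \<Rightarrow> 'd"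
  vert :: "'d \<Rightarrow> 'v"
  lface :: "'d \<Rightarrow> 'f"

text \<open>The dart following \<open>d\<close> on the counterclockwise boundary of the face to the left of \<open>d\<close>.\<close>

definition face_next :: "('d, 'v, 'f) surface_graph \<Rightarrow> 'd \<Rightarrow> 'd" where
  "face_next G d = inv (rot G) (opp G d)"

definition edge_of :: "('d, 'v, 'f) surface_graph \<Rightarrow> 'd \<Rightarrow> 'd set" where
  "edge_of G d = {d, opp G d}"

text \<open>The last two conjuncts: the surface is connected and its Euler characteristic is zero.\<close>

definition torus_graph :: "('d, 'v, 'f) surface_graph \<Rightarrow> bool" where
  "torus_graph G \<longleftrightarrow>
     finite (darts G) \<and> darts G \<noteq> {} \<and>
     rot G permutes darts G \<and> opp G permutes darts G \<and>
     (\<forall>d\<in>darts G. opp G d \<noteq> d \<and> opp G (opp G d) = d) \<and>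
     (\<forall>d\<in>darts G. \<forall>d'\<in>darts G.
        (vert G d = vert G d' \<longleftrightarrow> d' \<in> orbit (rot G) d) \<and>
        (lface G d = lface G d' \<longleftrightarrow> d' \<in> orbit (face_next G) d)) \<and>
     (\<forall>d\<in>darts G. \<forall>d'\<in>darts G. (d, d') \<in> ({(x, rot G x) |x. True} \<union> {(x, opp G x) |x. True})\<^sup>*) \<and>
     card (vert G ` darts G) + card (lface G ` darts G) = card (edge_of G ` darts G)"


section \<open>Bipartite graphs on oriented surfaces\<close>

text \<open>
  \<open>brot\<close> and \<open>wrot\<close> send an edge to the next one counterclockwise around its black, respectively
  white, end; the vertices are their orbits.  Every edge is directed from black to white, and
  \<open>fc\<close> gives the name of the face to its left.  The face to the left of \<open>e\<close> is also to the left of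
  \<open>wrot (brot e)\<close>, and the orbits of \<open>wrot \<circ> brot\<close> are the faces; the face to the right of \<open>e\<close> is to
  the left of \<open>inv brot e\<close>.  Names of faces are carried along by all moves below and thereby
  express the correspondence between the faces before and after a move.
\<close>

record ('e, 'f) bip =
  edges :: "'e set"
  brot :: "'e \<Rightarrow> 'e"
  wrot :: "'e \<Rightarrow> 'e"
  fc :: "'e \<Rightarrow> 'f"

definition wf_bip :: "('e, 'f) bip \<Rightarrow> bool" where
  "wf_bip \<Gamma> \<longleftrightarrow> finite (edges \<Gamma>) \<and> brot \<Gamma> permutes edges \<Gamma> \<and> wrot \<Gamma> permutes edges \<Gamma> \<and>
     (\<forall>e\<in>edges \<Gamma>. fc \<Gamma> (wrot \<Gamma> (brot \<Gamma> e)) = fc \<Gamma> e)"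

definition faces :: "('e, 'f) bip \<Rightarrow> 'f set" where
  "faces \<Gamma> = fc \<Gamma> ` edges \<Gamma>"

text \<open>Interchanging the colours reverses the direction of the edges, hence left and right.\<close>

definition swap_colours :: "('e, 'f) bip \<Rightarrow> ('e, 'f) bip" where
  "swap_colours \<Gamma> = \<lparr>edges = edges \<Gamma>, brot = wrot \<Gamma>, wrot = brot \<Gamma>, fc = (\<lambda>e. fc \<Gamma> (inv (brot \<Gamma>) e))\<rparr>"

text \<open>
  An isomorphism \<open>h\<close> of bipartite surface graphs, inducing the map \<open>\<theta>\<close> on faces.
\<close>

definition bip_iso :: "('e \<Rightarrow> 'e2) \<Rightarrow> ('f \<Rightarrow> 'f2) \<Rightarrow> ('e, 'f) bip \<Rightarrow> ('e2, 'f2) bip \<Rightarrow> bool" where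
  "bip_iso h \<theta> \<Gamma> \<Gamma>' \<longleftrightarrow> bij_betw h (edges \<Gamma>) (edges \<Gamma>') \<and>
     (\<forall>e\<in>edges \<Gamma>. h (brot \<Gamma> e) = brot \<Gamma>' (h e) \<and> h (wrot \<Gamma> e) = wrot \<Gamma>' (h e) \<and>
        \<theta> (fc \<Gamma> e) = fc \<Gamma>' (h e))"

text \<open>
  Shrinking a 2-valent white vertex with edges \<open>e1\<close>, \<open>e2\<close> ending at distinct black vertices.
  The permutation \<open>m\<close> joins the cycles of \<open>brot\<close> through \<open>e1\<close> and \<open>e2\<close> into one; the new black
  rotation is obtained from it by skipping \<open>e1\<close> and \<open>e2\<close>.
\<close>

definition shrink_white :: "('e, 'f) bip \<Rightarrow> ('e, 'f) bip \<Rightarrow> bool" where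
  "shrink_white \<Gamma> \<Gamma>' \<longleftrightarrow> wf_bip \<Gamma> \<and> wf_bip \<Gamma>' \<and>
     (\<exists>e1 e2. let m = (brot \<Gamma>)(e1 := brot \<Gamma> e2, e2 := brot \<Gamma> e1) in
        e1 \<in> edges \<Gamma> \<and> e2 \<in> edges \<Gamma> \<and> e1 \<noteq> e2 \<and> wrot \<Gamma> e1 = e2 \<and> wrot \<Gamma> e2 = e1 \<and>
        e2 \<notin> orbit (brot \<Gamma>) e1 \<and>
        edges \<Gamma>' = edges \<Gamma> - {e1, e2} \<and>
        (\<forall>e\<in>edges \<Gamma>'. wrot \<Gamma>' e = wrot \<Gamma> e \<and> fc \<Gamma>' e = fc \<Gamma> e \<and>
           brot \<Gamma>' e = (if m e \<notin> {e1, e2} then m e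
                        else if m (m e) \<notin> {e1, e2} then m (m e)
                        else m (m (m e)))))"

definition shrink :: "('e, 'f) bip \<Rightarrow> ('e, 'f) bip \<Rightarrow> bool" where
  "shrink \<Gamma> \<Gamma>' \<longleftrightarrow> shrink_white \<Gamma> \<Gamma>' \<or> shrink_white (swap_colours \<Gamma>) (swap_colours \<Gamma>')"

text \<open>
  The spider move with black centres: \<open>p\<^sub>i\<close>, \<open>q\<^sub>i\<close>, \<open>u\<^sub>i\<close>, \<open>r\<^sub>i\<close> are the edges joining
  \<open>P\<close>, \<open>Q\<close>, \<open>U\<close>, \<open>R\<close> to the white vertex \<open>i\<close>, where the white vertices 1, 2, 3, 4 occur in
  counterclockwise order on the boundary of the disc.  In the rotation at the white vertices,
  \<open>p1\<close> gives way to \<open>u1, r1\<close>, the pair \<open>q2, p2\<close> to \<open>u2\<close>, \<open>q3\<close> to \<open>r3, u3\<close>, and \<open>p4, q4\<close>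
  to \<open>r4\<close>; \<open>entry\<close> replaces the first edge of each of these old groups by the first edge of the
  new one.
\<close>

definition spider_black :: "'f \<Rightarrow> ('e, 'f) bip \<Rightarrow> ('e, 'f) bip \<Rightarrow> bool" where
  "spider_black F \<Gamma> \<Gamma>' \<longleftrightarrow> wf_bip \<Gamma> \<and> wf_bip \<Gamma>' \<and>
     (\<exists>p1 p2 p4 q2 q3 q4 u1 u2 u3 r1 r3 r4.
        let old = {p1, p2, p4, q2, q3, q4};
            new = {u1, u2, u3, r1, r3, r4};
            entry = (\<lambda>e. if e = p1 then u1 else if e = q2 then u2 else if e = q3 then r3
                         else if e = p4 then r4 else e)
        in
        \<comment> \<open>the configuration before the move\<close>
        distinct [p1, p2, p4, q2, q3, q4] \<and> old \<subseteq> edges \<Gamma> \<and>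
        brot \<Gamma> p1 = p2 \<and> brot \<Gamma> p2 = p4 \<and> brot \<Gamma> p4 = p1 \<and>
        brot \<Gamma> q2 = q3 \<and> brot \<Gamma> q3 = q4 \<and> brot \<Gamma> q4 = q2 \<and>
        wrot \<Gamma> q2 = p2 \<and> wrot \<Gamma> p4 = q4 \<and>
        distinct (map (orbit (wrot \<Gamma>)) [p1, p2, q3, p4]) \<and>
        fc \<Gamma> p2 = F \<and> fc \<Gamma> q4 = F \<and>
        \<comment> \<open>the configuration after the move\<close>
        distinct [u1, u2, u3, r1, r3, r4] \<and> new \<inter> (edges \<Gamma> - old) = {} \<and>
        edges \<Gamma>' = (edges \<Gamma> - old) \<union> new \<and>
        brot \<Gamma>' u1 = u2 \<and> brot \<Gamma>' u2 = u3 \<and> brot \<Gamma>' u3 = u1 \<and>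
        brot \<Gamma>' r1 = r3 \<and> brot \<Gamma>' r3 = r4 \<and> brot \<Gamma>' r4 = r1 \<and>
        wrot \<Gamma>' u1 = r1 \<and> wrot \<Gamma>' r1 = entry (wrot \<Gamma> p1) \<and>
        wrot \<Gamma>' u2 = entry (wrot \<Gamma> p2) \<and>
        wrot \<Gamma>' r3 = u3 \<and> wrot \<Gamma>' u3 = entry (wrot \<Gamma> q3) \<and>
        wrot \<Gamma>' r4 = entry (wrot \<Gamma> q4) \<and>
        fc \<Gamma>' r1 = F \<and> fc \<Gamma>' u3 = F \<and>
        fc \<Gamma>' u1 = fc \<Gamma> p1 \<and> fc \<Gamma>' u2 = fc \<Gamma> q2 \<and>
        fc \<Gamma>' r3 = fc \<Gamma> q3 \<and> fc \<Gamma>' r4 = fc \<Gamma> p4 \<and>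
        (\<forall>e\<in>edges \<Gamma> - old. brot \<Gamma>' e = brot \<Gamma> e \<and> wrot \<Gamma>' e = entry (wrot \<Gamma> e) \<and> fc \<Gamma>' e = fc \<Gamma> e))"

definition spider :: "'f \<Rightarrow> ('e, 'f) bip \<Rightarrow> ('e, 'f) bip \<Rightarrow> bool" where
  "spider F \<Gamma> \<Gamma>' \<longleftrightarrow> spider_black F \<Gamma> \<Gamma>' \<or> spider_black F (swap_colours \<Gamma>) (swap_colours \<Gamma>')"

text \<open>
  Sequences of elementary moves; the list records, in order, the spider moves as pairs of the graph
  to which the move is applied and its central face.
\<close>

inductive moves :: "('e, 'f) bip \<Rightarrow> (('e, 'f) bip \<times> 'f) list \<Rightarrow> ('e, 'f) bip \<Rightarrow> bool" where
  moves_refl: "moves \<Gamma> [] \<Gamma>"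
| moves_shrink: "shrink \<Gamma> \<Gamma>' \<Longrightarrow> moves \<Gamma>' ms \<Gamma>'' \<Longrightarrow> moves \<Gamma> ms \<Gamma>''"
| moves_expand: "shrink \<Gamma>' \<Gamma> \<Longrightarrow> moves \<Gamma>' ms \<Gamma>'' \<Longrightarrow> moves \<Gamma> ms \<Gamma>''"
| moves_spider: "spider F \<Gamma> \<Gamma>' \<Longrightarrow> moves \<Gamma>' ms \<Gamma>'' \<Longrightarrow> moves \<Gamma> ((\<Gamma>, F) # ms) \<Gamma>''"


section \<open>The intersection form and cluster mutations\<close>

text \<open>
  Twice the local intersection number at a vertex with counterclockwise rotation \<open>r\<close> of two flows
  \<open>x\<close>, \<open>y\<close>, where \<open>x e\<close> is the flow leaving the vertex along \<open>e\<close> (of total zero).  It is normalised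
  by: a path going from west to east and one going from south to north intersect with number 1.
  For flows of total zero it does not depend on the edge \<open>e\<close> at which the enumeration of the edges
  starts.
\<close>

definition local_pairing2 :: "('e \<Rightarrow> 'e) \<Rightarrow> 'e \<Rightarrow> ('e \<Rightarrow> int) \<Rightarrow> ('e \<Rightarrow> int) \<Rightarrow> int" where
  "local_pairing2 r e x y =
     (\<Sum>j<card (orbit r e). \<Sum>i<j.
        x ((r ^^ i) e) * y ((r ^^ j) e) - x ((r ^^ j) e) * y ((r ^^ i) e))"

definition vertex_pairing2 :: "'e set \<Rightarrow> ('e \<Rightarrow> 'e) \<Rightarrow> ('e \<Rightarrow> int) \<Rightarrow> ('e \<Rightarrow> int) \<Rightarrow> int" where
  "vertex_pairing2 E r x y = (\<Sum>v\<in>orbit r ` E. local_pairing2 r (SOME e. e \<in> v) x y)"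

text \<open>
  Intersection number of two 1-cycles \<open>x\<close>, \<open>y\<close> on the surface of the bipartite ribbon graph with
  edges \<open>E\<close> and rotations \<open>rb\<close>, \<open>rw\<close>; coefficients refer to the direction from black to white.
  (At white vertices the outgoing flows are \<open>-x\<close> and \<open>-y\<close>; the signs cancel.)
\<close>

definition intersection_number ::
  "'e set \<Rightarrow> ('e \<Rightarrow> 'e) \<Rightarrow> ('e \<Rightarrow> 'e) \<Rightarrow> ('e \<Rightarrow> int) \<Rightarrow> ('e \<Rightarrow> int) \<Rightarrow> int" where
  "intersection_number E rb rw x y = (vertex_pairing2 E rb x y + vertex_pairing2 E rw x y) div 2"

text \<open>The counterclockwise boundary of a face as a 1-cycle.\<close>

definition boundary :: "('e, 'f) bip \<Rightarrow> 'f \<Rightarrow> 'e \<Rightarrow> int" where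
  "boundary \<Gamma> f e = of_bool (fc \<Gamma> e = f) - of_bool (fc \<Gamma> (inv (brot \<Gamma>) e) = f)"

definition eps :: "('e, 'f) bip \<Rightarrow> 'f \<Rightarrow> 'f \<Rightarrow> int" where
  "eps \<Gamma> f g =
     intersection_number (edges \<Gamma>) (brot \<Gamma>) (inv (wrot \<Gamma>)) (boundary \<Gamma> f) (boundary \<Gamma> g)"

text \<open>
  Points of a torus with coordinates indexed by a set are functions, of which only the values on
  the index set matter.  Rational maps between tori are partial maps, undefined where
  the resulting coordinates do not give a point of the target torus (recall that division by zero
  yields zero).
\<close>

definition into :: "'a set \<Rightarrow> 'a \<Rightarrow> 'a option" where
  "into T x = (if x \<in> T then Some x else None)"

definition torus_A :: "('e, 'f) bip \<Rightarrow> ('f \<Rightarrow> complex) set" where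
  "torus_A \<Gamma> = {A. \<forall>f\<in>faces \<Gamma>. A f \<noteq> 0}"

definition torus_X :: "('e, 'f) bip \<Rightarrow> ('f \<Rightarrow> complex) set" where
  "torus_X \<Gamma> = {X. (\<forall>f\<in>faces \<Gamma>. X f \<noteq> 0) \<and> (\<Prod>f\<in>faces \<Gamma>. X f) = 1}"

definition mut_A :: "('e, 'f) bip \<Rightarrow> 'f \<Rightarrow> ('f \<Rightarrow> complex) \<rightharpoonup> ('f \<Rightarrow> complex)" where
  "mut_A \<Gamma> F A = into (torus_A \<Gamma>)
     (A(F := ((\<Prod>g\<in>{g \<in> faces \<Gamma>. eps \<Gamma> F g > 0}. A g powi eps \<Gamma> F g) +
              (\<Prod>g\<in>{g \<in> faces \<Gamma>. eps \<Gamma> F g < 0}. A g powi (- eps \<Gamma> F g))) / A F))"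

definition mut_X :: "('e, 'f) bip \<Rightarrow> 'f \<Rightarrow> ('f \<Rightarrow> complex) \<rightharpoonup> ('f \<Rightarrow> complex)" where
  "mut_X \<Gamma> F X = into (torus_X \<Gamma>)
     (\<lambda>f. if f = F then inverse (X F)
          else X f * (1 + X F powi (- sgn (eps \<Gamma> f F))) powi (- eps \<Gamma> f F))"

fun mutations :: "('g \<Rightarrow> 'f \<Rightarrow> ('x \<rightharpoonup> 'x)) \<Rightarrow> ('g \<times> 'f) list \<Rightarrow> ('x \<rightharpoonup> 'x)" where
  "mutations \<mu> [] = Some"
| "mutations \<mu> ((\<Gamma>, F) # ms) = mutations \<mu> ms \<circ>\<^sub>m \<mu> \<Gamma> F"


section \<open>The bipartite graph of a graph on the torus\<close>

text \<open>
  \<open>VertexEdge d\<close> joins the initial vertex of \<open>d\<close>, and \<open>FaceEdge d\<close> the face to the left of \<open>d\<close>,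
  to the midpoint of the edge of \<open>d\<close>.  \<open>NewEdge\<close> provides names for edges created by moves.
\<close>

datatype 'd gedge = VertexEdge 'd | FaceEdge 'd | NewEdge nat

fun gamma_brot :: "('d, 'v, 'f) surface_graph \<Rightarrow> 'd gedge \<Rightarrow> 'd gedge" where
  "gamma_brot G (VertexEdge d) = VertexEdge (rot G d)"
| "gamma_brot G (FaceEdge d) = FaceEdge (face_next G d)"
| "gamma_brot G (NewEdge n) = NewEdge n"

text \<open>
  Around the midpoint of the edge of \<open>d\<close> one meets, counterclockwise, the end point of \<open>d\<close>, the
  face to its left, its initial point, and the face to its right.
\<close>

fun gamma_wrot :: "('d, 'v, 'f) surface_graph \<Rightarrow> 'd gedge \<Rightarrow> 'd gedge" where
  "gamma_wrot G (VertexEdge d) = (if d \<in> darts G then FaceEdge (opp G d) else VertexEdge d)"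
| "gamma_wrot G (FaceEdge d) = (if d \<in> darts G then VertexEdge d else FaceEdge d)"
| "gamma_wrot G (NewEdge n) = NewEdge n"

text \<open>A face of \<open>gamma G\<close> is named by the set of the edges it has on its left.\<close>

definition gamma :: "('d, 'v, 'f) surface_graph \<Rightarrow> ('d gedge, 'd gedge set) bip" where
  "gamma G = \<lparr>edges = VertexEdge ` darts G \<union> FaceEdge ` darts G,
     brot = gamma_brot G, wrot = gamma_wrot G,
     fc = orbit (gamma_wrot G \<circ> gamma_brot G)\<rparr>"

text \<open>The black vertices of \<open>gamma G\<close> are the vertices and the faces of \<open>G\<close>.\<close>

definition black_vertices :: "('d, 'v, 'f) surface_graph \<Rightarrow> ('v + 'f) set" where
  "black_vertices G = Inl ` vert G ` darts G \<union> Inr ` lface G ` darts G"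

fun black_end :: "('d, 'v, 'f) surface_graph \<Rightarrow> 'd gedge \<Rightarrow> 'v + 'f" where
  "black_end G (VertexEdge d) = Inl (vert G d)"
| "black_end G (FaceEdge d) = Inr (lface G d)"
| "black_end G (NewEdge n) = undefined"

definition torus_B :: "('d, 'v, 'f) surface_graph \<Rightarrow> ('v + 'f \<Rightarrow> complex) set" where
  "torus_B G = {B. \<forall>b\<in>black_vertices G. B b \<noteq> 0}"

definition map_j :: "('d, 'v, 'f) surface_graph \<Rightarrow> ('v + 'f \<Rightarrow> complex) \<Rightarrow> ('d gedge set \<Rightarrow> complex)" where
  "map_j G B f = (\<Prod>b\<in>black_end G ` f. B b)"

text \<open>
  White vertices of \<open>gamma G\<close> are represented by the edges \<open>edge_of G d\<close> of \<open>G\<close>.  A point of the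
  torus of conductances up to a common scalar is given by any representative: the maps below are
  compatible with rescaling, see \<open>map_i_scale\<close>, \<open>rho_delta_star_scale\<close> and \<open>rho_star_delta_scale\<close>.
\<close>

definition torus_R :: "('d, 'v, 'f) surface_graph \<Rightarrow> ('d set \<Rightarrow> complex) set" where
  "torus_R G = {C. \<forall>w\<in>edge_of G ` darts G. C w \<noteq> 0}"

text \<open>Parallel transport along an edge of \<open>gamma G\<close> from its black to its white end.\<close>

fun transport :: "('d, 'v, 'f) surface_graph \<Rightarrow> ('d set \<Rightarrow> complex) \<Rightarrow> 'd gedge \<Rightarrow> complex" where
  "transport G C (VertexEdge d) = C (edge_of G d)"
| "transport G C (FaceEdge d) = 1"
| "transport G C (NewEdge n) = 1"

text \<open>
  The counterclockwise boundary of \<open>f\<close> consists of the edges \<open>e\<close> with \<open>f\<close> on their left, each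
  followed by \<open>inv wrot e\<close> traversed from white to black.
\<close>

definition monodromy :: "('e, 'f) bip \<Rightarrow> ('e \<Rightarrow> complex) \<Rightarrow> 'f \<Rightarrow> complex" where
  "monodromy \<Gamma> T f = (\<Prod>e\<in>{e \<in> edges \<Gamma>. fc \<Gamma> e = f}. T e / T (inv (wrot \<Gamma>) e))"

definition map_i :: "('d, 'v, 'f) surface_graph \<Rightarrow> ('d set \<Rightarrow> complex) \<Rightarrow> ('d gedge set \<Rightarrow> complex)" where
  "map_i G C = monodromy (gamma G) (transport G C)"


section \<open>The Y-Delta move\<close>

text \<open>The cyclic successor in \<open>{1, 2, 3}\<close>.\<close>

definition nxt :: "nat \<Rightarrow> nat" where
  "nxt k = k mod 3 + 1"

text \<open>
  \<open>a k\<close> is the dart from vertex \<open>k\<close> to vertex \<open>nxt k\<close> of the triangle, whose face is on its left.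
  \<open>s k\<close> is the dart from vertex \<open>k\<close> to the centre \<open>c\<close> of the star, and \<open>t k\<close> is its opposite.
  At vertex \<open>nxt k\<close> the two consecutive darts \<open>a (nxt k)\<close>, \<open>opp (a k)\<close> of the triangle are replaced
  by the one dart \<open>s (nxt k)\<close> of the star.  The six darts of the star may or may not be
  those of the triangle.
\<close>

definition tri_darts :: "('d, 'v, 'f) surface_graph \<Rightarrow> (nat \<Rightarrow> 'd) \<Rightarrow> 'd set" where
  "tri_darts G a = {a 1, a 2, a 3, opp G (a 1), opp G (a 2), opp G (a 3)}"

definition delta_star :: "('d, 'v, 'f) surface_graph \<Rightarrow> ('d, 'v, 'f) surface_graph \<Rightarrow>
    (nat \<Rightarrow> 'd) \<Rightarrow> (nat \<Rightarrow> 'd) \<Rightarrow> (nat \<Rightarrow> 'd) \<Rightarrow> 'v \<Rightarrow> bool" where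
  "delta_star G G' a s t c \<longleftrightarrow>
     (let outer = darts G - tri_darts G a;
          sub = (\<lambda>d. if d = a 1 then s 1 else if d = a 2 then s 2 else if d = a 3 then s 3 else d)
      in
      tri_darts G a \<subseteq> darts G \<and>
      distinct [a 1, a 2, a 3, opp G (a 1), opp G (a 2), opp G (a 3)] \<and>
      distinct [s 1, s 2, s 3, t 1, t 2, t 3] \<and>
      {s 1, s 2, s 3, t 1, t 2, t 3} \<inter> outer = {} \<and>
      c \<notin> vert G ` darts G \<and>
      darts G' = outer \<union> {s 1, s 2, s 3, t 1, t 2, t 3} \<and>
      (\<forall>k\<in>{1, 2, 3}.
         face_next G (a k) = a (nxt k) \<and>
         opp G' (s k) = t k \<and> opp G' (t k) = s k \<and>
         rot G' (t k) = t (nxt k) \<and>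
         rot G' (s (nxt k)) = sub (rot G (opp G (a k))) \<and>
         vert G' (s k) = vert G (a k) \<and> vert G' (t k) = c \<and>
         lface G' (t k) = lface G (opp G (a k)) \<and> lface G' (s (nxt k)) = lface G (opp G (a k))) \<and>
      (\<forall>d\<in>outer. opp G' d = opp G d \<and> rot G' d = sub (rot G d) \<and>
         vert G' d = vert G d \<and> lface G' d = lface G d))"

text \<open>
  The vertices of the triangle have degree greater than 2 and the faces across its sides are not
  bounded by a single edge.  Otherwise, at one of the mutations, one and the same face occurs next to
  the mutated face with contributions of opposite sign to the intersection number; these cancel, and
  the mutation formula written with \<open>eps\<close> is no longer the transformation of a spider move (it
  does not even preserve the condition that the product of the \<open>X\<close>-coordinates is 1).
\<close>

definition nondegenerate :: "('d, 'v, 'f) surface_graph \<Rightarrow> (nat \<Rightarrow> 'd) \<Rightarrow> bool" where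
  "nondegenerate G a \<longleftrightarrow> (\<forall>k\<in>{1, 2, 3}.
     card {d \<in> darts G. vert G d = vert G (a k)} > 2 \<and>
     card {d \<in> darts G. lface G d = lface G (opp G (a k))} > 1)"

text \<open>
  The numerator \<open>B\<^sub>1 B\<^sub>4 + B\<^sub>2 B\<^sub>5 + B\<^sub>3 B\<^sub>6\<close>: the side opposite to vertex 1, 2, 3 is that of \<open>a 2\<close>,
  \<open>a 3\<close>, \<open>a 1\<close>, respectively.
\<close>

definition star_sum :: "('d, 'v, 'f) surface_graph \<Rightarrow> (nat \<Rightarrow> 'd) \<Rightarrow> ('v + 'f \<Rightarrow> complex) \<Rightarrow> complex" where
  "star_sum G a B =
     B (Inl (vert G (a 1))) * B (Inr (lface G (opp G (a 2)))) +
     B (Inl (vert G (a 2))) * B (Inr (lface G (opp G (a 3)))) +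
     B (Inl (vert G (a 3))) * B (Inr (lface G (opp G (a 1))))"

text \<open>
  In the following four definitions \<open>G\<close> is the graph with the triangle and \<open>G'\<close> the graph with the
  star.  Variables not mentioned are unchanged, since black vertices and edges outside the move have
  the same names in both graphs.
\<close>

definition beta_delta_star :: "('d, 'v, 'f) surface_graph \<Rightarrow> ('d, 'v, 'f) surface_graph \<Rightarrow>
    (nat \<Rightarrow> 'd) \<Rightarrow> 'v \<Rightarrow> ('v + 'f \<Rightarrow> complex) \<rightharpoonup> ('v + 'f \<Rightarrow> complex)" where
  "beta_delta_star G G' a c B = into (torus_B G')
     (B(Inl c := star_sum G a B / B (Inr (lface G (a 1)))))"

definition beta_star_delta :: "('d, 'v, 'f) surface_graph \<Rightarrow> ('d, 'v, 'f) surface_graph \<Rightarrow>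
    (nat \<Rightarrow> 'd) \<Rightarrow> 'v \<Rightarrow> ('v + 'f \<Rightarrow> complex) \<rightharpoonup> ('v + 'f \<Rightarrow> complex)" where
  "beta_star_delta G G' a c B = into (torus_B G)
     (B(Inr (lface G (a 1)) := star_sum G a B / B (Inl c)))"

definition rho_delta_star :: "('d, 'v, 'f) surface_graph \<Rightarrow> ('d, 'v, 'f) surface_graph \<Rightarrow>
    (nat \<Rightarrow> 'd) \<Rightarrow> (nat \<Rightarrow> 'd) \<Rightarrow> ('d set \<Rightarrow> complex) \<rightharpoonup> ('d set \<Rightarrow> complex)" where
  "rho_delta_star G G' a s C =
     (let \<alpha> = C (edge_of G (a 2)); \<beta> = C (edge_of G (a 3)); \<gamma> = C (edge_of G (a 1));
          S = \<alpha> * \<beta> + \<beta> * \<gamma> + \<gamma> * \<alpha>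
      in into (torus_R G')
           (C(edge_of G' (s 1) := S / \<alpha>, edge_of G' (s 2) := S / \<beta>, edge_of G' (s 3) := S / \<gamma>)))"

definition rho_star_delta :: "('d, 'v, 'f) surface_graph \<Rightarrow> ('d, 'v, 'f) surface_graph \<Rightarrow>
    (nat \<Rightarrow> 'd) \<Rightarrow> (nat \<Rightarrow> 'd) \<Rightarrow> ('d set \<Rightarrow> complex) \<rightharpoonup> ('d set \<Rightarrow> complex)" where
  "rho_star_delta G G' a s C =
     (let x = C (edge_of G' (s 1)); y = C (edge_of G' (s 2)); z = C (edge_of G' (s 3))
      in into (torus_R G)
           (C(edge_of G (a 2) := y * z / (x + y + z),
              edge_of G (a 3) := x * z / (x + y + z),
              edge_of G (a 1) := x * y / (x + y + z))))"

text \<open>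
  A Y-Delta move from \<open>G\<close> to \<open>G'\<close> in either direction, with its action on the \<open>B\<close>-variables and
  conductances; \<open>T\<close> is the one of the two graphs which has the triangle.
\<close>

inductive y_delta_move :: "('d, 'v, 'f) surface_graph \<Rightarrow> (nat \<Rightarrow> 'd) \<Rightarrow>
    ('d, 'v, 'f) surface_graph \<Rightarrow> ('d, 'v, 'f) surface_graph \<Rightarrow>
    (('v + 'f \<Rightarrow> complex) \<rightharpoonup> ('v + 'f \<Rightarrow> complex)) \<Rightarrow>
    (('d set \<Rightarrow> complex) \<rightharpoonup> ('d set \<Rightarrow> complex)) \<Rightarrow> bool" where
  delta_to_star: "delta_star G G' a s t c \<Longrightarrow>
     y_delta_move G a G G' (beta_delta_star G G' a c) (rho_delta_star G G' a s)"
| star_to_delta: "delta_star G G' a s t c \<Longrightarrow>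
     y_delta_move G a G' G (beta_star_delta G G' a c) (rho_star_delta G G' a s)"

text \<open>
  Points with positive real coordinates; these form a Zariski dense subset of the torus.
\<close>

definition positive_on :: "'x set \<Rightarrow> ('x \<Rightarrow> complex) \<Rightarrow> bool" where
  "positive_on I u \<longleftrightarrow> (\<forall>x\<in>I. \<exists>r>0. u x = complex_of_real r)"


section \<open>Compatibility with rescaling of conductances\<close>

lemma wf_bip_gamma:
  assumes "torus_graph G"
  shows "wf_bip (gamma G)"
proof -
  have r: "rot G permutes darts G" and o: "opp G permutes darts G" and fin: "finite (darts G)"
    and inv: "\<And>d. d \<in> darts G \<Longrightarrow> opp G (opp G d) = d"
    using assms by (auto simp: torus_graph_def)
  have "face_next G = inv (rot G) \<circ> opp G"
    by (simp add: fun_eq_iff face_next_def)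
  then have fn: "face_next G permutes darts G"
    using permutes_compose[OF o permutes_inv[OF r]] by simp
  let ?E = "VertexEdge ` darts G \<union> FaceEdge ` darts G"
  have b: "gamma_brot G permutes ?E"
  proof (rule bij_imp_permutes)
    have "inj_on (gamma_brot G) ?E"
      by (auto simp: inj_on_def inj_eq[OF permutes_inj[OF r]] inj_eq[OF permutes_inj[OF fn]])
    moreover have "gamma_brot G ` ?E \<subseteq> ?E"
      by (auto simp: permutes_in_image[OF r] permutes_in_image[OF fn])
    ultimately show "bij_betw (gamma_brot G) ?E ?E"
      using fin by (simp add: bij_betw_def endo_inj_surj)
    show "gamma_brot G x = x" if "x \<notin> ?E" for x
      using that by (cases x) (auto simp: image_iff intro!: permutes_not_in[OF r] permutes_not_in[OF fn])
  qed
  have w: "gamma_wrot G permutes ?E"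
  proof (rule bij_imp_permutes)
    have "inj_on (gamma_wrot G) ?E"
      by (auto simp: inj_on_def inj_eq[OF permutes_inj[OF o]])
    moreover have "gamma_wrot G ` ?E \<subseteq> ?E"
      by (auto simp: permutes_in_image[OF o])
    ultimately show "bij_betw (gamma_wrot G) ?E ?E"
      using fin by (simp add: bij_betw_def endo_inj_surj)
    show "gamma_wrot G x = x" if "x \<notin> ?E" for x
      using that by (cases x) auto
  qed
  have perm: "permutation (gamma_wrot G \<circ> gamma_brot G)"
    unfolding permutation_permutes
    by (intro exI[of _ ?E] conjI permutes_compose[OF b w]) (use fin in auto)
  have "orbit (gamma_wrot G \<circ> gamma_brot G) (gamma_wrot G (gamma_brot G e)) =
      orbit (gamma_wrot G \<circ> gamma_brot G) e" for e
    using permutation_orbit_step[OF perm, of e] by simp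
  then show ?thesis
    using b w fin by (simp add: wf_bip_def gamma_def)
qed

lemma gamma_face:
  assumes "torus_graph G" "d \<in> darts G"
  shows "orbit (gamma_wrot G \<circ> gamma_brot G) (VertexEdge d) = {VertexEdge d, FaceEdge (opp G (rot G d))}"
proof -
  have r: "rot G permutes darts G" and o: "opp G permutes darts G"
    and inv: "\<And>d. d \<in> darts G \<Longrightarrow> opp G (opp G d) = d"
    using assms by (auto simp: torus_graph_def)
  let ?\<phi> = "gamma_wrot G \<circ> gamma_brot G"
  have rd: "rot G d \<in> darts G" using assms(2) permutes_in_image[OF r] by simp
  have 1: "?\<phi> (VertexEdge d) = FaceEdge (opp G (rot G d))" using rd by simp
  have 2: "?\<phi> (FaceEdge (opp G (rot G d))) = VertexEdge d"
    using rd inv[OF rd] permutes_inverses[OF r] assms(2) by (simp add: face_next_def)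
  show ?thesis
  proof
    show "orbit ?\<phi> (VertexEdge d) \<subseteq> {VertexEdge d, FaceEdge (opp G (rot G d))}"
    proof
      fix x assume "x \<in> orbit ?\<phi> (VertexEdge d)"
      then show "x \<in> {VertexEdge d, FaceEdge (opp G (rot G d))}"
        by induction (use 1 2 in auto)
    qed
    show "{VertexEdge d, FaceEdge (opp G (rot G d))} \<subseteq> orbit ?\<phi> (VertexEdge d)"
      using orbit.base[of ?\<phi> "VertexEdge d"] orbit.step[of "FaceEdge (opp G (rot G d))" ?\<phi> "VertexEdge d"]
        1 2 by auto
  qed
qed

lemma faces_gamma:
  assumes "torus_graph G"
  shows "faces (gamma G) = (\<lambda>d. {VertexEdge d, FaceEdge (opp G (rot G d))}) ` darts G"
proof -
  have r: "rot G permutes darts G" and o: "opp G permutes darts G"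
    and inv: "\<And>d. d \<in> darts G \<Longrightarrow> opp G (opp G d) = d"
    using assms by (auto simp: torus_graph_def)
  have wf: "fc (gamma G) (wrot (gamma G) (brot (gamma G) e)) = fc (gamma G) e" if "e \<in> edges (gamma G)" for e
    using wf_bip_gamma[OF assms] that by (simp add: wf_bip_def)
  have "fc (gamma G) (FaceEdge d) \<in> (\<lambda>d. fc (gamma G) (VertexEdge d)) ` darts G" if "d \<in> darts G" for d
  proof -
    have "face_next G d \<in> darts G"
      using that permutes_in_image[OF o] permutes_in_image[OF permutes_inv[OF r]]
      by (simp add: face_next_def)
    then show ?thesis
      using wf[of "FaceEdge d"] that by (auto simp: gamma_def)
  qed
  then have "faces (gamma G) = (\<lambda>d. fc (gamma G) (VertexEdge d)) ` darts G"
    by (auto simp: faces_def gamma_def)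
  also have "\<dots> = (\<lambda>d. {VertexEdge d, FaceEdge (opp G (rot G d))}) ` darts G"
    using gamma_face[OF assms] by (intro image_cong) (auto simp: gamma_def)
  finally show ?thesis .
qed

lemma map_i_eq:
  assumes "torus_graph G" "d \<in> darts G"
  shows "map_i G C {VertexEdge d, FaceEdge (opp G (rot G d))} = C (edge_of G d) / C (edge_of G (rot G d))"
proof -
  have r: "rot G permutes darts G" and o: "opp G permutes darts G"
    and inv: "\<And>d. d \<in> darts G \<Longrightarrow> opp G (opp G d) = d"
    using assms by (auto simp: torus_graph_def)
  have rd: "rot G d \<in> darts G" using assms(2) permutes_in_image[OF r] by simp
  have ord: "opp G (rot G d) \<in> darts G" using rd permutes_in_image[OF o] by simp
  let ?f = "{VertexEdge d, FaceEdge (opp G (rot G d))}"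
  have wf: "wf_bip (gamma G)" using assms(1) by (rule wf_bip_gamma)
  then have b: "brot (gamma G) permutes edges (gamma G)" and w: "wrot (gamma G) permutes edges (gamma G)"
    and fin: "finite (edges (gamma G))"
    by (simp_all add: wf_bip_def)
  have "permutation (wrot (gamma G) \<circ> brot (gamma G))"
    unfolding permutation_permutes
    by (intro exI[of _ "edges (gamma G)"] conjI permutes_compose[OF b w] fin)
  then have perm: "permutation (gamma_wrot G \<circ> gamma_brot G)" by (simp add: gamma_def)
  have inj: "inj (gamma_wrot G)" using permutes_inj[OF w] by (simp add: gamma_def)
  have fcd: "fc (gamma G) (VertexEdge d) = ?f"
    using gamma_face[OF assms] by (simp add: gamma_def)
  have "fc (gamma G) e = ?f \<longleftrightarrow> e \<in> ?f" for e
  proof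
    show "e \<in> ?f" if "fc (gamma G) e = ?f"
      using permutation_self_in_orbit[OF perm, of e] that by (simp add: gamma_def)
    show "fc (gamma G) e = ?f" if "e \<in> ?f"
    proof -
      have "e \<in> fc (gamma G) (VertexEdge d)" using that fcd by simp
      then have "orbit (gamma_wrot G \<circ> gamma_brot G) e = fc (gamma G) (VertexEdge d)"
        using orbit_cyclic_eq3[OF cyclic_on_orbit'[OF perm]] by (simp add: gamma_def)
      then show ?thesis using fcd by (simp add: gamma_def)
    qed
  qed
  then have set: "{e \<in> edges (gamma G). fc (gamma G) e = ?f} = ?f"
    using assms(2) ord by (auto simp: gamma_def)
  have i1: "inv (gamma_wrot G) (VertexEdge d) = FaceEdge d"
    using assms(2) by (intro inv_f_eq[OF inj]) simp
  have i2: "inv (gamma_wrot G) (FaceEdge (opp G (rot G d))) = VertexEdge (rot G d)"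
    using rd by (intro inv_f_eq[OF inj]) simp
  show ?thesis
    unfolding map_i_def monodromy_def set using i1 i2 by (simp add: gamma_def)
qed

lemma map_i_scale:
  assumes "torus_graph G" "\<kappa> \<noteq> 0" "f \<in> faces (gamma G)"
  shows "map_i G (\<lambda>w. \<kappa> * C w) f = map_i G C f"
  using assms by (auto simp: faces_gamma map_i_eq)

lemma torus_R_scale: "\<kappa> \<noteq> 0 \<Longrightarrow> (\<lambda>w. \<kappa> * C w) \<in> torus_R G \<longleftrightarrow> C \<in> torus_R G"
  by (simp add: torus_R_def)

lemma rho_delta_star_scale:
  assumes "\<kappa> \<noteq> 0"
  shows "rho_delta_star G G' a s (\<lambda>w. \<kappa> * C w) =
    map_option (\<lambda>C' w. \<kappa> * C' w) (rho_delta_star G G' a s C)"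
proof -
  define \<alpha> \<beta> \<gamma> where "\<alpha> = C (edge_of G (a 2))" "\<beta> = C (edge_of G (a 3))" "\<gamma> = C (edge_of G (a 1))"
  define S where "S = \<alpha> * \<beta> + \<beta> * \<gamma> + \<gamma> * \<alpha>"
  define D where "D = C(edge_of G' (s 1) := S / \<alpha>, edge_of G' (s 2) := S / \<beta>, edge_of G' (s 3) := S / \<gamma>)"
  have S: "\<kappa> * \<alpha> * (\<kappa> * \<beta>) + \<kappa> * \<beta> * (\<kappa> * \<gamma>) + \<kappa> * \<gamma> * (\<kappa> * \<alpha>) = \<kappa> * (\<kappa> * S)"
    by (simp add: S_def algebra_simps)
  have D: "(\<lambda>w. \<kappa> * C w)(edge_of G' (s 1) := \<kappa> * (\<kappa> * S) / (\<kappa> * \<alpha>),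
      edge_of G' (s 2) := \<kappa> * (\<kappa> * S) / (\<kappa> * \<beta>), edge_of G' (s 3) := \<kappa> * (\<kappa> * S) / (\<kappa> * \<gamma>)) =
      (\<lambda>w. \<kappa> * D w)"
    using assms by (auto simp: D_def fun_eq_iff)
  have "rho_delta_star G G' a s C = into (torus_R G') D"
    by (simp add: rho_delta_star_def Let_def D_def S_def \<alpha>_\<beta>_\<gamma>_def)
  moreover have "rho_delta_star G G' a s (\<lambda>w. \<kappa> * C w) = into (torus_R G') (\<lambda>w. \<kappa> * D w)"
    unfolding D[symmetric] S[symmetric] by (simp add: rho_delta_star_def Let_def \<alpha>_\<beta>_\<gamma>_def)
  ultimately show ?thesis
    by (simp add: into_def torus_R_scale[OF assms])
qed

lemma rho_star_delta_scale:
  assumes "\<kappa> \<noteq> 0"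
  shows "rho_star_delta G G' a s (\<lambda>w. \<kappa> * C w) =
    map_option (\<lambda>C' w. \<kappa> * C' w) (rho_star_delta G G' a s C)"
proof -
  define x y z where "x = C (edge_of G' (s 1))" "y = C (edge_of G' (s 2))" "z = C (edge_of G' (s 3))"
  define D where "D = C(edge_of G (a 2) := y * z / (x + y + z), edge_of G (a 3) := x * z / (x + y + z),
    edge_of G (a 1) := x * y / (x + y + z))"
  have q: "\<kappa> * u * (\<kappa> * v) / (\<kappa> * x + \<kappa> * y + \<kappa> * z) = \<kappa> * (u * v / (x + y + z))" for u v
  proof -
    have "\<kappa> * u * (\<kappa> * v) / (\<kappa> * x + \<kappa> * y + \<kappa> * z) = (\<kappa> * (\<kappa> * (u * v))) / (\<kappa> * (x + y + z))"
      by (simp add: algebra_simps)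
    also have "\<dots> = \<kappa> * (u * v / (x + y + z))"
      using assms by simp
    finally show ?thesis .
  qed
  have D: "(\<lambda>w. \<kappa> * C w)(edge_of G (a 2) := \<kappa> * y * (\<kappa> * z) / (\<kappa> * x + \<kappa> * y + \<kappa> * z),
      edge_of G (a 3) := \<kappa> * x * (\<kappa> * z) / (\<kappa> * x + \<kappa> * y + \<kappa> * z),
      edge_of G (a 1) := \<kappa> * x * (\<kappa> * y) / (\<kappa> * x + \<kappa> * y + \<kappa> * z)) = (\<lambda>w. \<kappa> * D w)"
    unfolding q by (auto simp: D_def fun_eq_iff)
  have "rho_star_delta G G' a s C = into (torus_R G) D"
    by (simp add: rho_star_delta_def Let_def D_def x_y_z_def)
  moreover have "rho_star_delta G G' a s (\<lambda>w. \<kappa> * C w) = into (torus_R G) (\<lambda>w. \<kappa> * D w)"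
    unfolding D[symmetric] by (simp add: rho_star_delta_def Let_def x_y_z_def)
  ultimately show ?thesis
    by (simp add: into_def torus_R_scale[OF assms])
qed

end

theory Submission
  imports Defs
begin

text \<open>
  Around the triangular face, \<open>\<Gamma>\<^sub>G\<close> is a hexagon: a trivalent black centre (the face) is joined to
  three white vertices (the sides), each of which is adjacent to three consecutive black vertices of
  the boundary, alternately vertices and faces of \<open>G\<close>.  The star gives the same picture with the
  roles of the vertices and the faces interchanged.  So it suffices to turn a hexagon by one
  step, and the two directions of the Y-Delta move are instances of the same statement.

  Call the three inner quadrilaterals \<open>f\<^sub>1, f\<^sub>2, f\<^sub>3\<close>.  Splitting off a trivalent black vertex at each
  of the three boundary vertices lying on two inner edges, one can do spider moves at
  \<open>f\<^sub>1, f\<^sub>2, f\<^sub>3, f\<^sub>1\<close>; then the old white vertices have become 2-valent, and shrinking them gives the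
  turned hexagon.  For \<open>A\<close>-coordinates that are products of two \<open>B\<close>-coordinates the exchange
  relations become, after cancelling common factors, \<open>u = B\<^sub>2 B\<^sub>5 + B\<^sub>3 B\<^sub>6\<close> (an auxiliary value which
  disappears at the fourth step) and three times \<open>B\<^sub>0 B\<^sub>7 = B\<^sub>1 B\<^sub>4 + B\<^sub>2 B\<^sub>5 + B\<^sub>3 B\<^sub>6\<close>.
\<close>

section \<open>The intersection form in terms of faces\<close>

text \<open>A spider move needs both black vertices of its face to be trivalent, hence the
  preliminary splitting. New edges inherit old names, so the edge set and the names of faces stay
  fixed during the spider moves, and each step changes only two permutations that can be tabulated.
  The price is a final identification of the outcome with the required graph, by a map of edges and
  an induced map of faces. The obstacle is that on a torus the outer faces along the hexagon need
  not be distinct. Each mutation only needs the four neighbours of its own face to be distinct, and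
  opposite outer faces may coincide. Changes of coordinates are therefore collected edge by edge:
  both \<open>map_j\<close> and \<open>map_i\<close> are rewritten as products of weights over the
  two edges with the face on their left. A conductance C becomes the weight C on vertex edges and
  1/C on face edges; interchanging vertices and faces then inverts weights, which makes the two
  directions of the move formally equal. Mutations are partial maps, so the nonvanishing of
  intermediate denominators is drawn from definedness. As the exchange relations are
  subtraction-free, positive points lie in the domain.\<close>

lemma sum_funpow_orbit:
  fixes k :: "'e \<Rightarrow> int"
  assumes "r permutes E" "finite E"
  shows "(\<Sum>i<card (orbit r e). k ((r ^^ i) e)) = sum k (orbit r e)"
proof -
  let ?n = "funpow_dist1 r e e"
  have self: "e \<in> orbit r e"
    using assms by (intro permutation_self_in_orbit) (auto simp: permutation_permutes)
  have inj: "inj_on (\<lambda>i. (r ^^ i) e) {..<?n}"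
    using inj_on_funpow_dist1[OF self] by (simp add: lessThan_atLeast0)
  have img: "orbit r e = (\<lambda>i. (r ^^ i) e) ` {..<?n}"
    using orbit_conv_funpow_dist1[OF self] by (simp add: lessThan_atLeast0)
  have "card (orbit r e) = ?n"
    by (simp add: img card_image[OF inj])
  then show ?thesis
    by (simp add: img sum.reindex[OF inj])
qed

text \<open>\<open>inv r\<close> permutes the orbit, so the differences cancel on going once around
  the vertex.\<close>

lemma sum_diff_inv_orbit:
  fixes k :: "'e \<Rightarrow> int"
  assumes "r permutes E" "finite E"
  shows "(\<Sum>i\<in>orbit r e. k i - k (inv r i)) = 0"
proof -
  have fin: "finite (orbit r e)"
    using assms by (intro finite_orbit permutation_self_in_orbit) (auto simp: permutation_permutes)
  have img: "r ` orbit r e = orbit r e"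
    by (rule endo_inj_surj[OF fin _ permutes_inj_on[OF assms(1)]]) (auto intro: orbit.step)
  have "inv r ` orbit r e = orbit r e"
    by (subst img[symmetric]) (simp add: image_image permutes_inverses(2)[OF assms(1)])
  then have "(\<Sum>i\<in>orbit r e. k i) = (\<Sum>i\<in>inv r ` orbit r e. k i)"
    by simp
  also have "\<dots> = (\<Sum>i\<in>orbit r e. k (inv r i))"
    by (simp add: sum.reindex permutes_inj_on[OF permutes_inv[OF assms(1)]])
  finally show ?thesis
    by (simp add: sum_subtractf)
qed

text \<open>Summation by parts: when both flows are differences along the rotation, the inner sums
  telescope and the sum over pairs of edges becomes a single sum. The starting edge \<open>e\<close>
  enters only through terms at \<open>inv r e\<close>, each multiplied by a total flow, which is
  zero.\<close>

lemma local_pairing2_diff: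
  fixes F H :: "'e \<Rightarrow> int"
  assumes r: "r permutes E" and fin: "finite E"
    and x: "\<And>i. i \<in> orbit r e \<Longrightarrow> x i = F i - F (inv r i)"
    and y: "\<And>i. i \<in> orbit r e \<Longrightarrow> y i = H i - H (inv r i)"
  shows "local_pairing2 r e x y = (\<Sum>i\<in>orbit r e. F (inv r i) * H i - F i * H (inv r i))"
proof -
  let ?n = "card (orbit r e)" and ?e = "\<lambda>i. (r ^^ i) e"
  have self: "e \<in> orbit r e"
    using assms by (intro permutation_self_in_orbit) (auto simp: permutation_permutes)
  then have mem: "?e i \<in> orbit r e" for i
    by (rule funpow_in_orbit)
  have inv_Suc: "inv r (?e (Suc i)) = ?e i" for i
    using permutes_inverses(2)[OF r] by simp
  have part: "(\<Sum>i<j. z (?e i)) = K (inv r (?e j)) - K (inv r e)"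
    if "\<And>i. i \<in> orbit r e \<Longrightarrow> z i = K i - K (inv r i)" for z K :: "'e \<Rightarrow> int" and j
  proof (induction j)
    case (Suc j)
    then show ?case using that[OF mem[of j]] inv_Suc[of j] by simp
  qed simp
  note partx = part[of x F, OF x] and party = part[of y H, OF y]
  have "local_pairing2 r e x y = (\<Sum>j<?n. (F (inv r (?e j)) - F (inv r e)) * y (?e j) -
      (H (inv r (?e j)) - H (inv r e)) * x (?e j))"
    unfolding local_pairing2_def
    by (rule sum.cong[OF refl]) (simp add: sum_subtractf partx party mult.commute flip: sum_distrib_left sum_distrib_right)
  also have "\<dots> = (\<Sum>i\<in>orbit r e. (F (inv r i) - F (inv r e)) * y i - (H (inv r i) - H (inv r e)) * x i)"
    using r fin by (rule sum_funpow_orbit)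
  also have "\<dots> = (\<Sum>i\<in>orbit r e. F (inv r i) * H i - F i * H (inv r i))
      - F (inv r e) * (\<Sum>i\<in>orbit r e. H i - H (inv r i)) + H (inv r e) * (\<Sum>i\<in>orbit r e. F i - F (inv r i))"
    unfolding sum_distrib_left sum_subtractf[symmetric] sum.distrib[symmetric]
    by (rule sum.cong[OF refl]) (simp add: x y algebra_simps)
  finally show ?thesis
    by (simp only: sum_diff_inv_orbit[OF r fin])
qed

lemma vertex_pairing2_diff:
  fixes F H :: "'e \<Rightarrow> int"
  assumes r: "r permutes E" and fin: "finite E"
    and x: "\<And>i. i \<in> E \<Longrightarrow> x i = F i - F (inv r i)"
    and y: "\<And>i. i \<in> E \<Longrightarrow> y i = H i - H (inv r i)"
  shows "vertex_pairing2 E r x y = (\<Sum>i\<in>E. F (inv r i) * H i - F i * H (inv r i))"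
proof -
  have self: "e \<in> orbit r e" for e
    using assms by (intro permutation_self_in_orbit) (auto simp: permutation_permutes)
  have cyc: "cyclic_on r (orbit r e)" for e
    using r fin by (rule cyclic_on_orbit)
  have sub: "orbit r e \<subseteq> E" if "e \<in> E" for e
    using r that by (rule permutes_orbit_subset)
  have "vertex_pairing2 E r x y =
      (\<Sum>v\<in>orbit r ` E. \<Sum>i\<in>v. F (inv r i) * H i - F i * H (inv r i))"
    unfolding vertex_pairing2_def
  proof (rule sum.cong[OF refl])
    fix v assume "v \<in> orbit r ` E"
    then obtain d where d: "d \<in> E" "v = orbit r d" by auto
    \<comment> \<open>Any representative will do: its orbit is \<open>v\<close> again, and the
      single-sum form does not depend on it.\<close>
    have some: "(SOME e. e \<in> v) \<in> v"
      using self[of d] d by (metis someI)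
    then have v: "orbit r (SOME e. e \<in> v) = v"
      using orbit_cyclic_eq3[OF cyc] d by simp
    show "local_pairing2 r (SOME e. e \<in> v) x y = (\<Sum>i\<in>v. F (inv r i) * H i - F i * H (inv r i))"
      using local_pairing2_diff[OF r fin, of "SOME e. e \<in> v" x F y H] x y sub[OF d(1)] d(2) v by auto
  qed
  also have "\<dots> = (\<Sum>i\<in>\<Union>(orbit r ` E). F (inv r i) * H i - F i * H (inv r i))"
  proof (rule sum.Union_disjoint[symmetric, unfolded comp_def])
    show "\<forall>A\<in>orbit r ` E. finite A"
      using sub fin finite_subset by blast
    show "\<forall>A\<in>orbit r ` E. \<forall>B\<in>orbit r ` E. A \<noteq> B \<longrightarrow> A \<inter> B = {}"
      using orbit_cyclic_eq3[OF cyc] by (metis disjoint_iff imageE)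
  qed
  also have "\<Union>(orbit r ` E) = E"
    using sub self by blast
  finally show ?thesis .
qed

text \<open>
  At a black as well as at a white vertex of the reversed ribbon graph, the boundary of a face is the
  difference of the indicator of the face on the left and of its shift by one edge; each edge
  therefore contributes equally at both ends, which makes up for the division by two.
\<close>

lemma eps_eq:
  assumes "wf_bip \<Gamma>"
  shows "eps \<Gamma> f g = (\<Sum>e\<in>edges \<Gamma>.
     of_bool (fc \<Gamma> (inv (brot \<Gamma>) e) = f) * of_bool (fc \<Gamma> e = g) -
     of_bool (fc \<Gamma> e = f) * of_bool (fc \<Gamma> (inv (brot \<Gamma>) e) = g))"
proof -
  let ?E = "edges \<Gamma>" and ?b = "brot \<Gamma>" and ?w = "wrot \<Gamma>"
  have fin: "finite ?E" and b: "?b permutes ?E" and w: "?w permutes ?E"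
    and c: "\<And>e. e \<in> ?E \<Longrightarrow> fc \<Gamma> (?w (?b e)) = fc \<Gamma> e"
    using assms by (auto simp: wf_bip_def)
  \<comment> \<open>The face condition read at \<open>inv ?b e\<close>: the face to the right of
    \<open>e\<close> is to the left of \<open>?w e\<close>. As \<open>inv (inv ?w)\<close> is
    \<open>?w\<close>, the white vertices of the reversed ribbon graph yield the same sum as the
    black ones.\<close>
  have c': "fc \<Gamma> (?w e) = fc \<Gamma> (inv ?b e)" if "e \<in> ?E" for e
    using c[of "inv ?b e"] that permutes_in_image[OF permutes_inv[OF b]] permutes_inverses(1)[OF b] by simp
  have black: "vertex_pairing2 ?E ?b (boundary \<Gamma> f) (boundary \<Gamma> g) = (\<Sum>e\<in>?E.
     of_bool (fc \<Gamma> (inv ?b e) = f) * of_bool (fc \<Gamma> e = g) -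
     of_bool (fc \<Gamma> e = f) * of_bool (fc \<Gamma> (inv ?b e) = g))" for f g
    by (rule vertex_pairing2_diff[OF b fin]) (auto simp: boundary_def)
  have white: "vertex_pairing2 ?E (inv ?w) (boundary \<Gamma> f) (boundary \<Gamma> g) = (\<Sum>e\<in>?E.
     of_bool (fc \<Gamma> (inv (inv ?w) e) = f) * of_bool (fc \<Gamma> e = g) -
     of_bool (fc \<Gamma> e = f) * of_bool (fc \<Gamma> (inv (inv ?w) e) = g))" for f g
    by (rule vertex_pairing2_diff[OF permutes_inv[OF w] fin])
      (auto simp: boundary_def permutes_inv_inv[OF w] c')
  show ?thesis
    unfolding eps_def intersection_number_def black white
    by (simp add: permutes_inv_inv[OF w] c')
qed

section \<open>Elementary moves\<close>

text \<open>
  The new edges reuse the old names as \<open>u1 = p1\<close>, \<open>u2 = q2\<close>, \<open>u3 = q4\<close>, \<open>r1 = p2\<close>, \<open>r3 = q3\<close>, \<open>r4 = p4\<close>.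
  With this choice \<open>entry\<close> is the identity, and neither the set of edges nor \<open>fc\<close> changes.
\<close>

definition spider_result ::
  "('e, 'f) bip \<Rightarrow> 'e \<Rightarrow> 'e \<Rightarrow> 'e \<Rightarrow> 'e \<Rightarrow> 'e \<Rightarrow> 'e \<Rightarrow> ('e, 'f) bip" where
  "spider_result \<Gamma> p1 p2 p4 q2 q3 q4 = \<Gamma>\<lparr>
     brot := (brot \<Gamma>)(p1 := q2, q2 := q4, q4 := p1, p2 := q3, q3 := p4, p4 := p2),
     wrot := (wrot \<Gamma>)(p1 := p2, p2 := wrot \<Gamma> p1, q2 := wrot \<Gamma> p2,
       q3 := q4, q4 := wrot \<Gamma> q3, p4 := wrot \<Gamma> q4)\<rparr>"

lemma spider_result_simps [simp]:
  "edges (spider_result \<Gamma> p1 p2 p4 q2 q3 q4) = edges \<Gamma>"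
  "fc (spider_result \<Gamma> p1 p2 p4 q2 q3 q4) = fc \<Gamma>"
  by (simp_all add: spider_result_def)

lemma cycle3_permutes:
  assumes "a \<in> S" "b \<in> S" "c \<in> S"
  shows "(transpose a b \<circ> transpose b c) permutes S"
  using assms by (intro permutes_compose permutes_swap_id)

text \<open>Each new rotation is the old one precomposed with two disjoint 3-cycles, so it permutes
  the edges; the face condition remains to be checked on the six edges and on a generic one.\<close>

lemma spider_result:
  assumes wf: "wf_bip \<Gamma>"
    and dist: "distinct [p1, p2, p4, q2, q3, q4]" and E: "{p1, p2, p4, q2, q3, q4} \<subseteq> edges \<Gamma>"
    and bp: "brot \<Gamma> p1 = p2" "brot \<Gamma> p2 = p4" "brot \<Gamma> p4 = p1"
    and bq: "brot \<Gamma> q2 = q3" "brot \<Gamma> q3 = q4" "brot \<Gamma> q4 = q2"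
    and w: "wrot \<Gamma> q2 = p2" "wrot \<Gamma> p4 = q4"
    and white: "distinct (map (orbit (wrot \<Gamma>)) [p1, p2, q3, p4])"
    and F: "fc \<Gamma> p2 = F" "fc \<Gamma> q4 = F"
  shows "wf_bip (spider_result \<Gamma> p1 p2 p4 q2 q3 q4)" (is "wf_bip ?\<Delta>")
    and "spider F \<Gamma> (spider_result \<Gamma> p1 p2 p4 q2 q3 q4)"
proof -
  have fin: "finite (edges \<Gamma>)" and pb: "brot \<Gamma> permutes edges \<Gamma>" and pw: "wrot \<Gamma> permutes edges \<Gamma>"
    and c: "\<And>e. e \<in> edges \<Gamma> \<Longrightarrow> fc \<Gamma> (wrot \<Gamma> (brot \<Gamma> e)) = fc \<Gamma> e"
    using wf by (auto simp: wf_bip_def)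
  have neq: "p1 \<noteq> p2" "p1 \<noteq> p4" "p1 \<noteq> q2" "p1 \<noteq> q3" "p1 \<noteq> q4" "p2 \<noteq> p4" "p2 \<noteq> q2"
    "p2 \<noteq> q3" "p2 \<noteq> q4" "p4 \<noteq> q2" "p4 \<noteq> q3" "p4 \<noteq> q4" "q2 \<noteq> q3" "q2 \<noteq> q4" "q3 \<noteq> q4"
    using dist by simp_all
  have six: thesis if "e = p1 \<Longrightarrow> thesis" "e = p2 \<Longrightarrow> thesis" "e = p4 \<Longrightarrow> thesis" "e = q2 \<Longrightarrow> thesis"
      "e = q3 \<Longrightarrow> thesis" "e = q4 \<Longrightarrow> thesis"
      "e \<noteq> p1 \<Longrightarrow> e \<noteq> p2 \<Longrightarrow> e \<noteq> p4 \<Longrightarrow> e \<noteq> q2 \<Longrightarrow> e \<noteq> q3 \<Longrightarrow> e \<noteq> q4 \<Longrightarrow> thesis" for e thesis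
    using that by blast
  have "brot ?\<Delta> = brot \<Gamma> \<circ> ((transpose p1 q4 \<circ> transpose q4 p4) \<circ> (transpose q2 q3 \<circ> transpose q3 p2))"
  proof (rule ext)
    fix e show "brot ?\<Delta> e = (brot \<Gamma> \<circ> ((transpose p1 q4 \<circ> transpose q4 p4) \<circ> (transpose q2 q3 \<circ> transpose q3 p2))) e"
      by (cases rule: six[of e]) (simp_all add: spider_result_def bp bq neq neq[symmetric])
  qed
  then have b': "brot ?\<Delta> permutes edges \<Gamma>"
    using E by (auto intro!: permutes_compose[OF _ pb] permutes_compose[OF cycle3_permutes cycle3_permutes])
  have "wrot ?\<Delta> = wrot \<Gamma> \<circ> ((transpose p1 q2 \<circ> transpose q2 p2) \<circ> (transpose q3 p4 \<circ> transpose p4 q4))"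
  proof (rule ext)
    fix e show "wrot ?\<Delta> e = (wrot \<Gamma> \<circ> ((transpose p1 q2 \<circ> transpose q2 p2) \<circ> (transpose q3 p4 \<circ> transpose p4 q4))) e"
      by (cases rule: six[of e]) (simp_all add: spider_result_def w neq neq[symmetric])
  qed
  then have w': "wrot ?\<Delta> permutes edges \<Gamma>"
    using E by (auto intro!: permutes_compose[OF _ pw] permutes_compose[OF cycle3_permutes cycle3_permutes])
  have "fc \<Gamma> (wrot ?\<Delta> (brot ?\<Delta> e)) = fc \<Gamma> e" if e: "e \<in> edges \<Gamma>" for e
  proof -
    \<comment> \<open>\<open>brot\<close> maps the six edges onto themselves, so from any other edge
      one does not reach an edge whose \<open>wrot\<close> has changed.\<close>
    have pre: "brot \<Gamma> e = p1 \<longleftrightarrow> e = p4" "brot \<Gamma> e = p2 \<longleftrightarrow> e = p1" "brot \<Gamma> e = p4 \<longleftrightarrow> e = p2"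
      "brot \<Gamma> e = q2 \<longleftrightarrow> e = q4" "brot \<Gamma> e = q3 \<longleftrightarrow> e = q2" "brot \<Gamma> e = q4 \<longleftrightarrow> e = q3"
      using bp bq permutes_inv_eq[OF pb] by metis+
    show ?thesis
      by (cases rule: six[of e])
        (use c[OF e] in \<open>simp_all add: spider_result_def bp bq w F pre neq neq[symmetric]\<close>)
  qed
  with b' w' fin show wf': "wf_bip ?\<Delta>"
    by (simp add: wf_bip_def)
  have "{p1, q2, q4, p2, q3, p4} = {p1, p2, p4, q2, q3, q4}"
    by blast
  then have set1: "edges \<Gamma> - {p1, p2, p4, q2, q3, q4} \<union> {p1, q2, q4, p2, q3, p4} = edges \<Gamma>"
    and set2: "{p1, q2, q4, p2, q3, p4} \<inter> (edges \<Gamma> - {p1, p2, p4, q2, q3, q4}) = {}"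
    using E by (simp_all only: Un_commute Diff_partition Diff_disjoint)
  have entry: "(if e = p1 then p1 else if e = q2 then q2 else if e = q3 then q3 else if e = p4 then p4 else e) = e" for e
    by simp
  have "distinct [p1, q2, q4, p2, q3, p4]"
    using dist by auto
  note conf = dist E bp bq w white F this
  have "brot ?\<Delta> p1 = q2" "brot ?\<Delta> q2 = q4" "brot ?\<Delta> q4 = p1" "brot ?\<Delta> p2 = q3" "brot ?\<Delta> q3 = p4" "brot ?\<Delta> p4 = p2"
    "wrot ?\<Delta> p1 = p2" "wrot ?\<Delta> p2 = wrot \<Gamma> p1" "wrot ?\<Delta> q2 = wrot \<Gamma> p2" "wrot ?\<Delta> q3 = q4"
    "wrot ?\<Delta> q4 = wrot \<Gamma> q3" "wrot ?\<Delta> p4 = wrot \<Gamma> q4"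
    "\<forall>e\<in>edges \<Gamma> - {p1, p2, p4, q2, q3, q4}. brot ?\<Delta> e = brot \<Gamma> e \<and> wrot ?\<Delta> e = wrot \<Gamma> e \<and> fc \<Gamma> e = fc \<Gamma> e"
    by (simp_all add: spider_result_def neq neq[symmetric])
  note conf = conf this
  show "spider F \<Gamma> ?\<Delta>"
    unfolding spider_def spider_black_def Let_def
    apply (intro disjI1 conjI wf wf')
    apply (rule exI[of _ p1], rule exI[of _ p2], rule exI[of _ p4], rule exI[of _ q2], rule exI[of _ q3], rule exI[of _ q4])
    apply (rule exI[of _ p1], rule exI[of _ q2], rule exI[of _ q4], rule exI[of _ p2], rule exI[of _ q3], rule exI[of _ p4])
    unfolding entry spider_result_simps set1 by (intro conjI conf set2 refl)
qed

text \<open>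
  The consecutive edges \<open>l\<close>, \<open>n\<close> at a black vertex are split off to a new trivalent black vertex with
  edges \<open>l, n, y\<close>; the edge \<open>z\<close> takes their place at the old vertex.
\<close>

definition expand_result :: "('e, 'f) bip \<Rightarrow> 'e \<Rightarrow> 'e \<Rightarrow> 'e \<Rightarrow> 'e \<Rightarrow> ('e, 'f) bip" where
  "expand_result \<Gamma> l n y z = \<lparr>edges = insert y (insert z (edges \<Gamma>)),
     brot = transpose l z \<circ> brot \<Gamma> \<circ> (transpose z n \<circ> transpose n y),
     wrot = (wrot \<Gamma>)(y := z, z := y),
     fc = (fc \<Gamma>)(y := fc \<Gamma> (wrot \<Gamma> l), z := fc \<Gamma> n)\<rparr>"

lemma expand_result:
  assumes wf: "wf_bip \<Gamma>" and E: "l \<in> edges \<Gamma>" "n \<in> edges \<Gamma>"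
    and new: "y \<notin> edges \<Gamma>" "z \<notin> edges \<Gamma>" "y \<noteq> z"
    and ln: "brot \<Gamma> l = n" "l \<noteq> n"
  shows "wf_bip (expand_result \<Gamma> l n y z)" (is "wf_bip ?\<Delta>")
    and "shrink (expand_result \<Gamma> l n y z) \<Gamma>"
    and "e \<in> insert y (insert z (edges \<Gamma>)) \<Longrightarrow> brot (expand_result \<Gamma> l n y z) e =
      (if e = n then y else if e = y then l
       else let g = brot \<Gamma> (if e = z then n else e) in if g = l then z else g)"
proof -
  have fin: "finite (edges \<Gamma>)" and pb: "brot \<Gamma> permutes edges \<Gamma>" and pw: "wrot \<Gamma> permutes edges \<Gamma>"
    and c: "\<And>e. e \<in> edges \<Gamma> \<Longrightarrow> fc \<Gamma> (wrot \<Gamma> (brot \<Gamma> e)) = fc \<Gamma> e"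
    using wf by (auto simp: wf_bip_def)
  let ?E = "edges ?\<Delta>"
  have sub: "edges \<Gamma> \<subseteq> ?E" and yz: "y \<in> ?E" "z \<in> ?E" and ln': "l \<in> ?E" "n \<in> ?E"
    using E by (auto simp: expand_result_def)
  have neq: "l \<noteq> y" "l \<noteq> z" "n \<noteq> y" "n \<noteq> z"
    using E new by auto
  have fix_yz: "brot \<Gamma> y = y" "brot \<Gamma> z = z" "wrot \<Gamma> y = y" "wrot \<Gamma> z = z"
    using new pb pw by (simp_all add: permutes_not_in)
  have b': "brot ?\<Delta> permutes ?E"
    unfolding expand_result_def using yz ln' permutes_subset[OF pb sub]
    by (auto simp: expand_result_def intro!: permutes_compose cycle3_permutes permutes_swap_id)
  have "wrot ?\<Delta> = wrot \<Gamma> \<circ> transpose y z"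
    using fix_yz new by (auto simp: expand_result_def fun_eq_iff transpose_def)
  then have w': "wrot ?\<Delta> permutes ?E"
    using permutes_compose[OF permutes_swap_id[OF yz] permutes_subset[OF pw sub]] by simp
  have in_E: "brot \<Gamma> e \<noteq> y" "brot \<Gamma> e \<noteq> z" "wrot \<Gamma> e \<noteq> y" "wrot \<Gamma> e \<noteq> z" if "e \<in> edges \<Gamma>" for e
    using that new permutes_in_image[OF pb, of e] permutes_in_image[OF pw, of e] by auto
  have brot': "brot ?\<Delta> e = (if e = n then y else if e = y then l else
      let g = brot \<Gamma> (if e = z then n else e) in if g = l then z else g)" if "e \<in> ?E" for e
    using that new neq fix_yz in_E in_E[OF E(2)] by (auto simp: expand_result_def transpose_def Let_def)
  have wrot': "wrot ?\<Delta> y = z" "wrot ?\<Delta> z = y" "e \<in> edges \<Gamma> \<Longrightarrow> wrot ?\<Delta> e = wrot \<Gamma> e"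
    and fc': "fc ?\<Delta> y = fc \<Gamma> (wrot \<Gamma> l)" "fc ?\<Delta> z = fc \<Gamma> n" "e \<in> edges \<Gamma> \<Longrightarrow> fc ?\<Delta> e = fc \<Gamma> e" for e
    using new by (auto simp: expand_result_def)
  have w_in: "wrot \<Gamma> e \<in> edges \<Gamma> \<longleftrightarrow> e \<in> edges \<Gamma>" and b_in: "brot \<Gamma> e \<in> edges \<Gamma> \<longleftrightarrow> e \<in> edges \<Gamma>" for e
    using permutes_in_image[OF pw] permutes_in_image[OF pb] by auto
  \<comment> \<open>If \<open>brot\<close> led from \<open>e\<close> to \<open>l\<close>, the
    boundary now runs through \<open>z\<close> to \<open>y\<close>; this is why \<open>y\<close> is
    named after the face of \<open>wrot \<Gamma> l\<close>.\<close>
  have step: "fc ?\<Delta> (wrot ?\<Delta> (let g = brot \<Gamma> e in if g = l then z else g)) = fc \<Gamma> e" if e: "e \<in> edges \<Gamma>" for e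
  proof (cases "brot \<Gamma> e = l")
    case True
    then show ?thesis using c[OF e] by (simp add: wrot' fc')
  next
    case False
    then show ?thesis using c[OF e] e by (simp add: wrot' fc' w_in b_in)
  qed
  have "fc ?\<Delta> (wrot ?\<Delta> (brot ?\<Delta> e)) = fc ?\<Delta> e" if e: "e \<in> ?E" for e
  proof -
    consider "e = y" | "e = n" | "e = z" | "e \<in> edges \<Gamma>" "e \<noteq> y" "e \<noteq> n" "e \<noteq> z"
      using e by (auto simp: expand_result_def)
    then show ?thesis
    proof cases
      case 1
      then show ?thesis using E neq by (simp add: brot'[OF yz(1)] wrot' fc' w_in)
    next
      case 2
      then show ?thesis using E neq by (simp add: brot'[OF ln'(2)] wrot' fc')
    next
      case 3
      then show ?thesis using neq new step[OF E(2)] by (simp add: brot'[OF yz(2)] fc')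
    next
      case 4
      then show ?thesis using step[OF 4(1)] by (simp add: brot'[OF e] fc')
    qed
  qed
  with b' w' fin show wf': "wf_bip ?\<Delta>"
    by (simp add: wf_bip_def expand_result_def)
  have "y \<noteq> z" by fact
  \<comment> \<open>Shrinking requires two distinct black ends: the split-off vertex has only
    \<open>l\<close>, \<open>n\<close>, \<open>y\<close>, so \<open>z\<close> ends
    elsewhere.\<close>
  have orb: "orbit (brot ?\<Delta>) y \<subseteq> {l, n, y}"
  proof
    fix x assume "x \<in> orbit (brot ?\<Delta>) y"
    then show "x \<in> {l, n, y}"
      by induction (use brot'[OF yz(1)] brot'[OF ln'(1)] brot'[OF ln'(2)] neq ln in \<open>auto simp: Let_def\<close>)
  qed
  have diff: "edges \<Gamma> = ?E - {y, z}"
    using new by (auto simp: expand_result_def)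
  \<comment> \<open>All three iterates in the definition of shrinking can occur, the third one
    exactly when \<open>l\<close> and \<open>n\<close> were the only edges at the old
    vertex.\<close>
  have m: "(let m = (brot ?\<Delta>)(y := brot ?\<Delta> z, z := brot ?\<Delta> y) in
     brot \<Gamma> e = (if m e \<notin> {y, z} then m e else if m (m e) \<notin> {y, z} then m (m e) else m (m (m e))))"
    if e: "e \<in> edges \<Gamma>" for e
  proof -
    have yz': "e \<noteq> y" "e \<noteq> z" and e': "e \<in> ?E" using e new sub by auto
    show ?thesis
    proof (cases "e = n")
      case True
      then show ?thesis
        using neq \<open>y \<noteq> z\<close> in_E(1,2)[OF E(2)] by (simp add: brot'[OF ln'(2)] brot'[OF yz(1)] brot'[OF yz(2)] Let_def)
    next
      case False
      then show ?thesis
        using yz' neq \<open>y \<noteq> z\<close> in_E(1,2)[OF e] by (simp add: brot'[OF e'] brot'[OF yz(1)] Let_def)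
    qed
  qed
  have "z \<notin> orbit (brot ?\<Delta>) y"
    using orb neq \<open>y \<noteq> z\<close> by auto
  then have conf: "y \<in> ?E" "z \<in> ?E" "y \<noteq> z" "wrot ?\<Delta> y = z" "wrot ?\<Delta> z = y" "z \<notin> orbit (brot ?\<Delta>) y"
    "edges \<Gamma> = ?E - {y, z}" "\<And>e. e \<in> edges \<Gamma> \<Longrightarrow> wrot \<Gamma> e = wrot ?\<Delta> e"
    "\<And>e. e \<in> edges \<Gamma> \<Longrightarrow> fc \<Gamma> e = fc ?\<Delta> e"
    using yz new(3) diff by (auto simp: wrot' fc')
  show "shrink ?\<Delta> \<Gamma>"
    unfolding shrink_def shrink_white_def
    apply (intro disjI1 conjI wf wf')
    apply (rule exI[of _ y], rule exI[of _ z])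
    unfolding Let_def
    by (intro conjI ballI conf m[unfolded Let_def])
  show "e \<in> insert y (insert z (edges \<Gamma>)) \<Longrightarrow> brot ?\<Delta> e = (if e = n then y else if e = y then l
       else let g = brot \<Gamma> (if e = z then n else e) in if g = l then z else g)"
    using brot'[of e] by (simp add: expand_result_def)
qed

text \<open>The inverse construction, which removes a trivalent black vertex with edges \<open>l, n, y\<close>.\<close>

definition shrink_result :: "('e, 'f) bip \<Rightarrow> 'e \<Rightarrow> 'e \<Rightarrow> 'e \<Rightarrow> 'e \<Rightarrow> ('e, 'f) bip" where
  "shrink_result \<Gamma> l n y z = \<lparr>edges = edges \<Gamma> - {y, z},
     brot = transpose l z \<circ> brot \<Gamma> \<circ> (transpose n z \<circ> transpose z y),
     wrot = wrot \<Gamma> \<circ> transpose y z,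
     fc = fc \<Gamma>\<rparr>"

text \<open>The transpositions in the definition make \<open>y\<close> and \<open>z\<close> fixed
  points of both rotations, which therefore restrict to permutations of the remaining edges.\<close>

lemma shrink_result:
  assumes wf: "wf_bip \<Gamma>" and E: "{l, n, y, z} \<subseteq> edges \<Gamma>" and dist: "distinct [l, n, y, z]"
    and b: "brot \<Gamma> l = n" "brot \<Gamma> n = y" "brot \<Gamma> y = l"
    and w: "wrot \<Gamma> y = z" "wrot \<Gamma> z = y"
  shows "wf_bip (shrink_result \<Gamma> l n y z)" (is "wf_bip ?\<Delta>")
    and "shrink \<Gamma> (shrink_result \<Gamma> l n y z)"
    and "e \<in> edges \<Gamma> - {y, z} \<Longrightarrow> brot (shrink_result \<Gamma> l n y z) e =
      (let g = brot \<Gamma> (if e = n then z else e) in if g = z then l else g)"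
    and "e \<in> edges \<Gamma> - {y, z} \<Longrightarrow> wrot (shrink_result \<Gamma> l n y z) e = wrot \<Gamma> e"
proof -
  have fin: "finite (edges \<Gamma>)" and pb: "brot \<Gamma> permutes edges \<Gamma>" and pw: "wrot \<Gamma> permutes edges \<Gamma>"
    and c: "\<And>e. e \<in> edges \<Gamma> \<Longrightarrow> fc \<Gamma> (wrot \<Gamma> (brot \<Gamma> e)) = fc \<Gamma> e"
    using wf by (auto simp: wf_bip_def)
  have bl: "brot \<Gamma> e = l \<longleftrightarrow> e = y" "brot \<Gamma> e = y \<longleftrightarrow> e = n" "brot \<Gamma> e = n \<longleftrightarrow> e = l" for e
    using b permutes_inj[OF pb] by (metis injD)+
  have neq: "l \<noteq> n" "l \<noteq> y" "l \<noteq> z" "n \<noteq> y" "n \<noteq> z" "y \<noteq> z"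
    using dist by simp_all
  have brot': "brot ?\<Delta> e = (if e \<in> {y, z} then e else
      (let g = brot \<Gamma> (if e = n then z else e) in if g = z then l else g))" for e
    using dist b bl by (auto simp: shrink_result_def transpose_def Let_def)
  have wrot': "wrot ?\<Delta> e = (if e \<in> {y, z} then e else wrot \<Gamma> e)" for e
    using dist w by (auto simp: shrink_result_def transpose_def)
  have "brot ?\<Delta> permutes edges \<Gamma>"
    using E pb by (auto simp: shrink_result_def intro!: permutes_compose cycle3_permutes permutes_swap_id)
  then have b': "brot ?\<Delta> permutes edges ?\<Delta>"
    by (rule permutes_superset) (use brot' in \<open>auto simp: shrink_result_def\<close>)
  have "wrot ?\<Delta> permutes edges \<Gamma>"
    using E pw by (auto simp: shrink_result_def intro!: permutes_compose permutes_swap_id)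
  then have w': "wrot ?\<Delta> permutes edges ?\<Delta>"
    by (rule permutes_superset) (use wrot' in \<open>auto simp: shrink_result_def\<close>)
  have E': "l \<in> edges \<Gamma>" "n \<in> edges \<Gamma>" "y \<in> edges \<Gamma>" "z \<in> edges \<Gamma>"
    using E by auto
  have fyz: "fc \<Gamma> z = fc \<Gamma> n" "fc \<Gamma> (wrot \<Gamma> l) = fc \<Gamma> y"
    using c[OF E'(2)] c[OF E'(3)] b w by auto
  have "fc ?\<Delta> (wrot ?\<Delta> (brot ?\<Delta> e)) = fc ?\<Delta> e" if e: "e \<in> edges ?\<Delta>" for e
  proof -
    have e': "e \<in> edges \<Gamma>" "e \<noteq> y" "e \<noteq> z" using e by (auto simp: shrink_result_def)
    have fc: "fc ?\<Delta> = fc \<Gamma>" by (simp add: shrink_result_def)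
    show ?thesis
    proof (cases "e = n")
      case True
      then have "brot ?\<Delta> e = (if brot \<Gamma> z = z then l else brot \<Gamma> z)"
        using neq by (simp add: brot' Let_def)
      then show ?thesis
        using c[OF E'(4)] fyz bl(2)[of z] neq w True by (simp add: wrot' fc split: if_splits)
    next
      case False
      then have "brot ?\<Delta> e = (if brot \<Gamma> e = z then l else brot \<Gamma> e)"
        using e' by (simp add: brot' Let_def)
      then show ?thesis
        using c[OF e'(1)] fyz bl(2)[of e] neq w False by (simp add: wrot' fc split: if_splits)
    qed
  qed
  with b' w' fin show wf': "wf_bip ?\<Delta>"
    by (simp add: wf_bip_def shrink_result_def)
  have orb: "orbit (brot \<Gamma>) y \<subseteq> {l, n, y}"
  proof
    fix x assume "x \<in> orbit (brot \<Gamma>) y"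
    then show "x \<in> {l, n, y}"
      by induction (use b in auto)
  qed
  have m: "(let m = (brot \<Gamma>)(y := brot \<Gamma> z, z := brot \<Gamma> y) in
     brot ?\<Delta> e = (if m e \<notin> {y, z} then m e else if m (m e) \<notin> {y, z} then m (m e) else m (m (m e))))"
    if e: "e \<in> edges ?\<Delta>" for e
  proof -
    have e': "e \<in> edges \<Gamma>" "e \<noteq> y" "e \<noteq> z" using e by (auto simp: shrink_result_def)
    show ?thesis
    proof (cases "e = n")
      case True
      then show ?thesis
        using neq b bl(2)[of z] by (simp add: brot' Let_def)
    next
      case False
      then show ?thesis
        using e' neq b bl(2)[of e] by (simp add: brot' Let_def)
    qed
  qed
  have n: "edges ?\<Delta> = edges \<Gamma> - {y, z}" "fc ?\<Delta> = fc \<Gamma>" by (simp_all add: shrink_result_def)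
  have "z \<notin> orbit (brot \<Gamma>) y"
    using orb neq by auto
  then have conf: "y \<in> edges \<Gamma>" "z \<in> edges \<Gamma>" "y \<noteq> z" "wrot \<Gamma> y = z" "wrot \<Gamma> z = y" "z \<notin> orbit (brot \<Gamma>) y"
    "edges ?\<Delta> = edges \<Gamma> - {y, z}" "\<And>e. e \<in> edges ?\<Delta> \<Longrightarrow> wrot ?\<Delta> e = wrot \<Gamma> e"
    "\<And>e. e \<in> edges ?\<Delta> \<Longrightarrow> fc ?\<Delta> e = fc \<Gamma> e"
    using E' neq w n by (auto simp: wrot')
  show "shrink \<Gamma> ?\<Delta>"
    unfolding shrink_def shrink_white_def
    apply (intro disjI1 conjI wf wf')
    apply (rule exI[of _ y], rule exI[of _ z])
    unfolding Let_def
    by (intro conjI ballI conf m[unfolded Let_def])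
  show "e \<in> edges \<Gamma> - {y, z} \<Longrightarrow> brot ?\<Delta> e = (let g = brot \<Gamma> (if e = n then z else e) in if g = z then l else g)"
    by (simp add: brot')
  show "e \<in> edges \<Gamma> - {y, z} \<Longrightarrow> wrot ?\<Delta> e = wrot \<Gamma> e"
    by (simp add: wrot')
qed

section \<open>Mutations at quadrilaterals\<close>

lemma eps_swap: "wf_bip \<Gamma> \<Longrightarrow> eps \<Gamma> g f = - eps \<Gamma> f g"
  by (simp add: eps_eq sum_negf[symmetric] algebra_simps)

text \<open>Only \<open>p2\<close> and \<open>q4\<close> have \<open>F\<close> on their left.
  Reindexing one of the two sums by \<open>brot\<close> makes their successors count positively,
  while their predecessors count negatively.\<close>

lemma eps_quad:
  assumes wf: "wf_bip \<Gamma>" and F: "{e \<in> edges \<Gamma>. fc \<Gamma> e = F} = {p2, q4}" "p2 \<noteq> q4"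
    and b: "brot \<Gamma> p1 = p2" "brot \<Gamma> p2 = p4" "brot \<Gamma> q3 = q4" "brot \<Gamma> q4 = q2"
  shows "eps \<Gamma> F g = of_bool (fc \<Gamma> p4 = g) + of_bool (fc \<Gamma> q2 = g)
    - of_bool (fc \<Gamma> p1 = g) - of_bool (fc \<Gamma> q3 = g)"
proof -
  let ?E = "edges \<Gamma>" and ?b = "brot \<Gamma>"
  have fin: "finite ?E" and pb: "?b permutes ?E"
    using wf by (auto simp: wf_bip_def)
  have single: "(\<Sum>e\<in>?E. of_bool (fc \<Gamma> e = F) * k e) = k p2 + k q4" for k :: "_ \<Rightarrow> int"
  proof -
    have "(\<Sum>e\<in>?E. of_bool (fc \<Gamma> e = F) * k e) = (\<Sum>e\<in>{e \<in> ?E. fc \<Gamma> e = F}. k e)"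
      using fin by (simp add: sum.inter_filter of_bool_def if_distrib[of "\<lambda>x. x * _"] cong: if_cong)
    then show ?thesis using F by simp
  qed
  have "(\<Sum>e\<in>?E. of_bool (fc \<Gamma> (inv ?b e) = F) * of_bool (fc \<Gamma> e = g)) =
      (\<Sum>e\<in>?E. of_bool (fc \<Gamma> (inv ?b (?b e)) = F) * (of_bool (fc \<Gamma> (?b e) = g) :: int))"
    using sum.permute[OF pb, of "\<lambda>e. of_bool (fc \<Gamma> (inv ?b e) = F) * of_bool (fc \<Gamma> e = g)"] by (simp add: comp_def)
  moreover have "inv ?b p2 = p1" "inv ?b q4 = q3"
    using b by (simp_all add: permutes_inv_eq[OF pb])
  ultimately show ?thesis
    unfolding eps_eq[OF wf] sum_subtractf by (simp add: permutes_inverses(2)[OF pb] single b)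
qed

text \<open>The mutation at a quadrilateral with four distinct neighbours:
  \<open>eps \<Gamma> F g\<close> is 1 for \<open>g\<close> among \<open>a\<close>, \<open>b\<close>
  and -1 for \<open>g\<close> among \<open>c\<close>, \<open>d\<close>.\<close>

definition exchange_A :: "'f \<Rightarrow> 'f \<Rightarrow> 'f \<Rightarrow> 'f \<Rightarrow> 'f \<Rightarrow> ('f \<Rightarrow> complex) \<Rightarrow> 'f \<Rightarrow> complex" where
  "exchange_A F a b c d A = A(F := (A a * A b + A c * A d) / A F)"

text \<open>The X-rule uses \<open>eps\<close> in the transposed order, so it is \<open>a\<close>
  and \<open>b\<close> that receive the factor \<open>1 + X F\<close>.\<close>

definition exchange_X :: "'f \<Rightarrow> 'f \<Rightarrow> 'f \<Rightarrow> 'f \<Rightarrow> 'f \<Rightarrow> ('f \<Rightarrow> complex) \<Rightarrow> 'f \<Rightarrow> complex" where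
  "exchange_X F a b c d X g = (if g = F then inverse (X F)
    else if g \<in> {a, b} then X g * (1 + X F)
    else if g \<in> {c, d} then X g * inverse (1 + inverse (X F)) else X g)"

text \<open>Distinct neighbours leave only the values 1, -1 and 0 for
  \<open>eps \<Gamma> F g\<close>: nothing cancels and all exponents become 1.\<close>

lemma mut_A_quad:
  assumes wf: "wf_bip \<Gamma>" and F: "{e \<in> edges \<Gamma>. fc \<Gamma> e = F} = {p2, q4}" "p2 \<noteq> q4"
    and b: "brot \<Gamma> p1 = p2" "brot \<Gamma> p2 = p4" "brot \<Gamma> q3 = q4" "brot \<Gamma> q4 = q2"
    and d: "distinct [fc \<Gamma> p4, fc \<Gamma> q2, fc \<Gamma> p1, fc \<Gamma> q3]"
    and E: "{p1, p4, q2, q3} \<subseteq> edges \<Gamma>"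
  shows "mut_A \<Gamma> F A = into (torus_A \<Gamma>) (exchange_A F (fc \<Gamma> p4) (fc \<Gamma> q2) (fc \<Gamma> p1) (fc \<Gamma> q3) A)"
proof -
  have n: "fc \<Gamma> p4 \<noteq> fc \<Gamma> q2" "fc \<Gamma> p4 \<noteq> fc \<Gamma> p1" "fc \<Gamma> p4 \<noteq> fc \<Gamma> q3" "fc \<Gamma> q2 \<noteq> fc \<Gamma> p1"
    "fc \<Gamma> q2 \<noteq> fc \<Gamma> q3" "fc \<Gamma> p1 \<noteq> fc \<Gamma> q3"
    using d by auto
  note eps = eps_quad[OF wf F b]
  have "{g \<in> faces \<Gamma>. eps \<Gamma> F g > 0} = {fc \<Gamma> p4, fc \<Gamma> q2}"
    using n E by (auto simp: eps faces_def of_bool_def split: if_splits)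
  moreover have "{g \<in> faces \<Gamma>. eps \<Gamma> F g < 0} = {fc \<Gamma> p1, fc \<Gamma> q3}"
    using n E by (auto simp: eps faces_def of_bool_def split: if_splits)
  ultimately show ?thesis
    unfolding mut_A_def exchange_A_def using n n[symmetric] by (simp add: eps)
qed

lemma mut_X_quad:
  assumes wf: "wf_bip \<Gamma>" and F: "{e \<in> edges \<Gamma>. fc \<Gamma> e = F} = {p2, q4}" "p2 \<noteq> q4"
    and b: "brot \<Gamma> p1 = p2" "brot \<Gamma> p2 = p4" "brot \<Gamma> q3 = q4" "brot \<Gamma> q4 = q2"
    and d: "distinct [fc \<Gamma> p4, fc \<Gamma> q2, fc \<Gamma> p1, fc \<Gamma> q3]"
  shows "mut_X \<Gamma> F X = into (torus_X \<Gamma>) (exchange_X F (fc \<Gamma> p4) (fc \<Gamma> q2) (fc \<Gamma> p1) (fc \<Gamma> q3) X)"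
proof -
  have n: "fc \<Gamma> p4 \<noteq> fc \<Gamma> q2" "fc \<Gamma> p4 \<noteq> fc \<Gamma> p1" "fc \<Gamma> p4 \<noteq> fc \<Gamma> q3" "fc \<Gamma> q2 \<noteq> fc \<Gamma> p1"
    "fc \<Gamma> q2 \<noteq> fc \<Gamma> q3" "fc \<Gamma> p1 \<noteq> fc \<Gamma> q3"
    using d by auto
  note eps = eps_swap[OF wf, of _ F] eps_quad[OF wf F b]
  show ?thesis
    unfolding mut_X_def
    by (rule arg_cong[where f = "into _"]) (use n n[symmetric] in \<open>auto simp: fun_eq_iff exchange_X_def eps power_int_minus\<close>)
qed

lemma positive_on_exchange_A:
  assumes "positive_on V A" "{F, a, b, c, d} \<subseteq> V"
  shows "positive_on V (exchange_A F a b c d A)"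
proof -
  obtain r where r: "\<And>f. f \<in> V \<Longrightarrow> r f > 0 \<and> A f = complex_of_real (r f)"
    using assms(1) unfolding positive_on_def by metis
  have "exchange_A F a b c d A F = complex_of_real ((r a * r b + r c * r d) / r F)"
    using r assms(2) by (simp add: exchange_A_def)
  moreover have "(r a * r b + r c * r d) / r F > 0"
    using r assms(2) by (simp add: add_pos_pos)
  ultimately show ?thesis
    unfolding positive_on_def using r by (metis exchange_A_def fun_upd_other)
qed

lemma positive_on_exchange_X:
  assumes "positive_on V X" "F \<in> V"
  shows "positive_on V (exchange_X F a b c d X)"
proof -
  obtain r where r: "\<And>f. f \<in> V \<Longrightarrow> r f > 0 \<and> X f = complex_of_real (r f)"
    using assms(1) unfolding positive_on_def by metis
  show ?thesis
    unfolding positive_on_def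
  proof
    fix g assume g: "g \<in> V"
    let ?r = "if g = F then inverse (r F) else if g \<in> {a, b} then r g * (1 + r F)
      else if g \<in> {c, d} then r g * inverse (1 + inverse (r F)) else r g"
    have "exchange_X F a b c d X g = complex_of_real ?r"
      using r[OF g] r[OF assms(2)] by (simp add: exchange_X_def)
    moreover have "?r > 0"
      using r[OF g] r[OF assms(2)] by (simp add: add_pos_pos)
    ultimately show "\<exists>r>0. exchange_X F a b c d X g = complex_of_real r" by blast
  qed
qed

text \<open>The factors at one of \<open>a\<close>, \<open>b\<close> and one of \<open>c\<close>,
  \<open>d\<close> multiply to \<open>X F\<close>. The two pairs supply its square, which
  compensates for \<open>X F\<close> turning into its inverse.\<close>

lemma prod_exchange_X:
  assumes "finite V" "{F, a, b, c, d} \<subseteq> V" "distinct [F, a, b, c, d]" "X F \<noteq> 0" "1 + X F \<noteq> 0"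
  shows "(\<Prod>g\<in>V. exchange_X F a b c d X g) = (\<Prod>g\<in>V. X g)"
proof -
  define W where "W = V - {F, a, b, c, d}"
  have V: "V = {F, a, b, c, d} \<union> W" "{F, a, b, c, d} \<inter> W = {}" "finite W"
    using assms(1,2) by (auto simp: W_def)
  have W: "(\<Prod>g\<in>W. exchange_X F a b c d X g) = (\<Prod>g\<in>W. X g)"
    by (rule prod.cong) (auto simp: W_def exchange_X_def)
  have split: "(\<Prod>g\<in>V. Y g) = Y F * Y a * Y b * Y c * Y d * (\<Prod>g\<in>W. Y g)" for Y :: "_ \<Rightarrow> complex"
    unfolding V(1) using V(2,3) assms(3) by (subst prod.union_disjoint) auto
  define k where "k = inverse (1 + inverse (X F))"
  have k: "(1 + X F) * k = X F"
    using assms(4,5) by (simp add: k_def field_simps)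
  have "inverse (X F) * (X a * (1 + X F)) * (X b * (1 + X F)) * (X c * k) * (X d * k) =
      inverse (X F) * ((1 + X F) * k) * ((1 + X F) * k) * (X a * X b * X c * X d)"
    by (simp only: ac_simps)
  also have "\<dots> = X F * X a * X b * X c * X d"
    unfolding k using assms(4) by simp
  finally show ?thesis
    unfolding split W using assms(3) by (simp add: exchange_X_def k_def split: if_splits) auto
qed

text \<open>
  In the following two lemmas \<open>op\<close> and \<open>om\<close> stand for the six outer faces along the hexagon; some of
  the \<open>op\<close> may coincide with some of the \<open>om\<close>.
\<close>

lemma exchange_A_four:
  assumes f: "distinct [f1, f2, f3]"
    and o: "{op1, op2, op3, om1, om2, om3} \<inter> {f1, f2, f3} = {}"
    and A1: "A1 = exchange_A f1 f2 om3 f3 op1 A0" and A2: "A2 = exchange_A f2 f1 om1 op1 op2 A1"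
    and A3: "A3 = exchange_A f3 om3 om2 f1 op3 A2" and A4: "A4 = exchange_A f1 f2 om2 op2 f3 A3"
    and A0f: "A0 f1 = b0 * p1" "A0 f2 = b0 * p2" "A0 f3 = b0 * p3"
    and A0o: "A0 op1 = p1 * q1" "A0 op2 = p2 * q2" "A0 op3 = p3 * q3"
      "A0 om1 = p2 * q1" "A0 om2 = p3 * q2" "A0 om3 = p1 * q3"
    and nz: "b0 \<noteq> 0" "p1 \<noteq> 0" "p2 \<noteq> 0" "p3 \<noteq> 0" "A1 f1 \<noteq> 0"
    and b7: "b7 = (p1 * q2 + p2 * q3 + p3 * q1) / b0"
  shows "A4 f1 = q2 * b7" "A4 f2 = q1 * b7" "A4 f3 = q3 * b7" "g \<notin> {f1, f2, f3} \<Longrightarrow> A4 g = A0 g"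
proof -
  have n: "f1 \<noteq> f2" "f1 \<noteq> f3" "f2 \<noteq> f3" "op1 \<noteq> f1" "op1 \<noteq> f2" "op1 \<noteq> f3" "op2 \<noteq> f1" "op2 \<noteq> f2" "op2 \<noteq> f3"
    "op3 \<noteq> f1" "op3 \<noteq> f2" "op3 \<noteq> f3" "om1 \<noteq> f1" "om1 \<noteq> f2" "om1 \<noteq> f3" "om2 \<noteq> f1" "om2 \<noteq> f2" "om2 \<noteq> f3"
    "om3 \<noteq> f1" "om3 \<noteq> f2" "om3 \<noteq> f3"
    using f o by auto
  note n = n n[symmetric]
  \<comment> \<open>The first exchange after cancelling \<open>b0 * p1\<close>. It is
    \<open>b0 * b7\<close> without the term \<open>p1 * q2\<close>, which the second and the third
    exchange each supply.\<close>
  define u where "u = p3 * q1 + p2 * q3"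
  have 1: "A1 f1 = u"
    using nz by (simp add: A1 exchange_A_def A0f A0o n u_def field_simps)
  have 2: "A2 f2 = q1 * b7"
    using nz by (simp add: A2 exchange_A_def 1 n) (simp add: A1 exchange_A_def A0f A0o n b7 u_def field_simps)
  have 21: "A2 f1 = u" using 1 by (simp add: A2 exchange_A_def n)
  have 3: "A3 f3 = q3 * b7"
    using nz by (simp add: A3 exchange_A_def 21 n)
      (simp add: A2 A1 exchange_A_def A0f A0o n b7 u_def field_simps)
  have 31: "A3 f1 = u" "A3 f2 = q1 * b7" using 21 2 by (simp_all add: A3 exchange_A_def n)
  have u: "u \<noteq> 0" using nz 1 by simp
  have "A4 f1 = (q1 * b7 * (p3 * q2) + p2 * q2 * (q3 * b7)) / u"
    by (simp add: A4 exchange_A_def 31 3 n) (simp add: A3 A2 A1 exchange_A_def A0o n)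
  \<comment> \<open>Both summands contain \<open>q2 * b7\<close>, and the remaining factors add up
    to \<open>u\<close>.\<close>
  also have "\<dots> = u * (q2 * b7) / u"
    by (simp add: u_def algebra_simps)
  finally show "A4 f1 = q2 * b7" using u by simp
  show "A4 f2 = q1 * b7" "A4 f3 = q3 * b7" "g \<notin> {f1, f2, f3} \<Longrightarrow> A4 g = A0 g"
    using 3 31 by (simp_all add: A4 exchange_A_def n) (simp add: A3 A2 A1 exchange_A_def)
qed

lemma inverse_one_plus_inverse: "x \<noteq> 0 \<Longrightarrow> inverse (1 + inverse x) = x / (1 + x)" for x :: complex
  by (simp add: field_simps)

lemma exchange_X_four:
  assumes f: "distinct [f1, f2, f3]"
    and o: "{op1, op2, op3, om1, om2, om3} \<inter> {f1, f2, f3} = {}"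
    and oo: "op1 \<noteq> op2" "op2 \<noteq> op3" "op3 \<noteq> op1" "om1 \<noteq> om2" "om2 \<noteq> om3" "om3 \<noteq> om1"
      "op1 \<noteq> om1" "op2 \<noteq> om2" "op3 \<noteq> om3" "om1 \<noteq> op2" "om2 \<noteq> op3" "om3 \<noteq> op1"
    and X1: "X1 = exchange_X f1 f2 om3 f3 op1 X0" and X2: "X2 = exchange_X f2 f1 om1 op1 op2 X1"
    and X3: "X3 = exchange_X f3 om3 om2 f1 op3 X2" and X4: "X4 = exchange_X f1 f2 om2 op2 f3 X3"
    and X0: "X0 f1 = c1 / c3" "X0 f2 = c2 / c1" "X0 f3 = c3 / c2"
    and nz: "c1 \<noteq> 0" "c2 \<noteq> 0" "c3 \<noteq> 0" "X1 f2 \<noteq> 0" "X2 f1 \<noteq> 0"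
    and S: "S = c1 * c2 + c2 * c3 + c3 * c1"
  shows "X4 f1 = c1 / c3" "X4 f2 = c3 / c2" "X4 f3 = c2 / c1" "S \<noteq> 0"
    "g \<notin> {f1, f2, f3} \<Longrightarrow> X4 g = X0 g *
      (if g = op1 then c1 * c2 / S else 1) * (if g = op2 then c2 * c3 / S else 1) * (if g = op3 then c3 * c1 / S else 1) *
      (if g = om1 then S / (c3 * c1) else 1) * (if g = om2 then S / (c1 * c2) else 1) * (if g = om3 then S / (c2 * c3) else 1)"
proof -
  have n: "f1 \<noteq> f2" "f1 \<noteq> f3" "f2 \<noteq> f3" "op1 \<noteq> f1" "op1 \<noteq> f2" "op1 \<noteq> f3" "op2 \<noteq> f1" "op2 \<noteq> f2" "op2 \<noteq> f3"
    "op3 \<noteq> f1" "op3 \<noteq> f2" "op3 \<noteq> f3" "om1 \<noteq> f1" "om1 \<noteq> f2" "om1 \<noteq> f3" "om2 \<noteq> f1" "om2 \<noteq> f2" "om2 \<noteq> f3"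
    "om3 \<noteq> f1" "om3 \<noteq> f2" "om3 \<noteq> f3"
    using f o by auto
  note n = n n[symmetric] oo oo[symmetric]
  have X1v: "X1 f1 = c3 / c1" "X1 f2 = c2 * (c1 + c3) / (c1 * c3)" "X1 f3 = c3 / c2 * inverse (1 + c3 / c1)"
    using nz(1-3) by (simp_all add: X1 exchange_X_def X0 n field_simps)
  \<comment> \<open>The factor \<open>c1 + c3\<close>, and later \<open>S\<close>, appears in the
    numerator of an intermediate coordinate that is nonzero by \<open>nz\<close>.\<close>
  then have c13: "c1 + c3 \<noteq> 0" using nz by auto
  have t1: "1 + c1 / c3 = (c1 + c3) / c3" "inverse (1 + c3 / c1) = c1 / (c1 + c3)"
    "1 + X1 f2 = S / (c1 * c3)"
    using nz(1-3) c13 by (simp_all add: X1v S field_simps)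
  have "X2 f1 = c3 / c1 * (S / (c1 * c3))"
    by (simp add: X2 exchange_X_def n t1(3) X1v(1))
  then show S0: "S \<noteq> 0" using nz by auto
  have i2: "inverse (1 + inverse (X1 f2)) = c2 * (c1 + c3) / S"
    using nz c13 by (simp add: inverse_one_plus_inverse t1(3)) (simp add: X1v)
  have X2v: "X2 f1 = S / (c1 * c1)" "X2 f2 = c1 * c3 / (c2 * (c1 + c3))" "X2 f3 = c1 * c3 / (c2 * (c1 + c3))"
    using nz(1-3) c13 \<open>X2 f1 = _\<close> by (simp_all add: X2 exchange_X_def n X1v t1)
  have S': "S = c2 * (c1 + c3) + c1 * c3"
    by (simp add: S algebra_simps)
  have t3: "1 + X2 f3 = S / (c2 * (c1 + c3))"
    using nz(1-3) c13 by (simp add: X2v S' add_divide_distrib)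
  have i3: "inverse (1 + inverse (X2 f3)) = c1 * c3 / S"
    using nz(1-3) c13 S0 t3 by (subst inverse_one_plus_inverse) (simp_all add: X2v(3) del: add_divide_distrib)
  have X3v: "X3 f1 = c3 / c1" "X3 f2 = c1 * c3 / (c2 * (c1 + c3))" "X3 f3 = c2 * (c1 + c3) / (c1 * c3)"
    using nz(1-3) c13 S0 by (simp_all add: X3 exchange_X_def n X2v(1,2) i3) (simp add: X2v(3))
  have t4: "1 + X3 f1 = (c1 + c3) / c1" "inverse (1 + inverse (X3 f1)) = c3 / (c1 + c3)"
    using nz(1-3) c13 by (simp_all add: X3v field_simps)
  have "X4 f1 = inverse (X3 f1)" "X4 f2 = X3 f2 * (1 + X3 f1)" "X4 f3 = X3 f3 * inverse (1 + inverse (X3 f1))"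
    by (simp_all add: X4 exchange_X_def n)
  then show "X4 f1 = c1 / c3" "X4 f2 = c3 / c2" "X4 f3 = c2 / c1"
    unfolding t4 unfolding X3v using nz(1-3) c13 by simp_all
  assume g: "g \<notin> {f1, f2, f3}"
  \<comment> \<open>The factors are kept as a product of conditionals because one face may be both
    an \<open>op\<close> and an \<open>om\<close>; within a single mutation the conditions exclude
    each other.\<close>
  have 1: "X1 g = X0 g * (if g = om3 then (c1 + c3) / c3 else 1) * (if g = op1 then c1 / (c1 + c3) else 1)"
    using g unfolding t1(1,2)[symmetric] X0(1)[symmetric] by (simp add: X1 exchange_X_def n X0)
  have 2: "X2 g = X1 g * (if g = om1 then S / (c1 * c3) else 1) * (if g = op1 then c2 * (c1 + c3) / S else 1)
      * (if g = op2 then c2 * (c1 + c3) / S else 1)"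
    using g unfolding t1(3)[symmetric] i2[symmetric] by (simp add: X2 exchange_X_def n)
  have 3: "X3 g = X2 g * (if g = om3 then S / (c2 * (c1 + c3)) else 1) * (if g = om2 then S / (c2 * (c1 + c3)) else 1)
      * (if g = op3 then c1 * c3 / S else 1)"
    using g unfolding t3[symmetric] i3[symmetric] by (simp add: X3 exchange_X_def n)
  have 4: "X4 g = X3 g * (if g = om2 then (c1 + c3) / c1 else 1) * (if g = op2 then c3 / (c1 + c3) else 1)"
    using g unfolding t4[symmetric] by (simp add: X4 exchange_X_def n)
  \<comment> \<open>The faces \<open>op1\<close>, \<open>op2\<close>, \<open>om2\<close>,
    \<open>om3\<close> neighbour two of the mutations each; the intermediate \<open>c1 + c3\<close>
    cancels between the two factors.\<close>
  have m1: "(if g = op1 then c1 / (c1 + c3) else 1) * (if g = op1 then c2 * (c1 + c3) / S else 1)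
      = (if g = op1 then c1 * c2 / S else 1)"
    "(if g = op2 then c2 * (c1 + c3) / S else 1) * (if g = op2 then c3 / (c1 + c3) else 1)
      = (if g = op2 then c2 * c3 / S else 1)"
    "(if g = om2 then S / (c2 * (c1 + c3)) else 1) * (if g = om2 then (c1 + c3) / c1 else 1)
      = (if g = om2 then S / (c1 * c2) else 1)"
    "(if g = om3 then (c1 + c3) / c3 else 1) * (if g = om3 then S / (c2 * (c1 + c3)) else 1)
      = (if g = om3 then S / (c2 * c3) else 1)"
    using c13 by (auto simp: mult.commute)
  show "X4 g = X0 g *
      (if g = op1 then c1 * c2 / S else 1) * (if g = op2 then c2 * c3 / S else 1) * (if g = op3 then c3 * c1 / S else 1) *
      (if g = om1 then S / (c3 * c1) else 1) * (if g = om2 then S / (c1 * c2) else 1) * (if g = om3 then S / (c2 * c3) else 1)"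
    unfolding 4 3 2 1 m1[symmetric] mult.commute[of c3 c1] by (simp only: ac_simps)
qed

lemma into_eq_Some_iff: "into T u = Some v \<longleftrightarrow> u \<in> T \<and> v = u"
  by (auto simp: into_def)

text \<open>Invariant sets separate orbits without computing them: \<open>A\<close> sets
  \<open>a\<close> apart from the rest, then \<open>B\<close> does so for \<open>b\<close> and
  \<open>C\<close> for \<open>c\<close>. The orbit of \<open>d\<close> may remain unknown.\<close>

lemma distinct_orbits4:
  assumes "r permutes E" "finite E"
    and "r ` A \<subseteq> A" "r ` B \<subseteq> B" "r ` C \<subseteq> C"
    and "a \<in> A" "b \<notin> A" "c \<notin> A" "d \<notin> A" "b \<in> B" "c \<notin> B" "d \<notin> B" "c \<in> C" "d \<notin> C"
  shows "distinct (map (orbit r) [a, b, c, d])"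
proof -
  have self: "s \<in> orbit r s" for s
    using assms(1,2) by (intro permutation_self_in_orbit) (auto simp: permutation_permutes)
  have "orbit r s \<noteq> orbit r t" if "r ` S \<subseteq> S" "s \<in> S" "t \<notin> S" for s t S
  proof
    assume "orbit r s = orbit r t"
    then have "t \<in> orbit r s" using self[of t] by simp
    then have "t \<in> S" by induction (use that in auto)
    then show False using that by simp
  qed
  note neq = this[OF assms(3,6,7)] this[OF assms(3,6,8)] this[OF assms(3,6,9)]
    this[OF assms(4,10,11)] this[OF assms(4,10,12)] this[OF assms(5,13,14)]
  show ?thesis
    unfolding list.map distinct.simps list.set by (intro conjI) (use neq in auto)
qed

section \<open>The hexagon\<close>

text \<open>An index type rather than the numbers 1, 2, 3: statements for all \<open>k\<close> need
  no membership condition.\<close>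

datatype three = One | Two | Three

fun succ3 :: "three \<Rightarrow> three" where
  "succ3 One = Two" | "succ3 Two = Three" | "succ3 Three = One"

lemma succ3_eq_iff [simp]: "succ3 j = succ3 k \<longleftrightarrow> j = k"
  by (cases j; cases k) simp_all

lemma three_succ3_cases: obtains j where "k = succ3 j"
  by (metis succ3.simps three.exhaust)

lemma UNIV_three: "UNIV = {One, Two, Three}"
  using three.exhaust by auto

lemma range_three: "range f = {f One, f Two, f Three}"
  by (simp add: UNIV_three)

text \<open>
  The edges \<open>x k\<close> join the centre to the three white vertices \<open>w\<^sub>k\<close>, and \<open>l k\<close>, \<open>m k\<close>, \<open>n k\<close> join \<open>w\<^sub>k\<close> to the
  boundary of the hexagon; \<open>l (succ3 k)\<close> and \<open>n k\<close> end at the same boundary vertex.  All faces are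
  quadrilaterals, hence have two edges on their left.  The inner faces are those of the \<open>x k\<close>,
  the outer faces next to the hexagon are those of the \<open>m k\<close> and \<open>n k\<close>, and the last two
  assumptions keep apart the outer faces that occur in the same mutation.
\<close>

locale hexagon =
  fixes \<Gamma> :: "('e, 'f) bip" and x l m n :: "three \<Rightarrow> 'e"
  assumes wf: "wf_bip \<Gamma>"
    and fc_eq_iff: "\<And>e e'. e \<in> edges \<Gamma> \<Longrightarrow> e' \<in> edges \<Gamma> \<Longrightarrow>
      fc \<Gamma> e = fc \<Gamma> e' \<longleftrightarrow> e' = e \<or> e' = wrot \<Gamma> (brot \<Gamma> e)"
    and in_edges [simp]: "\<And>k. x k \<in> edges \<Gamma>" "\<And>k. l k \<in> edges \<Gamma>" "\<And>k. m k \<in> edges \<Gamma>" "\<And>k. n k \<in> edges \<Gamma>"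
    and inj [simp]: "\<And>j k. x j = x k \<longleftrightarrow> j = k" "\<And>j k. l j = l k \<longleftrightarrow> j = k"
      "\<And>j k. m j = m k \<longleftrightarrow> j = k" "\<And>j k. n j = n k \<longleftrightarrow> j = k"
    and neq [simp]: "\<And>j k. x j \<noteq> l k" "\<And>j k. x j \<noteq> m k" "\<And>j k. x j \<noteq> n k"
      "\<And>j k. l j \<noteq> m k" "\<And>j k. l j \<noteq> n k" "\<And>j k. m j \<noteq> n k"
    and brot_x: "\<And>k. brot \<Gamma> (x k) = x (succ3 k)"
    and brot_l: "\<And>k. brot \<Gamma> (l (succ3 k)) = n k"
    and wrot_xlmn: "\<And>k. wrot \<Gamma> (x k) = l k" "\<And>k. wrot \<Gamma> (l k) = m k"
      "\<And>k. wrot \<Gamma> (m k) = n k" "\<And>k. wrot \<Gamma> (n k) = x k"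
    and brot_m_neq: "\<And>k. brot \<Gamma> (m k) \<noteq> m k" "\<And>j k. brot \<Gamma> (m k) \<noteq> l j"
    and brot_n_neq: "\<And>k. brot \<Gamma> (n k) \<noteq> l (succ3 k)" "\<And>j k. brot \<Gamma> (n k) \<noteq> m j"
begin

lemmas neq_sym [simp] = neq[symmetric]

abbreviation "x1 \<equiv> x One" abbreviation "x2 \<equiv> x Two" abbreviation "x3 \<equiv> x Three"
abbreviation "l1 \<equiv> l One" abbreviation "l2 \<equiv> l Two" abbreviation "l3 \<equiv> l Three"
abbreviation "m1 \<equiv> m One" abbreviation "m2 \<equiv> m Two" abbreviation "m3 \<equiv> m Three"
abbreviation "n1 \<equiv> n One" abbreviation "n2 \<equiv> n Two" abbreviation "n3 \<equiv> n Three"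

lemma brot_permutes: "brot \<Gamma> permutes edges \<Gamma>" and wrot_permutes: "wrot \<Gamma> permutes edges \<Gamma>"
  and finite_edges: "finite (edges \<Gamma>)"
  and fc_wrot_brot: "\<And>e. e \<in> edges \<Gamma> \<Longrightarrow> fc \<Gamma> (wrot \<Gamma> (brot \<Gamma> e)) = fc \<Gamma> e"
  using wf by (auto simp: wf_bip_def)

lemma brot_l123 [simp]: "brot \<Gamma> l1 = n3" "brot \<Gamma> l2 = n1" "brot \<Gamma> l3 = n2"
  using brot_l[of One] brot_l[of Two] brot_l[of Three] by simp_all

lemma brot_in [simp]: "brot \<Gamma> e \<in> edges \<Gamma> \<longleftrightarrow> e \<in> edges \<Gamma>"
  and wrot_in [simp]: "wrot \<Gamma> e \<in> edges \<Gamma> \<longleftrightarrow> e \<in> edges \<Gamma>"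
  using permutes_in_image[OF brot_permutes] permutes_in_image[OF wrot_permutes] by auto

lemma brot_eq_iff: "brot \<Gamma> e = brot \<Gamma> e' \<longleftrightarrow> e = e'" and wrot_eq_iff: "wrot \<Gamma> e = wrot \<Gamma> e' \<longleftrightarrow> e = e'"
  using permutes_inj[OF brot_permutes] permutes_inj[OF wrot_permutes] by (auto simp: inj_eq)

lemma brot_eq: "brot \<Gamma> e = x (succ3 k) \<longleftrightarrow> e = x k" "brot \<Gamma> e = n k \<longleftrightarrow> e = l (succ3 k)"
  using brot_eq_iff brot_x brot_l by metis+

lemma wrot_eq: "wrot \<Gamma> e = l k \<longleftrightarrow> e = x k" "wrot \<Gamma> e = m k \<longleftrightarrow> e = l k"
  "wrot \<Gamma> e = n k \<longleftrightarrow> e = m k" "wrot \<Gamma> e = x k \<longleftrightarrow> e = n k"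
  using wrot_eq_iff wrot_xlmn by metis+

lemma fc_l: "fc \<Gamma> l2 = fc \<Gamma> x1" "fc \<Gamma> l3 = fc \<Gamma> x2" "fc \<Gamma> l1 = fc \<Gamma> x3"
  using fc_wrot_brot[of x1] fc_wrot_brot[of x2] fc_wrot_brot[of x3]
  by (simp_all add: brot_x wrot_xlmn)

lemma fc_eq_x_iff:
  assumes "e \<in> edges \<Gamma>"
  shows "fc \<Gamma> e = fc \<Gamma> (x k) \<longleftrightarrow> e = x k \<or> e = l (succ3 k)"
  using fc_eq_iff[of "x k" e] assms by (auto simp: brot_x wrot_xlmn)

lemma fc_eq_m_iff:
  assumes "e \<in> edges \<Gamma>"
  shows "fc \<Gamma> e = fc \<Gamma> (m k) \<longleftrightarrow> e = m k \<or> brot \<Gamma> e = l k"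
  unfolding fc_eq_iff[OF assms in_edges(3)] by (metis wrot_eq(2))

lemma fc_eq_n_iff:
  assumes "e \<in> edges \<Gamma>"
  shows "fc \<Gamma> e = fc \<Gamma> (n k) \<longleftrightarrow> e = n k \<or> brot \<Gamma> e = m k"
  unfolding fc_eq_iff[OF assms in_edges(4)] by (metis wrot_eq(3))

lemma fc_x_neq [simp]: "fc \<Gamma> (x j) = fc \<Gamma> (x k) \<longleftrightarrow> j = k"
  "fc \<Gamma> (m j) \<noteq> fc \<Gamma> (x k)" "fc \<Gamma> (n j) \<noteq> fc \<Gamma> (x k)" "fc \<Gamma> (x k) \<noteq> fc \<Gamma> (m j)" "fc \<Gamma> (x k) \<noteq> fc \<Gamma> (n j)"
  by (simp_all add: fc_eq_x_iff fc_eq_m_iff fc_eq_n_iff brot_x)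

text \<open>Equality of two such faces would force one of the values of \<open>brot\<close> that the
  locale forbids. The faces of \<open>m k\<close> and \<open>n (succ3 k)\<close> are left out: these
  may coincide.\<close>

lemma fc_mn_neq [simp]: "fc \<Gamma> (m j) = fc \<Gamma> (m k) \<longleftrightarrow> j = k" "fc \<Gamma> (n j) = fc \<Gamma> (n k) \<longleftrightarrow> j = k"
  "fc \<Gamma> (m k) \<noteq> fc \<Gamma> (n k)" "fc \<Gamma> (n k) \<noteq> fc \<Gamma> (m k)"
  "fc \<Gamma> (n k) \<noteq> fc \<Gamma> (m (succ3 k))" "fc \<Gamma> (m (succ3 k)) \<noteq> fc \<Gamma> (n k)"
proof -
  show "fc \<Gamma> (m j) = fc \<Gamma> (m k) \<longleftrightarrow> j = k" "fc \<Gamma> (n j) = fc \<Gamma> (n k) \<longleftrightarrow> j = k"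
    by (simp_all add: fc_eq_m_iff fc_eq_n_iff brot_m_neq brot_n_neq)
  show mn: "fc \<Gamma> (m k) \<noteq> fc \<Gamma> (n k)" and nm: "fc \<Gamma> (n k) \<noteq> fc \<Gamma> (m (succ3 k))"
    using fc_eq_n_iff[OF in_edges(3), of k k] fc_eq_m_iff[OF in_edges(4), of k "succ3 k"] brot_m_neq(1)[of k] brot_n_neq(1)[of k]
    by simp_all
  show "fc \<Gamma> (n k) \<noteq> fc \<Gamma> (m k)" "fc \<Gamma> (m (succ3 k)) \<noteq> fc \<Gamma> (n k)"
    using mn nm by simp_all
qed

lemmas fc_n_m_neq [simp] = fc_mn_neq(5)[of One, simplified] fc_mn_neq(5)[of Two, simplified] fc_mn_neq(5)[of Three, simplified]
  fc_mn_neq(6)[of One, simplified] fc_mn_neq(6)[of Two, simplified] fc_mn_neq(6)[of Three, simplified]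

definition outer :: "'e set" where
  "outer = edges \<Gamma> - (range x \<union> range l \<union> range m \<union> range n)"

lemma outer_neq [simp]:
  assumes "e \<in> outer"
  shows "e \<in> edges \<Gamma>" "e \<noteq> x k" "e \<noteq> l k" "e \<noteq> m k" "e \<noteq> n k" "x k \<noteq> e" "l k \<noteq> e" "m k \<noteq> e" "n k \<noteq> e"
  using assms by (auto simp: outer_def)

lemma not_outer [simp]: "x k \<notin> outer" "l k \<notin> outer" "m k \<notin> outer" "n k \<notin> outer"
  unfolding outer_def by simp_all

lemma edges_eq: "edges \<Gamma> = outer \<union> {x1, x2, x3, l1, l2, l3, m1, m2, m3, n1, n2, n3}"
  by (auto simp: outer_def range_three)

end

section \<open>Splitting off three trivalent black vertices\<close>

locale fresh_hexagon = hexagon \<Gamma> x l m n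
  for \<Gamma> :: "('e, 'f) bip" and x l m n :: "three \<Rightarrow> 'e" +
  fixes y z :: "three \<Rightarrow> 'e"
  assumes yz_new [simp]: "\<And>k. y k \<notin> edges \<Gamma>" "\<And>k. z k \<notin> edges \<Gamma>"
    and yz_inj [simp]: "\<And>j k. y j = y k \<longleftrightarrow> j = k" "\<And>j k. z j = z k \<longleftrightarrow> j = k" "\<And>j k. y j \<noteq> z k"
begin

abbreviation "y1 \<equiv> y One" abbreviation "y2 \<equiv> y Two" abbreviation "y3 \<equiv> y Three"
abbreviation "z1 \<equiv> z One" abbreviation "z2 \<equiv> z Two" abbreviation "z3 \<equiv> z Three"

lemma yz_neq [simp]:
  assumes "e \<in> edges \<Gamma>"
  shows "e \<noteq> y k" "e \<noteq> z k" "y k \<noteq> e" "z k \<noteq> e"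
  using assms yz_new by blast+

lemma zy_neq [simp]: "z j \<noteq> y k"
  using yz_inj(3) by metis

lemma yz_not_outer [simp]: "y k \<notin> outer" "z k \<notin> outer"
  unfolding outer_def by simp_all

text \<open>
  \<open>K1\<close>, \<open>K2\<close>, \<open>H0\<close> arise by the three expansions, \<open>H1\<close> to \<open>H4\<close> by the spider moves, and \<open>L1\<close> to \<open>L3\<close>
  by shrinking the old white vertices.
\<close>

definition "K1 = expand_result \<Gamma> l1 n3 y1 z1"
definition "K2 = expand_result K1 l2 n1 y2 z2"
definition "H0 = expand_result K2 l3 n2 y3 z3"

text \<open>Joint effect of the three expansions at the old boundary vertices, where
  \<open>z k\<close> now stands in the place of \<open>l k\<close>.\<close>

definition zsub :: "'e \<Rightarrow> 'e" where
  "zsub e = (if e = l1 then z1 else if e = l2 then z2 else if e = l3 then z3 else e)"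

lemma K1: "wf_bip K1" "shrink K1 \<Gamma>" "edges K1 = edges \<Gamma> \<union> {y1, z1}"
  unfolding K1_def by (intro expand_result(1,2)[OF wf]; simp)+ (simp_all add: expand_result_def)

lemma K1_brot: "e \<in> edges \<Gamma> \<union> {y1, z1} \<Longrightarrow> brot K1 e =
    (if e = n3 then y1 else if e = y1 then l1
     else let g = brot \<Gamma> (if e = z1 then n3 else e) in if g = l1 then z1 else g)"
  unfolding K1_def by (rule expand_result(3)[OF wf]) simp_all

lemma K2: "wf_bip K2" "shrink K2 K1" "edges K2 = edges \<Gamma> \<union> {y1, z1, y2, z2}"
  unfolding K2_def by (intro expand_result(1,2)[OF K1(1)]; simp add: K1 K1_brot)+ (auto simp: expand_result_def K1)

lemma K2_brot: "e \<in> edges \<Gamma> \<union> {y1, z1, y2, z2} \<Longrightarrow> brot K2 e =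
    (if e = n1 then y2 else if e = y2 then l2
     else let g = brot K1 (if e = z2 then n1 else e) in if g = l2 then z2 else g)"
  unfolding K2_def by (rule expand_result(3)[OF K1(1)]) (auto simp: K1 K1_brot)

lemma H0: "wf_bip H0" "shrink H0 K2" "edges H0 = edges \<Gamma> \<union> {y1, z1, y2, z2, y3, z3}"
  unfolding H0_def by (intro expand_result(1,2)[OF K2(1)]; simp add: K2 K2_brot K1_brot)+ (auto simp: expand_result_def K2)

lemma H0_brot': "e \<in> edges \<Gamma> \<union> {y1, z1, y2, z2, y3, z3} \<Longrightarrow> brot H0 e =
    (if e = n2 then y3 else if e = y3 then l3
     else let g = brot K2 (if e = z3 then n2 else e) in if g = l3 then z3 else g)"
  unfolding H0_def by (rule expand_result(3)[OF K2(1)]) (auto simp: K2 K2_brot K1_brot)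

lemma H0_fc: "e \<in> edges \<Gamma> \<Longrightarrow> fc H0 e = fc \<Gamma> e"
  "fc H0 y1 = fc \<Gamma> m1" "fc H0 y2 = fc \<Gamma> m2" "fc H0 y3 = fc \<Gamma> m3"
  "fc H0 z1 = fc \<Gamma> n3" "fc H0 z2 = fc \<Gamma> n1" "fc H0 z3 = fc \<Gamma> n2"
  by (simp_all add: H0_def K2_def K1_def expand_result_def wrot_xlmn)

lemma H0_wrot_outer: "e \<in> edges \<Gamma> \<Longrightarrow> wrot H0 e = wrot \<Gamma> e"
  by (simp add: H0_def K2_def K1_def expand_result_def)

lemma H0_brot_outer: "e \<in> outer \<union> range m \<Longrightarrow> brot H0 e = zsub (brot \<Gamma> e)"
  by (auto simp: H0_brot' K2_brot K1_brot zsub_def Let_def)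

lemma H0_brot_z: "brot H0 z1 = zsub (brot \<Gamma> n3)" "brot H0 z2 = zsub (brot \<Gamma> n1)" "brot H0 z3 = zsub (brot \<Gamma> n2)"
  by (simp_all add: H0_brot' K2_brot K1_brot zsub_def Let_def)

lemma H0_brot:
  "brot H0 x1 = x2" "brot H0 x2 = x3" "brot H0 x3 = x1" "brot H0 l1 = n3" "brot H0 l2 = n1"
  "brot H0 l3 = n2" "brot H0 n1 = y2" "brot H0 n2 = y3" "brot H0 n3 = y1" "brot H0 y1 = l1"
  "brot H0 y2 = l2" "brot H0 y3 = l3"
  by (simp_all add: H0_brot' K2_brot K1_brot brot_x)

lemma H0_wrot:
  "wrot H0 x1 = l1" "wrot H0 x2 = l2" "wrot H0 x3 = l3" "wrot H0 l1 = m1" "wrot H0 l2 = m2"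
  "wrot H0 l3 = m3" "wrot H0 m1 = n1" "wrot H0 m2 = n2" "wrot H0 m3 = n3" "wrot H0 n1 = x1"
  "wrot H0 n2 = x2" "wrot H0 n3 = x3" "wrot H0 y1 = z1" "wrot H0 y2 = z2" "wrot H0 y3 = z3"
  "wrot H0 z1 = y1" "wrot H0 z2 = y2" "wrot H0 z3 = y3"
  by (simp_all add: H0_def K2_def K1_def expand_result_def wrot_xlmn)

lemma H0_fibre: "{e \<in> edges H0. fc H0 e = fc \<Gamma> (x k)} = {x k, l (succ3 k)}"
  by (auto simp: H0 H0_fc fc_eq_x_iff)

lemma faces_H0: "faces H0 = faces \<Gamma>"
proof -
  have "fc H0 ` {y1, z1, y2, z2, y3, z3} \<subseteq> fc \<Gamma> ` edges \<Gamma>"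
    by (simp add: H0_fc)
  moreover have "fc H0 ` edges \<Gamma> = fc \<Gamma> ` edges \<Gamma>"
    using H0_fc(1) by auto
  ultimately show ?thesis
    unfolding faces_def H0(3) image_Un by auto
qed

section \<open>The four spider moves\<close>

text \<open>\<open>P\<close> is the centre and \<open>Q\<close> the first split-off vertex; the face
  between them has \<open>x3\<close> and \<open>l1\<close> on its left.\<close>

definition "H1 = spider_result H0 x2 x3 x1 n3 y1 l1"

lemma H0_orbits: "distinct (map (orbit (wrot H0)) [x2, x3, y1, x1])"
proof -
  have "wrot H0 permutes edges H0" "finite (edges H0)"
    using H0(1) by (simp_all add: wf_bip_def)
  then show ?thesis
    by (rule distinct_orbits4[of _ _ "{x2, l2, m2, n2}" "{x3, l3, m3, n3}" "{y1, z1}"]) (simp_all add: H0_wrot)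
qed

lemma H1: "wf_bip H1" "spider (fc \<Gamma> x3) H0 H1" "edges H1 = edges H0" "fc H1 = fc H0"
  unfolding H1_def
  by (intro spider_result[OF H0(1) _ _ _ _ _ _ _ _ _ _ H0_orbits]; simp add: H0_brot H0_wrot H0 H0_fc fc_l)+ simp_all

lemma H1_brot:
  "brot H1 x1 = x3" "brot H1 x2 = n3" "brot H1 x3 = y1" "brot H1 l1 = x2" "brot H1 l2 = n1"
  "brot H1 l3 = n2" "brot H1 n1 = y2" "brot H1 n2 = y3" "brot H1 n3 = l1" "brot H1 y1 = x1"
  "brot H1 y2 = l2" "brot H1 y3 = l3"
  by (simp_all add: H1_def spider_result_def H0_brot)

lemma H1_wrot:
  "wrot H1 x1 = m1" "wrot H1 x2 = x3" "wrot H1 x3 = l2" "wrot H1 l1 = z1" "wrot H1 l2 = m2"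
  "wrot H1 l3 = m3" "wrot H1 m1 = n1" "wrot H1 m2 = n2" "wrot H1 m3 = n3" "wrot H1 n1 = x1"
  "wrot H1 n2 = x2" "wrot H1 n3 = l3" "wrot H1 y1 = l1" "wrot H1 y2 = z2" "wrot H1 y3 = z3"
  "wrot H1 z1 = y1" "wrot H1 z2 = y2" "wrot H1 z3 = y3"
  by (simp_all add: H1_def spider_result_def H0_wrot)

text \<open>\<open>P\<close> is one of the two vertices created by the first move, \<open>Q\<close>
  the second split-off vertex.\<close>

definition "H2 = spider_result H1 y1 x1 x3 n1 y2 l2"

lemma H1_orbits: "distinct (map (orbit (wrot H1)) [y1, x1, y2, x3])"
proof -
  have "wrot H1 permutes edges H1" "finite (edges H1)"
    using H1(1) by (simp_all add: wf_bip_def)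
  then show ?thesis
    by (rule distinct_orbits4[of _ _ "{y1, l1, z1}" "{x1, m1, n1}" "{y2, z2}"]) (simp_all add: H1_wrot)
qed

lemma H2: "wf_bip H2" "spider (fc \<Gamma> x1) H1 H2" "edges H2 = edges H0" "fc H2 = fc H0"
  unfolding H2_def
  by (intro spider_result[OF H1(1) _ _ _ _ _ _ _ _ _ _ H1_orbits]; simp add: H1_brot H1_wrot H0 H1 H0_fc fc_l)+ (simp_all add: H1)

lemma H2_brot:
  "brot H2 x1 = y2" "brot H2 x2 = n3" "brot H2 x3 = x1" "brot H2 l1 = x2" "brot H2 l2 = y1"
  "brot H2 l3 = n2" "brot H2 n1 = l2" "brot H2 n2 = y3" "brot H2 n3 = l1" "brot H2 y1 = n1"
  "brot H2 y2 = x3" "brot H2 y3 = l3"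
  by (simp_all add: H2_def spider_result_def H1_brot)

lemma H2_wrot:
  "wrot H2 x1 = l1" "wrot H2 x2 = x3" "wrot H2 x3 = m2" "wrot H2 l1 = z1" "wrot H2 l2 = z2"
  "wrot H2 l3 = m3" "wrot H2 m1 = n1" "wrot H2 m2 = n2" "wrot H2 m3 = n3" "wrot H2 n1 = m1"
  "wrot H2 n2 = x2" "wrot H2 n3 = l3" "wrot H2 y1 = x1" "wrot H2 y2 = l2" "wrot H2 y3 = z3"
  "wrot H2 z1 = y1" "wrot H2 z2 = y2" "wrot H2 z3 = y3"
  by (simp_all add: H2_def spider_result_def H1_wrot)

text \<open>\<open>P\<close> is the other vertex created by the first move, \<open>Q\<close> the
  third split-off vertex.\<close>

definition "H3 = spider_result H2 l1 x2 n3 n2 y3 l3"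

lemma H2_orbits: "distinct (map (orbit (wrot H2)) [l1, x2, y3, n3])"
proof -
  have "wrot H2 permutes edges H2" "finite (edges H2)"
    using H2(1) by (simp_all add: wf_bip_def)
  then show ?thesis
    by (rule distinct_orbits4[of _ _ "{l1, z1, y1, x1}" "{x2, x3, m2, n2}" "{y3, z3}"]) (simp_all add: H2_wrot)
qed

lemma H3: "wf_bip H3" "spider (fc \<Gamma> x2) H2 H3" "edges H3 = edges H0" "fc H3 = fc H0"
  unfolding H3_def
  by (intro spider_result[OF H2(1) _ _ _ _ _ _ _ _ _ _ H2_orbits]; simp add: H2_brot H2_wrot H0 H2 H0_fc fc_l)+ (simp_all add: H2)

lemma H3_brot:
  "brot H3 x1 = y2" "brot H3 x2 = y3" "brot H3 x3 = x1" "brot H3 l1 = n2" "brot H3 l2 = y1"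
  "brot H3 l3 = l1" "brot H3 n1 = l2" "brot H3 n2 = l3" "brot H3 n3 = x2" "brot H3 y1 = n1"
  "brot H3 y2 = x3" "brot H3 y3 = n3"
  by (simp_all add: H3_def spider_result_def H2_brot)

lemma H3_wrot:
  "wrot H3 x1 = l1" "wrot H3 x2 = z1" "wrot H3 x3 = m2" "wrot H3 l1 = x2" "wrot H3 l2 = z2"
  "wrot H3 l3 = z3" "wrot H3 m1 = n1" "wrot H3 m2 = n2" "wrot H3 m3 = n3" "wrot H3 n1 = m1"
  "wrot H3 n2 = x3" "wrot H3 n3 = m3" "wrot H3 y1 = x1" "wrot H3 y2 = l2" "wrot H3 y3 = l3"
  "wrot H3 z1 = y1" "wrot H3 z2 = y2" "wrot H3 z3 = y3"
  by (simp_all add: H3_def spider_result_def H2_wrot)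

text \<open>Back at the face of \<open>x3\<close>, which now lies between a vertex made by the
  second move and one made by the third. This move creates the new centre, with edges
  \<open>x1\<close>, \<open>x3\<close>, \<open>l3\<close>.\<close>

definition "H4 = spider_result H3 y2 x3 x1 n2 l3 l1"

lemma H3_orbits: "distinct (map (orbit (wrot H3)) [y2, x3, l3, x1])"
proof -
  have "wrot H3 permutes edges H3" "finite (edges H3)"
    using H3(1) by (simp_all add: wf_bip_def)
  then show ?thesis
    by (rule distinct_orbits4[of _ _ "{y2, l2, z2}" "{x3, m2, n2}" "{l3, z3, y3}"]) (simp_all add: H3_wrot)
qed

lemma H4: "wf_bip H4" "spider (fc \<Gamma> x3) H3 H4" "edges H4 = edges H0" "fc H4 = fc H0"
  unfolding H4_def
  by (intro spider_result[OF H3(1) _ _ _ _ _ _ _ _ _ _ H3_orbits]; simp add: H3_brot H3_wrot H0 H3 H0_fc fc_l)+ (simp_all add: H3)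

lemma H4_brot:
  "brot H4 x1 = x3" "brot H4 x2 = y3" "brot H4 x3 = l3" "brot H4 l1 = y2" "brot H4 l2 = y1"
  "brot H4 l3 = x1" "brot H4 n1 = l2" "brot H4 n2 = l1" "brot H4 n3 = x2" "brot H4 y1 = n1"
  "brot H4 y2 = n2" "brot H4 y3 = n3"
  by (simp_all add: H4_def spider_result_def H3_brot)

lemma H4_wrot:
  "wrot H4 x1 = x2" "wrot H4 x2 = z1" "wrot H4 x3 = l2" "wrot H4 l1 = z3" "wrot H4 l2 = z2"
  "wrot H4 l3 = l1" "wrot H4 m1 = n1" "wrot H4 m2 = n2" "wrot H4 m3 = n3" "wrot H4 n1 = m1"
  "wrot H4 n2 = m2" "wrot H4 n3 = m3" "wrot H4 y1 = x1" "wrot H4 y2 = x3" "wrot H4 y3 = l3"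
  "wrot H4 z1 = y1" "wrot H4 z2 = y2" "wrot H4 z3 = y3"
  by (simp_all add: H4_def spider_result_def H3_wrot)

lemma H4_outer: "e \<in> outer \<union> range m \<union> range z \<Longrightarrow> brot H4 e = brot H0 e"
  "e \<in> outer \<Longrightarrow> wrot H4 e = wrot \<Gamma> e"
  by (auto simp: H4_def H3_def H2_def H1_def spider_result_def H0_wrot_outer)

section \<open>Contracting the old white vertices\<close>

text \<open>Each old white vertex is left with \<open>m k\<close> and \<open>n k\<close>. Shrinking
  it merges the trivalent vertex of \<open>n k\<close> with the boundary vertex of
  \<open>m k\<close>, where the two other edges of the former replace \<open>m k\<close>.\<close>

definition "L1 = shrink_result H4 l2 y1 n1 m1"
definition "L2 = shrink_result L1 l1 y2 n2 m2"
definition "L3 = shrink_result L2 x2 y3 n3 m3"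

text \<open>The change at the boundary vertices in inherited names; \<open>relabel\<close> will turn
  it into \<open>hex_sub\<close>.\<close>

definition wsub :: "'e \<Rightarrow> 'e" where
  "wsub e = (if e = m1 then l2 else if e = m2 then l1 else if e = m3 then x2 else zsub e)"

lemma L1: "wf_bip L1" "shrink H4 L1" "edges L1 = edges H4 - {n1, m1}" "fc L1 = fc H0"
  unfolding L1_def
  by (intro shrink_result(1,2)[OF H4(1)]; simp add: H4 H0 H4_brot H4_wrot )+ (simp_all add: shrink_result_def H4)

lemma L1_brot: "e \<in> edges H4 - {n1, m1} \<Longrightarrow> brot L1 e =
    (let g = brot H4 (if e = y1 then m1 else e) in if g = m1 then l2 else g)"
  unfolding L1_def by (rule shrink_result(3)[OF H4(1)]) (simp_all add: H4 H0 H4_brot H4_wrot )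

lemma L1_wrot: "e \<in> edges H4 - {n1, m1} \<Longrightarrow> wrot L1 e = wrot H4 e"
  unfolding L1_def by (rule shrink_result(4)[OF H4(1)]) (simp_all add: H4 H0 H4_brot H4_wrot )

lemma L2: "wf_bip L2" "shrink L1 L2" "edges L2 = edges L1 - {n2, m2}" "fc L2 = fc H0"
  unfolding L2_def
  by (intro shrink_result(1,2)[OF L1(1)]; simp add: H4 H0 H4_brot H4_wrot L1 L1_brot L1_wrot )+ (simp_all add: shrink_result_def L1)

lemma L2_brot: "e \<in> edges L1 - {n2, m2} \<Longrightarrow> brot L2 e =
    (let g = brot L1 (if e = y2 then m2 else e) in if g = m2 then l1 else g)"
  unfolding L2_def by (rule shrink_result(3)[OF L1(1)]) (simp_all add: H4 H0 H4_brot H4_wrot L1 L1_brot L1_wrot )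

lemma L2_wrot: "e \<in> edges L1 - {n2, m2} \<Longrightarrow> wrot L2 e = wrot L1 e"
  unfolding L2_def by (rule shrink_result(4)[OF L1(1)]) (simp_all add: H4 H0 H4_brot H4_wrot L1 L1_brot L1_wrot )

lemma L3: "wf_bip L3" "shrink L2 L3" "edges L3 = edges L2 - {n3, m3}" "fc L3 = fc H0"
  unfolding L3_def
  by (intro shrink_result(1,2)[OF L2(1)]; simp add: H4 H0 H4_brot H4_wrot L1 L1_brot L1_wrot L2 L2_brot L2_wrot )+ (simp_all add: shrink_result_def L2)

lemma L3_brot: "e \<in> edges L2 - {n3, m3} \<Longrightarrow> brot L3 e =
    (let g = brot L2 (if e = y3 then m3 else e) in if g = m3 then x2 else g)"
  unfolding L3_def by (rule shrink_result(3)[OF L2(1)]) (simp_all add: H4 H0 H4_brot H4_wrot L1 L1_brot L1_wrot L2 L2_brot L2_wrot )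

lemma L3_wrot: "e \<in> edges L2 - {n3, m3} \<Longrightarrow> wrot L3 e = wrot L2 e"
  unfolding L3_def by (rule shrink_result(4)[OF L2(1)]) (simp_all add: H4 H0 H4_brot H4_wrot L1 L1_brot L1_wrot L2 L2_brot L2_wrot )

lemma edges_L3: "edges L3 = outer \<union> {x1, x2, x3, l1, l2, l3, y1, y2, y3, z1, z2, z3}"
  unfolding L1 L2 L3 H4 H0 edges_eq by auto

lemma L3_brot_outer: "e \<in> outer \<Longrightarrow> brot L3 e = wsub (brot \<Gamma> e)"
  by (simp add: L3_brot L2_brot L1_brot L3 L2 L1 H4 H0 H4_brot H4_outer H0_brot_outer wsub_def zsub_def Let_def)

lemma L3_wrot_outer: "e \<in> outer \<Longrightarrow> wrot L3 e = wrot \<Gamma> e"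
  by (simp add: L3_wrot L2_wrot L1_wrot L3 L2 L1 H4 H0 H4_wrot H4_outer)

lemma L3_brot_y: "brot L3 (y k) = wsub (brot \<Gamma> (m k))"
  using brot_m_neq by (cases k; simp add: L3_brot L2_brot L1_brot L3 L2 L1 H4 H0 H4_brot H4_outer H0_brot_outer wsub_def zsub_def Let_def)

lemma L3_brot_z: "brot L3 (z (succ3 k)) = wsub (brot \<Gamma> (n k))"
  using brot_n_neq by (cases k; simp add: L3_brot L2_brot L1_brot L3 L2 L1 H4 H0 H4_brot H4_outer H0_brot_z wsub_def zsub_def Let_def)

lemma L3_brot_xl:
  "brot L3 x1 = x3" "brot L3 x3 = l3" "brot L3 l3 = x1" "brot L3 l2 = y1" "brot L3 l1 = y2"
  "brot L3 x2 = y3"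
  by (simp_all add: L3_brot L2_brot L1_brot L3 L2 L1 H4 H0 H4_brot)

lemma L3_wrot_xlyz:
  "wrot L3 x1 = x2" "wrot L3 x2 = z1" "wrot L3 x3 = l2" "wrot L3 l1 = z3" "wrot L3 l2 = z2"
  "wrot L3 l3 = l1" "wrot L3 y1 = x1" "wrot L3 y2 = x3" "wrot L3 y3 = l3" "wrot L3 z1 = y1"
  "wrot L3 z2 = y2" "wrot L3 z3 = y3"
  by (simp_all add: L3_wrot L2_wrot L1_wrot L3 L2 L1 H4 H0 H4_wrot)

section \<open>Composition of the four mutations\<close>

definition "spiders = [(H0, fc \<Gamma> x3), (H1, fc \<Gamma> x1), (H2, fc \<Gamma> x2), (H3, fc \<Gamma> x3)]"

lemma moves_spiders: "moves \<Gamma> spiders L3"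
  unfolding spiders_def
  by (rule moves_expand[OF K1(2)] moves_expand[OF K2(2)] moves_expand[OF H0(2)]
      moves_spider[OF H1(2)] moves_spider[OF H2(2)] moves_spider[OF H3(2)] moves_spider[OF H4(2)]
      moves_shrink[OF L1(2)] moves_shrink[OF L2(2)] moves_shrink[OF L3(2)] moves_refl)+

lemma faces_H: "faces H1 = faces \<Gamma>" "faces H2 = faces \<Gamma>" "faces H3 = faces \<Gamma>"
  using faces_H0 by (simp_all add: faces_def H1 H2 H3)

lemma torus_H:
  "torus_A H0 = torus_A \<Gamma>" "torus_A H1 = torus_A \<Gamma>" "torus_A H2 = torus_A \<Gamma>" "torus_A H3 = torus_A \<Gamma>"
  "torus_X H0 = torus_X \<Gamma>" "torus_X H1 = torus_X \<Gamma>" "torus_X H2 = torus_X \<Gamma>" "torus_X H3 = torus_X \<Gamma>"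
  by (simp_all add: torus_A_def torus_X_def faces_H0 faces_H)

text \<open>The neighbours are read off the tables of rotations. Their order matches
  \<open>exchange_A_four\<close> with the faces of \<open>x3\<close>, \<open>x1\<close>,
  \<open>x2\<close> as \<open>f1\<close>, \<open>f2\<close>, \<open>f3\<close> and those of
  \<open>m k\<close>, \<open>n k\<close> as the \<open>op\<close> and the \<open>om\<close>.\<close>

lemma mut_A_H:
  "mut_A H0 (fc \<Gamma> x3) A = into (torus_A \<Gamma>)
    (exchange_A (fc \<Gamma> x3) (fc \<Gamma> x1) (fc \<Gamma> n3) (fc \<Gamma> x2) (fc \<Gamma> m1) A)"
  "mut_A H1 (fc \<Gamma> x1) A = into (torus_A \<Gamma>)
    (exchange_A (fc \<Gamma> x1) (fc \<Gamma> x3) (fc \<Gamma> n1) (fc \<Gamma> m1) (fc \<Gamma> m2) A)"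
  "mut_A H2 (fc \<Gamma> x2) A = into (torus_A \<Gamma>)
    (exchange_A (fc \<Gamma> x2) (fc \<Gamma> n3) (fc \<Gamma> n2) (fc \<Gamma> x3) (fc \<Gamma> m3) A)"
  "mut_A H3 (fc \<Gamma> x3) A = into (torus_A \<Gamma>)
    (exchange_A (fc \<Gamma> x3) (fc \<Gamma> x1) (fc \<Gamma> n2) (fc \<Gamma> m2) (fc \<Gamma> x2) A)"
proof -
  show "mut_A H0 (fc \<Gamma> x3) A = into (torus_A \<Gamma>)
    (exchange_A (fc \<Gamma> x3) (fc \<Gamma> x1) (fc \<Gamma> n3) (fc \<Gamma> x2) (fc \<Gamma> m1) A)"
    unfolding torus_H(1)[symmetric]
    by (subst mut_A_quad[of H0 _ x3 l1 x2 x1 y1 n3])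
      (use H0_fibre[of Three] in \<open>simp_all add: H0 H0_fc H0_brot fc_l\<close>)
  show "mut_A H1 (fc \<Gamma> x1) A = into (torus_A \<Gamma>)
    (exchange_A (fc \<Gamma> x1) (fc \<Gamma> x3) (fc \<Gamma> n1) (fc \<Gamma> m1) (fc \<Gamma> m2) A)"
    unfolding torus_H(2)[symmetric]
    by (subst mut_A_quad[of H1 _ x1 l2 y1 x3 y2 n1])
      (use H0_fibre[of One] in \<open>simp_all add: H1 H0 H0_fc H1_brot fc_l\<close>)
  show "mut_A H2 (fc \<Gamma> x2) A = into (torus_A \<Gamma>)
    (exchange_A (fc \<Gamma> x2) (fc \<Gamma> n3) (fc \<Gamma> n2) (fc \<Gamma> x3) (fc \<Gamma> m3) A)"
    unfolding torus_H(3)[symmetric]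
    by (subst mut_A_quad[of H2 _ x2 l3 l1 n3 y3 n2])
      (use H0_fibre[of Two] in \<open>simp_all add: H2 H0 H0_fc H2_brot fc_l\<close>)
  show "mut_A H3 (fc \<Gamma> x3) A = into (torus_A \<Gamma>)
    (exchange_A (fc \<Gamma> x3) (fc \<Gamma> x1) (fc \<Gamma> n2) (fc \<Gamma> m2) (fc \<Gamma> x2) A)"
    unfolding torus_H(4)[symmetric]
    by (subst mut_A_quad[of H3 _ x3 l1 y2 x1 l3 n2])
      (use H0_fibre[of Three] in \<open>simp_all add: H3 H0 H0_fc H3_brot fc_l\<close>)
qed

lemma mut_X_H:
  "mut_X H0 (fc \<Gamma> x3) X = into (torus_X \<Gamma>)
    (exchange_X (fc \<Gamma> x3) (fc \<Gamma> x1) (fc \<Gamma> n3) (fc \<Gamma> x2) (fc \<Gamma> m1) X)"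
  "mut_X H1 (fc \<Gamma> x1) X = into (torus_X \<Gamma>)
    (exchange_X (fc \<Gamma> x1) (fc \<Gamma> x3) (fc \<Gamma> n1) (fc \<Gamma> m1) (fc \<Gamma> m2) X)"
  "mut_X H2 (fc \<Gamma> x2) X = into (torus_X \<Gamma>)
    (exchange_X (fc \<Gamma> x2) (fc \<Gamma> n3) (fc \<Gamma> n2) (fc \<Gamma> x3) (fc \<Gamma> m3) X)"
  "mut_X H3 (fc \<Gamma> x3) X = into (torus_X \<Gamma>)
    (exchange_X (fc \<Gamma> x3) (fc \<Gamma> x1) (fc \<Gamma> n2) (fc \<Gamma> m2) (fc \<Gamma> x2) X)"
proof -
  show "mut_X H0 (fc \<Gamma> x3) X = into (torus_X \<Gamma>)
    (exchange_X (fc \<Gamma> x3) (fc \<Gamma> x1) (fc \<Gamma> n3) (fc \<Gamma> x2) (fc \<Gamma> m1) X)"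
    unfolding torus_H(5)[symmetric]
    by (subst mut_X_quad[of H0 _ x3 l1 x2 x1 y1 n3])
      (use H0_fibre[of Three] in \<open>simp_all add: H0 H0_fc H0_brot fc_l\<close>)
  show "mut_X H1 (fc \<Gamma> x1) X = into (torus_X \<Gamma>)
    (exchange_X (fc \<Gamma> x1) (fc \<Gamma> x3) (fc \<Gamma> n1) (fc \<Gamma> m1) (fc \<Gamma> m2) X)"
    unfolding torus_H(6)[symmetric]
    by (subst mut_X_quad[of H1 _ x1 l2 y1 x3 y2 n1])
      (use H0_fibre[of One] in \<open>simp_all add: H1 H0 H0_fc H1_brot fc_l\<close>)
  show "mut_X H2 (fc \<Gamma> x2) X = into (torus_X \<Gamma>)
    (exchange_X (fc \<Gamma> x2) (fc \<Gamma> n3) (fc \<Gamma> n2) (fc \<Gamma> x3) (fc \<Gamma> m3) X)"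
    unfolding torus_H(7)[symmetric]
    by (subst mut_X_quad[of H2 _ x2 l3 l1 n3 y3 n2])
      (use H0_fibre[of Two] in \<open>simp_all add: H2 H0 H0_fc H2_brot fc_l\<close>)
  show "mut_X H3 (fc \<Gamma> x3) X = into (torus_X \<Gamma>)
    (exchange_X (fc \<Gamma> x3) (fc \<Gamma> x1) (fc \<Gamma> n2) (fc \<Gamma> m2) (fc \<Gamma> x2) X)"
    unfolding torus_H(8)[symmetric]
    by (subst mut_X_quad[of H3 _ x3 l1 y2 x1 l3 n2])
      (use H0_fibre[of Three] in \<open>simp_all add: H3 H0 H0_fc H3_brot fc_l\<close>)
qed

text \<open>\<open>p k\<close> and \<open>q k\<close> stand for the variables at the boundary
  vertices of \<open>l k\<close> and \<open>m k\<close>, \<open>b0\<close> and \<open>b7\<close> for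
  those of the old and the new centre.\<close>

lemma mutations_A_eq_Some:
  assumes "mutations mut_A spiders A0 = Some A"
    and A0: "\<And>k. A0 (fc \<Gamma> (x k)) = b0 * p (succ3 k)" "\<And>k. A0 (fc \<Gamma> (m k)) = p k * q k"
      "\<And>k. A0 (fc \<Gamma> (n k)) = p (succ3 k) * q k"
    and nz: "b0 \<noteq> 0" "\<And>k. p k \<noteq> 0"
    and b7: "b7 = (p One * q Two + p Two * q Three + p Three * q One) / b0"
  shows "A (fc \<Gamma> x1) = q One * b7" "A (fc \<Gamma> x2) = q Three * b7" "A (fc \<Gamma> x3) = q Two * b7"
    "g \<notin> {fc \<Gamma> x1, fc \<Gamma> x2, fc \<Gamma> x3} \<Longrightarrow> A g = A0 g"
proof -
  define A1 where "A1 = exchange_A (fc \<Gamma> x3) (fc \<Gamma> x1) (fc \<Gamma> n3) (fc \<Gamma> x2) (fc \<Gamma> m1) A0"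
  define A2 where "A2 = exchange_A (fc \<Gamma> x1) (fc \<Gamma> x3) (fc \<Gamma> n1) (fc \<Gamma> m1) (fc \<Gamma> m2) A1"
  define A3 where "A3 = exchange_A (fc \<Gamma> x2) (fc \<Gamma> n3) (fc \<Gamma> n2) (fc \<Gamma> x3) (fc \<Gamma> m3) A2"
  have "A1 \<in> torus_A \<Gamma>" and A: "A = exchange_A (fc \<Gamma> x3) (fc \<Gamma> x1) (fc \<Gamma> n2) (fc \<Gamma> m2) (fc \<Gamma> x2) A3"
    using assms(1) by (auto simp: spiders_def map_comp_Some_iff mut_A_H into_eq_Some_iff A1_def A2_def A3_def)
  \<comment> \<open>Definedness of the composition puts the intermediate point into the torus, so
    the auxiliary value may be divided by at the fourth mutation.\<close>
  then have "A1 (fc \<Gamma> x3) \<noteq> 0"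
    by (auto simp: torus_A_def faces_def)
  note four = exchange_A_four[of "fc \<Gamma> x3" "fc \<Gamma> x1" "fc \<Gamma> x2" "fc \<Gamma> m1" "fc \<Gamma> m2" "fc \<Gamma> m3" "fc \<Gamma> n1" "fc \<Gamma> n2" "fc \<Gamma> n3",
      OF _ _ A1_def A2_def A3_def A _ _ _ _ _ _ _ _ _ nz(1) _ _ _ this b7]
  show "A (fc \<Gamma> x1) = q One * b7" "A (fc \<Gamma> x2) = q Three * b7" "A (fc \<Gamma> x3) = q Two * b7"
    "g \<notin> {fc \<Gamma> x1, fc \<Gamma> x2, fc \<Gamma> x3} \<Longrightarrow> A g = A0 g"
    by (rule four; simp add: A0 nz insert_commute)+
qed

text \<open>The factors are grouped as ratios of a new to an old edge weight, one for each
  \<open>m k\<close> and \<open>n k\<close>, so that they can be absorbed into a product over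
  edges.\<close>

lemma mutations_X_eq_Some:
  assumes "mutations mut_X spiders X0 = Some X"
    and X0: "\<And>k. X0 (fc \<Gamma> (x k)) = c (succ3 k) / c k"
    and nz: "\<And>k. c k \<noteq> 0"
    and s: "\<And>k. s k = (c One * c Two + c Two * c Three + c Three * c One) / c (succ3 k)"
  shows "s k \<noteq> 0" "X (fc \<Gamma> x1) = s One / s Two" "X (fc \<Gamma> x2) = s Three / s One" "X (fc \<Gamma> x3) = s Two / s Three"
    "g \<notin> {fc \<Gamma> x1, fc \<Gamma> x2, fc \<Gamma> x3} \<Longrightarrow> X g = X0 g *
      (if g = fc \<Gamma> m1 then c One / s One else 1) * (if g = fc \<Gamma> m2 then c Two / s Two else 1) *
      (if g = fc \<Gamma> m3 then c Three / s Three else 1) *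
      (if g = fc \<Gamma> n1 then s Two / c One else 1) * (if g = fc \<Gamma> n2 then s Three / c Two else 1) *
      (if g = fc \<Gamma> n3 then s One / c Three else 1)"
proof -
  define X1 where "X1 = exchange_X (fc \<Gamma> x3) (fc \<Gamma> x1) (fc \<Gamma> n3) (fc \<Gamma> x2) (fc \<Gamma> m1) X0"
  define X2 where "X2 = exchange_X (fc \<Gamma> x1) (fc \<Gamma> x3) (fc \<Gamma> n1) (fc \<Gamma> m1) (fc \<Gamma> m2) X1"
  define X3 where "X3 = exchange_X (fc \<Gamma> x2) (fc \<Gamma> n3) (fc \<Gamma> n2) (fc \<Gamma> x3) (fc \<Gamma> m3) X2"
  have "X1 \<in> torus_X \<Gamma>" "X2 \<in> torus_X \<Gamma>"
    and X: "X = exchange_X (fc \<Gamma> x3) (fc \<Gamma> x1) (fc \<Gamma> n2) (fc \<Gamma> m2) (fc \<Gamma> x2) X3"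
    using assms(1) by (auto simp: spiders_def map_comp_Some_iff mut_X_H into_eq_Some_iff X1_def X2_def X3_def)
  then have X12: "X1 (fc \<Gamma> x1) \<noteq> 0" "X2 (fc \<Gamma> x3) \<noteq> 0"
    by (auto simp: torus_X_def faces_def)
  define S where "S = c One * c Two + c Two * c Three + c Three * c One"
  have s': "s One = S / c Two" "s Two = S / c Three" "s Three = S / c One"
    by (simp_all add: s S_def)
  note four = exchange_X_four[of "fc \<Gamma> x3" "fc \<Gamma> x1" "fc \<Gamma> x2" "fc \<Gamma> m1" "fc \<Gamma> m2" "fc \<Gamma> m3" "fc \<Gamma> n1" "fc \<Gamma> n2" "fc \<Gamma> n3",
      OF _ _ _ _ _ _ _ _ _ _ _ _ _ _ X1_def X2_def X3_def X _ _ _ nz nz nz X12 S_def]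
  have S: "S \<noteq> 0"
    by (rule four(4); simp add: X0)
  then show "s k \<noteq> 0"
    using nz by (cases k) (simp_all add: s')
  show "X (fc \<Gamma> x1) = s One / s Two" "X (fc \<Gamma> x2) = s Three / s One" "X (fc \<Gamma> x3) = s Two / s Three"
    by (subst four; simp add: X0 s' S)+
  have s2: "c One / s One = c One * c Two / S" "c Two / s Two = c Two * c Three / S" "c Three / s Three = c Three * c One / S"
    "s Two / c One = S / (c Three * c One)" "s Three / c Two = S / (c One * c Two)" "s One / c Three = S / (c Two * c Three)"
    by (simp_all add: s')
  show "g \<notin> {fc \<Gamma> x1, fc \<Gamma> x2, fc \<Gamma> x3} \<Longrightarrow> X g = X0 g *
      (if g = fc \<Gamma> m1 then c One / s One else 1) * (if g = fc \<Gamma> m2 then c Two / s Two else 1) *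
      (if g = fc \<Gamma> m3 then c Three / s Three else 1) *
      (if g = fc \<Gamma> n1 then s Two / c One else 1) * (if g = fc \<Gamma> n2 then s Three / c Two else 1) *
      (if g = fc \<Gamma> n3 then s One / c Three else 1)"
    unfolding s2 by (rule four(5); simp add: X0)
qed

lemma positive_on_imp_torus_A: "positive_on (faces \<Gamma>) A \<Longrightarrow> A \<in> torus_A \<Gamma>"
  by (force simp: positive_on_def torus_A_def)

text \<open>The exchange relations are subtraction-free: positive coordinates stay positive and
  never leave the domain.\<close>

lemma mutations_A_positive:
  assumes "positive_on (faces \<Gamma>) A0"
  shows "mutations mut_A spiders A0 \<noteq> None"
proof -
  have F: "fc \<Gamma> (x k) \<in> faces \<Gamma>" "fc \<Gamma> (m k) \<in> faces \<Gamma>" "fc \<Gamma> (n k) \<in> faces \<Gamma>" for k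
    by (simp_all add: faces_def)
  have step: "into (torus_A \<Gamma>) (exchange_A f a b c d A) = Some (exchange_A f a b c d A) \<and>
      positive_on (faces \<Gamma>) (exchange_A f a b c d A)"
    if "positive_on (faces \<Gamma>) A" "{f, a, b, c, d} \<subseteq> faces \<Gamma>" for f a b c d A
    using positive_on_exchange_A[OF that] positive_on_imp_torus_A by (simp add: into_def)
  have s: "\<exists>A'. mut_A H f A = Some A' \<and> positive_on (faces \<Gamma>) A'"
    if "positive_on (faces \<Gamma>) A" "(H, f) \<in> set spiders" for H f A
    using that step[OF that(1)] F by (auto simp: spiders_def mut_A_H)
  obtain A1 where A1: "mut_A H0 (fc \<Gamma> x3) A0 = Some A1" "positive_on (faces \<Gamma>) A1"
    using s[OF assms, of H0 "fc \<Gamma> x3"] by (auto simp: spiders_def)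
  obtain A2 where A2: "mut_A H1 (fc \<Gamma> x1) A1 = Some A2" "positive_on (faces \<Gamma>) A2"
    using s[OF A1(2), of H1 "fc \<Gamma> x1"] by (auto simp: spiders_def)
  obtain A3 where A3: "mut_A H2 (fc \<Gamma> x2) A2 = Some A3" "positive_on (faces \<Gamma>) A3"
    using s[OF A2(2), of H2 "fc \<Gamma> x2"] by (auto simp: spiders_def)
  obtain A4 where A4: "mut_A H3 (fc \<Gamma> x3) A3 = Some A4"
    using s[OF A3(2), of H3 "fc \<Gamma> x3"] by (auto simp: spiders_def)
  show ?thesis
    by (simp add: spiders_def map_comp_def A1 A2 A3 A4)
qed

text \<open>Besides positivity, the condition that all coordinates multiply to 1 has to be carried
  along; this takes a mutated face distinct from its four distinct neighbours.\<close>

lemma mutations_X_positive: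
  assumes "positive_on (faces \<Gamma>) X0" "(\<Prod>f\<in>faces \<Gamma>. X0 f) = 1"
  shows "mutations mut_X spiders X0 \<noteq> None"
proof -
  have F: "fc \<Gamma> (x k) \<in> faces \<Gamma>" "fc \<Gamma> (m k) \<in> faces \<Gamma>" "fc \<Gamma> (n k) \<in> faces \<Gamma>" for k
    by (simp_all add: faces_def)
  define good where "good X \<longleftrightarrow> positive_on (faces \<Gamma>) X \<and> (\<Prod>f\<in>faces \<Gamma>. X f) = 1" for X
  have fin: "finite (faces \<Gamma>)" by (simp add: faces_def finite_edges)
  have step: "into (torus_X \<Gamma>) (exchange_X f a b c d X) = Some (exchange_X f a b c d X) \<and>
      good (exchange_X f a b c d X)"
    if X: "good X" and V: "{f, a, b, c, d} \<subseteq> faces \<Gamma>" and dist: "distinct [f, a, b, c, d]" for f a b c d X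
  proof -
    obtain r where "r > 0" "X f = complex_of_real r"
      using X V by (auto simp: good_def positive_on_def)
    then have "X f \<noteq> 0" "1 + X f \<noteq> 0"
      by (auto simp: complex_eq_iff)
    then have prod: "(\<Prod>g\<in>faces \<Gamma>. exchange_X f a b c d X g) = 1"
      using prod_exchange_X[OF fin V dist] X by (simp add: good_def)
    have "positive_on (faces \<Gamma>) (exchange_X f a b c d X)"
      using X V by (intro positive_on_exchange_X) (auto simp: good_def)
    with prod show ?thesis
      by (force simp: good_def into_def torus_X_def positive_on_def)
  qed
  have s: "\<exists>X'. mut_X H f X = Some X' \<and> good X'"
    if "good X" "(H, f) \<in> set spiders" for H f X
    using that(2) step[OF that(1)] F by (auto simp: spiders_def mut_X_H)
  have "good X0" using assms by (simp add: good_def)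
  obtain X1 where X1: "mut_X H0 (fc \<Gamma> x3) X0 = Some X1" "good X1"
    using s[OF \<open>good X0\<close>, of H0 "fc \<Gamma> x3"] by (auto simp: spiders_def)
  obtain X2 where X2: "mut_X H1 (fc \<Gamma> x1) X1 = Some X2" "good X2"
    using s[OF X1(2), of H1 "fc \<Gamma> x1"] by (auto simp: spiders_def)
  obtain X3 where X3: "mut_X H2 (fc \<Gamma> x2) X2 = Some X3" "good X3"
    using s[OF X2(2), of H2 "fc \<Gamma> x2"] by (auto simp: spiders_def)
  obtain X4 where X4: "mut_X H3 (fc \<Gamma> x3) X3 = Some X4"
    using s[OF X3(2), of H3 "fc \<Gamma> x3"] by (auto simp: spiders_def)
  show ?thesis
    by (simp add: spiders_def map_comp_def X1 X2 X3 X4)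
qed

end

text \<open>
  Passage from a hexagon to the turned one: at the boundary vertices, \<open>m' k\<close> takes the place of
  the two edges \<open>l k\<close> and \<open>n (pred k)\<close>, and the two edges \<open>l' (succ3 k)\<close> and \<open>n' k\<close> that of \<open>m k\<close>.
  \<open>hex_sub\<close> replaces the first edge of each group.
\<close>

definition hex_sub :: "(three \<Rightarrow> 'e) \<Rightarrow> (three \<Rightarrow> 'e) \<Rightarrow> (three \<Rightarrow> 'e) \<Rightarrow> (three \<Rightarrow> 'e) \<Rightarrow> 'e \<Rightarrow> 'e" where
  "hex_sub l m l' m' e =
    (if e = l One then m' One else if e = l Two then m' Two else if e = l Three then m' Three
     else if e = m One then l' Two else if e = m Two then l' Three else if e = m Three then l' One else e)"

context hexagon
begin

text \<open>An \<open>x\<close> edge is reached only from an \<open>x\<close> edge and an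
  \<open>n\<close> edge only from an \<open>l\<close> edge. Hence from the listed edges one arrives
  where \<open>hex_sub\<close> either replaces the edge or leaves it alone.\<close>

lemma brot_cases:
  assumes "e \<in> outer \<union> range m \<union> range n"
  obtains k where "brot \<Gamma> e = l k" | k where "brot \<Gamma> e = m k" | "brot \<Gamma> e \<in> outer"
proof -
  have "e \<in> edges \<Gamma>" using assms by auto
  then have "brot \<Gamma> e \<in> edges \<Gamma>" by simp
  moreover have "brot \<Gamma> e \<noteq> x k" for k
  proof -
    have "brot \<Gamma> e = x k \<longleftrightarrow> e = x (succ3 (succ3 k))"
      using brot_eq(1)[of e "succ3 (succ3 k)"] by (cases k) simp_all
    then show ?thesis using assms by auto
  qed
  moreover have "brot \<Gamma> e \<noteq> n k" for k
    using brot_eq(2)[of e k] assms by auto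
  ultimately show thesis
    using that unfolding outer_def by blast
qed

end

lemma hex_sub_simps:
  assumes "\<And>j k. l j = l k \<longleftrightarrow> j = k" "\<And>j k. m j = m k \<longleftrightarrow> j = k" "\<And>j k. l j \<noteq> m k"
  shows "hex_sub l m l' m' (l k) = m' k" "hex_sub l m l' m' (m k) = l' (succ3 k)"
    "(\<And>k. e \<noteq> l k) \<Longrightarrow> (\<And>k. e \<noteq> m k) \<Longrightarrow> hex_sub l m l' m' e = e"
  using assms assms(3)[symmetric] by (cases k; simp add: hex_sub_def)+

text \<open>The turned hexagon inherits the non-coincidence conditions: via \<open>hex_sub\<close>
  those for \<open>m'\<close> reduce to those for \<open>n\<close>, and those for \<open>n'\<close>
  to those for \<open>m\<close>.\<close>

lemma (in hexagon) hexagon_targetI: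
  fixes x' l' m' n' :: "three \<Rightarrow> 'e"
  assumes "wf_bip \<Delta>" and "\<And>e e'. e \<in> edges \<Delta> \<Longrightarrow> e' \<in> edges \<Delta> \<Longrightarrow>
      fc \<Delta> e = fc \<Delta> e' \<longleftrightarrow> e' = e \<or> e' = wrot \<Delta> (brot \<Delta> e)"
    and "\<And>k. x' k \<in> edges \<Delta>" "\<And>k. l' k \<in> edges \<Delta>" "\<And>k. m' k \<in> edges \<Delta>" "\<And>k. n' k \<in> edges \<Delta>"
    and "\<And>j k. x' j = x' k \<longleftrightarrow> j = k" and inj_l: "\<And>j k. l' j = l' k \<longleftrightarrow> j = k"
    and inj_m: "\<And>j k. m' j = m' k \<longleftrightarrow> j = k" and "\<And>j k. n' j = n' k \<longleftrightarrow> j = k"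
    and "\<And>j k. x' j \<noteq> l' k" "\<And>j k. x' j \<noteq> m' k" "\<And>j k. x' j \<noteq> n' k"
      and lm: "\<And>j k. l' j \<noteq> m' k" and "\<And>j k. l' j \<noteq> n' k" "\<And>j k. m' j \<noteq> n' k"
    and "\<And>k. brot \<Delta> (x' k) = x' (succ3 k)" "\<And>k. brot \<Delta> (l' (succ3 k)) = n' k"
    and "\<And>k. wrot \<Delta> (x' k) = l' k" "\<And>k. wrot \<Delta> (l' k) = m' k"
      "\<And>k. wrot \<Delta> (m' k) = n' k" "\<And>k. wrot \<Delta> (n' k) = x' k"
    and out: "\<And>k. l' k \<notin> outer" "\<And>k. m' k \<notin> outer"
    and brot_n: "\<And>k. brot \<Delta> (n' k) = hex_sub l m l' m' (brot \<Gamma> (m k))"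
    and brot_m: "\<And>k. brot \<Delta> (m' (succ3 k)) = hex_sub l m l' m' (brot \<Gamma> (n k))"
  shows "hexagon \<Delta> x' l' m' n'"
proof -
  have hs: "hex_sub l m l' m' (l k) = m' k" "hex_sub l m l' m' (m k) = l' (succ3 k)" "e \<in> outer \<Longrightarrow> hex_sub l m l' m' e = e" for e k
    by (simp_all add: hex_sub_simps)
  have "brot \<Delta> (m' k) \<noteq> m' k \<and> brot \<Delta> (m' k) \<noteq> l' j" for j k
  proof -
    obtain i where k: "k = succ3 i" by (rule three_succ3_cases)
    show ?thesis
      unfolding k brot_m
      by (rule brot_cases[of "n i"]) (use brot_n_neq[of i] out in \<open>auto simp: hs inj_m lm lm[symmetric]\<close>)
  qed
  moreover have "brot \<Delta> (n' k) \<noteq> l' (succ3 k) \<and> brot \<Delta> (n' k) \<noteq> m' j" for j k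
    unfolding brot_n
    by (rule brot_cases[of "m k"]) (use brot_m_neq[of k] out in \<open>auto simp: hs inj_l lm\<close>)
  ultimately show ?thesis
    by (intro hexagon.intro) (use assms in simp_all)
qed

section \<open>Identification of the outcome with a given turned hexagon\<close>

text \<open>\<open>n' k\<close> is the last of the two edges replacing \<open>m k\<close>, and
  \<open>m' (succ3 k)\<close> replaces a pair ending in \<open>n k\<close>; so it is their
  successors that have to correspond.\<close>

locale hexagon_move = fresh_hexagon \<Gamma> x l m n y z + target: hexagon \<Delta> x' l' m' n'
  for \<Gamma> :: "('e, 'f) bip" and x l m n y z :: "three \<Rightarrow> 'e"
    and \<Delta> :: "('e, 'f) bip" and x' l' m' n' :: "three \<Rightarrow> 'e" +
  assumes outer_target: "target.outer = outer"
    and brot_target: "\<And>e. e \<in> outer \<Longrightarrow> brot \<Delta> e = hex_sub l m l' m' (brot \<Gamma> e)"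
      "\<And>k. brot \<Delta> (n' k) = hex_sub l m l' m' (brot \<Gamma> (m k))"
      "\<And>k. brot \<Delta> (m' (succ3 k)) = hex_sub l m l' m' (brot \<Gamma> (n k))"
    and wrot_target: "\<And>e. e \<in> outer \<Longrightarrow> wrot \<Delta> e = wrot \<Gamma> e"
begin

lemma outer_neq' [simp]:
  assumes "e \<in> outer"
  shows "e \<in> edges \<Delta>" "e \<noteq> x' k" "e \<noteq> l' k" "e \<noteq> m' k" "e \<noteq> n' k" "x' k \<noteq> e" "l' k \<noteq> e" "m' k \<noteq> e" "n' k \<noteq> e"
  using target.outer_neq[of e] assms by (simp_all add: outer_target)

lemma not_outer' [simp]: "x' k \<notin> outer" "l' k \<notin> outer" "m' k \<notin> outer" "n' k \<notin> outer"
  unfolding outer_target[symmetric] target.outer_def by simp_all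

lemma hex_sub [simp]: "hex_sub l m l' m' (l k) = m' k" "hex_sub l m l' m' (m k) = l' (succ3 k)"
  "e \<in> outer \<Longrightarrow> hex_sub l m l' m' e = e"
  by (simp_all add: hex_sub_simps)

text \<open>Identifies the outcome \<open>L3\<close> of the moves, whose edges have inherited old names, with \<open>\<Delta>\<close>.\<close>

definition relabel :: "'e \<Rightarrow> 'e" where
  "relabel e = (if e = x1 then x' One else if e = x3 then x' Two else if e = l3 then x' Three
    else if e = x2 then l' One else if e = l2 then l' Two else if e = l1 then l' Three
    else if e = y1 then n' One else if e = y2 then n' Two else if e = y3 then n' Three
    else if e = z1 then m' One else if e = z2 then m' Two else if e = z3 then m' Three else e)"

lemma relabel_simps:
  "relabel x1 = x' One" "relabel x3 = x' Two" "relabel l3 = x' Three"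
  "relabel x2 = l' One" "relabel l2 = l' Two" "relabel l1 = l' Three"
  "relabel (y k) = n' k" "relabel (z k) = m' k" "e \<in> outer \<Longrightarrow> relabel e = e"
  by (cases k; simp add: relabel_def)+

lemma relabel_wsub:
  assumes "e \<in> outer \<union> range m \<union> range n"
  shows "relabel (wsub (brot \<Gamma> e)) = hex_sub l m l' m' (brot \<Gamma> e)"
proof -
  have "relabel (wsub (l k)) = m' k" "relabel (wsub (m k)) = l' (succ3 k)" for k
    by (cases k; simp add: wsub_def zsub_def relabel_simps)+
  moreover have "relabel (wsub e) = e" if "e \<in> outer" for e
    using that by (simp add: wsub_def zsub_def relabel_simps)
  ultimately show ?thesis
    by (cases rule: brot_cases[OF assms]) auto
qed

lemma bij_relabel: "bij_betw relabel (edges L3) (edges \<Delta>)"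
proof -
  have "bij_betw relabel outer outer"
    by (rule bij_betw_cong[THEN iffD1, OF _ bij_betw_id]) (simp add: relabel_simps)
  moreover have "bij_betw relabel {x1, x2, x3, l1, l2, l3, y1, y2, y3, z1, z2, z3}
      {x' One, x' Two, x' Three, l' One, l' Two, l' Three, m' One, m' Two, m' Three, n' One, n' Two, n' Three}"
    unfolding bij_betw_def by (simp add: relabel_simps) (simp add: insert_commute)
  moreover have "outer \<inter> {x' One, x' Two, x' Three, l' One, l' Two, l' Three, m' One, m' Two, m' Three, n' One, n' Two, n' Three} = {}"
    by simp
  ultimately show ?thesis
    unfolding edges_L3 target.edges_eq outer_target by (rule bij_betw_combine)
qed

text \<open>
  \<open>transfer\<close> conjugates \<open>wrot \<circ> brot\<close> on the edges whose left face is not an inner one with the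
  corresponding permutation for \<open>\<Delta>\<close>; it therefore induces a bijection of the outer faces.
\<close>

definition transfer :: "'e \<Rightarrow> 'e" where
  "transfer e = (if e = m1 then n' One else if e = m2 then n' Two else if e = m3 then n' Three
    else if e = n1 then m' Two else if e = n2 then m' Three else if e = n3 then m' One else e)"

lemma transfer_simps [simp]: "transfer (m k) = n' k" "transfer (n k) = m' (succ3 k)" "e \<in> outer \<Longrightarrow> transfer e = e"
  by (cases k; simp add: transfer_def)+

lemma brot_transfer:
  assumes "e \<in> outer \<union> range m \<union> range n"
  shows "brot \<Delta> (transfer e) = hex_sub l m l' m' (brot \<Gamma> e)"
  using assms brot_target by auto

lemma transfer_in:
  assumes "e \<in> outer \<union> range m \<union> range n"
  shows "transfer e \<in> edges \<Delta>"
  using assms by auto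

lemma transfer_inj:
  assumes "e \<in> outer \<union> range m \<union> range n" "e' \<in> outer \<union> range m \<union> range n"
  shows "transfer e = transfer e' \<longleftrightarrow> e = e'"
  using assms by auto

lemma wrot_outer: "wrot \<Gamma> e \<in> outer" if "e \<in> outer"
proof -
  have "wrot \<Gamma> e \<in> edges \<Gamma>" "wrot \<Gamma> e \<noteq> x k" "wrot \<Gamma> e \<noteq> l k" "wrot \<Gamma> e \<noteq> m k" "wrot \<Gamma> e \<noteq> n k" for k
    using that by (simp_all add: wrot_eq)
  then show ?thesis unfolding outer_def by blast
qed

lemma transfer_step:
  assumes "e \<in> outer \<union> range m \<union> range n"
  shows "wrot \<Gamma> (brot \<Gamma> e) \<in> outer \<union> range m \<union> range n"
    and "wrot \<Delta> (brot \<Delta> (transfer e)) = transfer (wrot \<Gamma> (brot \<Gamma> e))"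
  by (cases rule: brot_cases[OF assms]; simp add: brot_transfer[OF assms] wrot_xlmn target.wrot_xlmn wrot_outer wrot_target)+

text \<open>A face has only \<open>e\<close> and \<open>wrot \<Gamma> (brot \<Gamma> e)\<close> on
  its boundary as left edges, so compatibility of \<open>transfer\<close> with one step decides
  equality of faces.\<close>

lemma fc_transfer:
  assumes "e \<in> outer \<union> range m \<union> range n" "e' \<in> outer \<union> range m \<union> range n"
  shows "fc \<Delta> (transfer e) = fc \<Delta> (transfer e') \<longleftrightarrow> fc \<Gamma> e = fc \<Gamma> e'"
proof -
  have "e \<in> edges \<Gamma>" "e' \<in> edges \<Gamma>" using assms by auto
  then show ?thesis
    using transfer_inj[OF assms(2,1)] transfer_inj[OF assms(2) transfer_step(1)[OF assms(1)]]
    by (simp add: fc_eq_iff target.fc_eq_iff transfer_in[OF assms(1)] transfer_in[OF assms(2)] transfer_step(2)[OF assms(1)])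
qed

lemma fc_x_neq_transfer:
  assumes "e \<in> outer \<union> range m \<union> range n"
  shows "fc \<Gamma> e \<noteq> fc \<Gamma> (x k)" "fc \<Delta> (transfer e) \<noteq> fc \<Delta> (x' k)"
proof -
  have "e \<in> edges \<Gamma>" using assms by auto
  then show "fc \<Gamma> e \<noteq> fc \<Gamma> (x k)"
    using assms fc_eq_x_iff[of e k] by auto
  show "fc \<Delta> (transfer e) \<noteq> fc \<Delta> (x' k)"
    unfolding target.fc_eq_x_iff[OF transfer_in[OF assms]] using assms by auto
qed

lemma edge_cases:
  assumes "e \<in> edges \<Gamma>"
  obtains "e \<in> outer \<union> range m \<union> range n" | k where "fc \<Gamma> e = fc \<Gamma> (x k)"
proof (cases "e \<in> outer \<union> range m \<union> range n")
  case False
  then have "e \<in> range x \<union> range l" using assms unfolding outer_def by blast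
  then have "\<exists>k. fc \<Gamma> e = fc \<Gamma> (x k)"
    using fc_l unfolding range_three by auto
  then show thesis using that by blast
qed (use that in blast)

text \<open>An outer face is carried along by any of its edges, the choice being irrelevant by
  \<open>fc_transfer\<close>. On the inner faces the order is dictated by \<open>relabel\<close>:
  the face of \<open>x2\<close> also has \<open>l3\<close> on its left, which becomes
  \<open>x' Three\<close>.\<close>

definition face_map :: "'f \<Rightarrow> 'f" where
  "face_map f = (if f = fc \<Gamma> x1 then fc \<Delta> (x' One) else if f = fc \<Gamma> x2 then fc \<Delta> (x' Three)
    else if f = fc \<Gamma> x3 then fc \<Delta> (x' Two)
    else fc \<Delta> (transfer (SOME e. e \<in> edges \<Gamma> \<and> fc \<Gamma> e = f)))"

lemma face_map_x: "face_map (fc \<Gamma> x1) = fc \<Delta> (x' One)" "face_map (fc \<Gamma> x2) = fc \<Delta> (x' Three)"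
  "face_map (fc \<Gamma> x3) = fc \<Delta> (x' Two)"
  by (simp_all add: face_map_def)

lemma face_map_transfer:
  assumes e: "e \<in> outer \<union> range m \<union> range n"
  shows "face_map (fc \<Gamma> e) = fc \<Delta> (transfer e)"
proof -
  let ?e = "SOME e'. e' \<in> edges \<Gamma> \<and> fc \<Gamma> e' = fc \<Gamma> e"
  have "e \<in> edges \<Gamma>" using e by auto
  then have e': "?e \<in> edges \<Gamma> \<and> fc \<Gamma> ?e = fc \<Gamma> e"
    using someI[of "\<lambda>e'. e' \<in> edges \<Gamma> \<and> fc \<Gamma> e' = fc \<Gamma> e" e] by blast
  then have "?e \<in> outer \<union> range m \<union> range n"
    using fc_x_neq_transfer(1)[OF e] by (metis edge_cases)
  then have "fc \<Delta> (transfer ?e) = fc \<Delta> (transfer e)"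
    using fc_transfer e e' by blast
  then show ?thesis
    using fc_x_neq_transfer(1)[OF e] by (simp add: face_map_def)
qed

lemma faces_eq: "faces \<Gamma> = fc \<Gamma> ` (outer \<union> range m \<union> range n) \<union> {fc \<Gamma> x1, fc \<Gamma> x2, fc \<Gamma> x3}"
  unfolding faces_def edges_eq range_three image_Un image_insert image_empty fc_l by blast

lemma image_transfer_outer: "transfer ` outer = outer"
  by simp

lemma faces_target: "faces \<Delta> = fc \<Delta> ` transfer ` (outer \<union> range m \<union> range n) \<union> {fc \<Delta> (x' One), fc \<Delta> (x' Two), fc \<Delta> (x' Three)}"
  unfolding faces_def target.edges_eq outer_target range_three image_Un image_insert image_empty target.fc_l
    image_transfer_outer transfer_simps succ3.simps by blast

lemma bij_face_map: "bij_betw face_map (faces \<Gamma>) (faces \<Delta>)"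
proof -
  let ?D = "outer \<union> range m \<union> range n"
  have "bij_betw face_map (fc \<Gamma> ` ?D) (fc \<Delta> ` transfer ` ?D)"
    unfolding bij_betw_def
  proof
    show "inj_on face_map (fc \<Gamma> ` ?D)"
    proof (rule inj_onI)
      fix f g assume "f \<in> fc \<Gamma> ` ?D" "g \<in> fc \<Gamma> ` ?D" and eq: "face_map f = face_map g"
      then obtain e e' where e: "e \<in> ?D" "f = fc \<Gamma> e" and e': "e' \<in> ?D" "g = fc \<Gamma> e'" by blast
      show "f = g" using eq fc_transfer[OF e(1) e'(1)] face_map_transfer[OF e(1)] face_map_transfer[OF e'(1)] e(2) e'(2) by simp
    qed
    show "face_map ` fc \<Gamma> ` ?D = fc \<Delta> ` transfer ` ?D"
      unfolding image_image by (rule image_cong[OF refl face_map_transfer])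
  qed
  moreover have "bij_betw face_map {fc \<Gamma> x1, fc \<Gamma> x2, fc \<Gamma> x3} {fc \<Delta> (x' One), fc \<Delta> (x' Two), fc \<Delta> (x' Three)}"
    unfolding bij_betw_def by (simp add: face_map_x) (simp add: insert_commute)
  moreover have "fc \<Delta> ` transfer ` ?D \<inter> {fc \<Delta> (x' One), fc \<Delta> (x' Two), fc \<Delta> (x' Three)} = {}"
    using fc_x_neq_transfer(2) by blast
  ultimately show ?thesis
    unfolding faces_eq faces_target by (rule bij_betw_combine)
qed

text \<open>Faces match because \<open>y k\<close> and \<open>z (succ3 k)\<close> bear the face
  names of \<open>m k\<close> and \<open>n k\<close>, and \<open>relabel\<close> sends the former
  where \<open>transfer\<close> sends the latter.\<close>

lemma bip_iso_relabel: "bip_iso relabel face_map L3 \<Delta>"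
  unfolding bip_iso_def
proof (intro conjI ballI)
  show "bij_betw relabel (edges L3) (edges \<Delta>)" by (rule bij_relabel)
  fix e assume "e \<in> edges L3"
  moreover have "z1 = z (succ3 Three)" "z2 = z (succ3 One)" "z3 = z (succ3 Two)"
    by simp_all
  ultimately consider "e \<in> outer" | k where "e = y k" | k where "e = z (succ3 k)" | "e \<in> {x1, x2, x3, l1, l2, l3}"
    unfolding edges_L3 by blast
  then have "relabel (brot L3 e) = brot \<Delta> (relabel e) \<and> relabel (wrot L3 e) = wrot \<Delta> (relabel e) \<and>
    face_map (fc L3 e) = fc \<Delta> (relabel e)"
  proof cases
    case 1
    then have D: "e \<in> outer \<union> range m \<union> range n" by simp
    show ?thesis
      using 1 wrot_outer[OF 1] face_map_transfer[OF D]
      by (simp add: L3_brot_outer relabel_wsub[OF D] L3_wrot_outer relabel_simps brot_target wrot_target L1 L2 L3 H0_fc)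
  next
    case (2 k)
    have D: "m k \<in> outer \<union> range m \<union> range n" by simp
    have "relabel (wrot L3 e) = wrot \<Delta> (relabel e)"
      by (cases k) (simp_all add: 2 L3_wrot_xlyz relabel_simps target.wrot_xlmn)
    moreover have "face_map (fc L3 e) = fc \<Delta> (relabel e)"
      using face_map_transfer[OF D] by (cases k) (simp_all add: 2 L1 L2 L3 H0_fc relabel_simps)
    ultimately show ?thesis
      by (simp add: 2 L3_brot_y relabel_wsub[OF D] relabel_simps brot_target)
  next
    case (3 k)
    have D: "n k \<in> outer \<union> range m \<union> range n" by simp
    have "relabel (wrot L3 e) = wrot \<Delta> (relabel e)"
      by (cases k) (simp_all add: 3 L3_wrot_xlyz relabel_simps target.wrot_xlmn)
    moreover have "face_map (fc L3 e) = fc \<Delta> (relabel e)"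
      using face_map_transfer[OF D] by (cases k) (simp_all add: 3 L1 L2 L3 H0_fc relabel_simps)
    ultimately show ?thesis
      by (simp add: 3 L3_brot_z relabel_wsub[OF D] relabel_simps brot_target)
  next
    case 4
    then show ?thesis
      by (auto simp: L3_brot_xl L3_wrot_xlyz target.brot_x target.wrot_xlmn target.brot_l123 relabel_simps
          L1 L2 L3 H0_fc fc_l face_map_x target.fc_l)
  qed
  then show "relabel (brot L3 e) = brot \<Delta> (relabel e)" "relabel (wrot L3 e) = wrot \<Delta> (relabel e)"
    "face_map (fc L3 e) = fc \<Delta> (relabel e)"
    by blast+
qed

lemma fibre_transfer:
  assumes e: "e \<in> outer \<union> range m \<union> range n"
  shows "{e' \<in> edges \<Delta>. fc \<Delta> e' = face_map (fc \<Gamma> e)} = transfer ` {e' \<in> edges \<Gamma>. fc \<Gamma> e' = fc \<Gamma> e}"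
    and "inj_on transfer {e' \<in> edges \<Gamma>. fc \<Gamma> e' = fc \<Gamma> e}"
    and "{e' \<in> edges \<Gamma>. fc \<Gamma> e' = fc \<Gamma> e} \<subseteq> outer \<union> range m \<union> range n"
proof -
  have "e \<in> edges \<Gamma>" using e by auto
  have "fc \<Gamma> e' = fc \<Gamma> e \<longleftrightarrow> e' = e \<or> e' = wrot \<Gamma> (brot \<Gamma> e)" if "e' \<in> edges \<Gamma>" for e'
    using fc_eq_iff[OF \<open>e \<in> edges \<Gamma>\<close> that] by metis
  then have fib: "{e' \<in> edges \<Gamma>. fc \<Gamma> e' = fc \<Gamma> e} = {e, wrot \<Gamma> (brot \<Gamma> e)}"
    using \<open>e \<in> edges \<Gamma>\<close> by auto
  have "fc \<Delta> e' = fc \<Delta> (transfer e) \<longleftrightarrow> e' = transfer e \<or> e' = wrot \<Delta> (brot \<Delta> (transfer e))" if "e' \<in> edges \<Delta>" for e'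
    using target.fc_eq_iff[OF transfer_in[OF e] that] by metis
  then have "{e' \<in> edges \<Delta>. fc \<Delta> e' = fc \<Delta> (transfer e)} = {transfer e, wrot \<Delta> (brot \<Delta> (transfer e))}"
    using transfer_in[OF e] by auto
  then show "{e' \<in> edges \<Delta>. fc \<Delta> e' = face_map (fc \<Gamma> e)} = transfer ` {e' \<in> edges \<Gamma>. fc \<Gamma> e' = fc \<Gamma> e}"
    unfolding fib face_map_transfer[OF e] by (simp add: transfer_step(2)[OF e])
  show "{e' \<in> edges \<Gamma>. fc \<Gamma> e' = fc \<Gamma> e} \<subseteq> outer \<union> range m \<union> range n"
    unfolding fib using e transfer_step(1)[OF e] by simp
  then show "inj_on transfer {e' \<in> edges \<Gamma>. fc \<Gamma> e' = fc \<Gamma> e}"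
    by (rule inj_on_subset[rotated]) (rule inj_onI, simp only: transfer_inj)
qed

lemma fibre_x: "{e \<in> edges \<Gamma>. fc \<Gamma> e = fc \<Gamma> (x k)} = {x k, l (succ3 k)}"
  using fc_eq_x_iff by auto

lemma fibre_x': "{e \<in> edges \<Delta>. fc \<Delta> e = fc \<Delta> (x' k)} = {x' k, l' (succ3 k)}"
  using target.fc_eq_x_iff by auto

text \<open>The second edge precedes \<open>l k\<close> and so shares its black end; an outer face
  thus sees two neighbouring boundary vertices of the hexagon.\<close>

lemma fibre_m:
  obtains e where "e \<in> edges \<Gamma>" "brot \<Gamma> e = l k" "e \<noteq> m k" "{e \<in> edges \<Gamma>. fc \<Gamma> e = fc \<Gamma> (m k)} = {m k, e}"
proof -
  obtain e where e: "brot \<Gamma> e = l k"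
    using permutes_surj[OF brot_permutes] by (metis surj_def)
  then have "e \<in> edges \<Gamma>" using brot_in in_edges(2) by metis
  moreover have "{e \<in> edges \<Gamma>. fc \<Gamma> e = fc \<Gamma> (m k)} = {m k, e}"
    using fc_eq_m_iff e brot_eq_iff \<open>e \<in> edges \<Gamma>\<close> in_edges(3)[of k] by (auto simp: set_eq_iff) metis
  ultimately show thesis using that e brot_m_neq(2) by metis
qed

lemma fibre_n:
  obtains e where "e \<in> edges \<Gamma>" "brot \<Gamma> e = m k" "e \<noteq> n k" "{e \<in> edges \<Gamma>. fc \<Gamma> e = fc \<Gamma> (n k)} = {n k, e}"
proof -
  obtain e where e: "brot \<Gamma> e = m k"
    using permutes_surj[OF brot_permutes] by (metis surj_def)
  then have "e \<in> edges \<Gamma>" using brot_in in_edges(3) by metis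
  moreover have "{e \<in> edges \<Gamma>. fc \<Gamma> e = fc \<Gamma> (n k)} = {n k, e}"
    using fc_eq_n_iff e brot_eq_iff \<open>e \<in> edges \<Gamma>\<close> in_edges(4)[of k] by (auto simp: set_eq_iff) metis
  ultimately show thesis using that e brot_n_neq(2) by metis
qed

lemma face_cases:
  assumes "f \<in> faces \<Gamma>"
  obtains e where "e \<in> outer \<union> range m \<union> range n" "f = fc \<Gamma> e" | "f = fc \<Gamma> x1" | "f = fc \<Gamma> x2" | "f = fc \<Gamma> x3"
  using assms unfolding faces_eq by blast

section \<open>The two diagrams in terms of edge weights\<close>

text \<open>\<open>u\<close> abstracts the B-variable at the black end of an edge, whence its
  invariance under \<open>brot\<close>. With abstract weights the result covers both directions of
  the move.\<close>

lemma mutations_A_face_map: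
  fixes u u' :: "'e \<Rightarrow> complex" and p q :: "three \<Rightarrow> complex"
  assumes mut: "mutations mut_A spiders A0 = Some A"
    and A0: "\<And>f. f \<in> faces \<Gamma> \<Longrightarrow> A0 f = (\<Prod>e\<in>{e \<in> edges \<Gamma>. fc \<Gamma> e = f}. u e)"
    and u_brot: "\<And>e. e \<in> edges \<Gamma> \<Longrightarrow> u (brot \<Gamma> e) = u e"
    and u: "\<And>k. u (x k) = b0" "\<And>k. u (l k) = p k" "\<And>k. u (m k) = q k"
    and u': "\<And>e. e \<in> outer \<Longrightarrow> u' e = u e" "\<And>k. u' (x' k) = b7" "\<And>k. u' (l' (succ3 k)) = q k"
      "\<And>k. u' (m' k) = p k" "\<And>k. u' (n' k) = q k"
    and nz: "b0 \<noteq> 0" "\<And>k. p k \<noteq> 0"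
    and b7: "b7 = (p One * q Two + p Two * q Three + p Three * q One) / b0"
    and f: "f \<in> faces \<Gamma>"
  shows "A f = (\<Prod>e\<in>{e \<in> edges \<Delta>. fc \<Delta> e = face_map f}. u' e)"
proof -
  have u_n: "u (n k) = p (succ3 k)" for k
    using u_brot[of "l (succ3 k)"] by (simp add: brot_l u)
  have in_faces: "fc \<Gamma> (x k) \<in> faces \<Gamma>" "fc \<Gamma> (m k) \<in> faces \<Gamma>" "fc \<Gamma> (n k) \<in> faces \<Gamma>" for k
    by (simp_all add: faces_def)
  have A0_x: "A0 (fc \<Gamma> (x k)) = b0 * p (succ3 k)" for k
    using A0[OF in_faces(1)[of k]] by (simp add: fibre_x u)
  have A0_m: "A0 (fc \<Gamma> (m k)) = p k * q k" for k
  proof -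
    obtain e where "e \<in> edges \<Gamma>" "brot \<Gamma> e = l k" "e \<noteq> m k" "{e \<in> edges \<Gamma>. fc \<Gamma> e = fc \<Gamma> (m k)} = {m k, e}"
      by (rule fibre_m)
    then show ?thesis
      using A0[OF in_faces(2)[of k]] u_brot[of e] by (simp add: u)
  qed
  have A0_n: "A0 (fc \<Gamma> (n k)) = p (succ3 k) * q k" for k
  proof -
    obtain e where "e \<in> edges \<Gamma>" "brot \<Gamma> e = m k" "e \<noteq> n k" "{e \<in> edges \<Gamma>. fc \<Gamma> e = fc \<Gamma> (n k)} = {n k, e}"
      by (rule fibre_n)
    then show ?thesis
      using A0[OF in_faces(3)[of k]] u_brot[of e] by (simp add: u u_n)
  qed
  note A = mutations_A_eq_Some[OF mut A0_x A0_m A0_n nz b7]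
  have u'l: "u' (l' One) = q Three" "u' (l' Two) = q One" "u' (l' Three) = q Two"
    using u'(3)[of Three] u'(3)[of One] u'(3)[of Two] by simp_all
  show ?thesis
  proof (cases rule: face_cases[OF f])
    case (1 e)
    have "A f = A0 f"
      using fc_x_neq_transfer(1)[OF 1(1)] by (intro A(4)) (simp add: 1)
    also have "\<dots> = (\<Prod>e'\<in>{e' \<in> edges \<Gamma>. fc \<Gamma> e' = fc \<Gamma> e}. u e')"
      using A0[OF f] 1(2) by simp
    also have "\<dots> = (\<Prod>e'\<in>{e' \<in> edges \<Gamma>. fc \<Gamma> e' = fc \<Gamma> e}. u' (transfer e'))"
    proof (rule prod.cong[OF refl])
      fix e' assume "e' \<in> {e' \<in> edges \<Gamma>. fc \<Gamma> e' = fc \<Gamma> e}"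
      then have "e' \<in> outer \<union> range m \<union> range n" using fibre_transfer(3)[OF 1(1)] by blast
      \<comment> \<open>\<open>transfer\<close> keeps an edge at its boundary vertex, and only the
        variable of the centre has changed.\<close>
      then show "u e' = u' (transfer e')" by (auto simp: u u' u_n)
    qed
    also have "\<dots> = (\<Prod>e\<in>{e \<in> edges \<Delta>. fc \<Delta> e = face_map f}. u' e)"
      unfolding 1(2) fibre_transfer(1)[OF 1(1)] by (simp add: prod.reindex[OF fibre_transfer(2)[OF 1(1)]])
    finally show ?thesis .
  qed (simp_all add: A(1-3) face_map_x fibre_x' u' u'l)
qed

text \<open>On an outer face only edges \<open>m k\<close> and \<open>n k\<close> change their
  weight, each by exactly the mutation factor attached to it; a face with two such edges receives
  both factors.\<close>

lemma mutations_X_face_map: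
  fixes u u' :: "'e \<Rightarrow> complex" and c s :: "three \<Rightarrow> complex"
  assumes mut: "mutations mut_X spiders X0 = Some X"
    and X0: "\<And>f. f \<in> faces \<Gamma> \<Longrightarrow> X0 f = (\<Prod>e\<in>{e \<in> edges \<Gamma>. fc \<Gamma> e = f}. u e)"
    and u: "\<And>k. u (x k) = 1 / c k" "\<And>k. u (l k) = c k" "\<And>k. u (m k) = 1 / c k" "\<And>k. u (n k) = c k"
    and u': "\<And>e. e \<in> outer \<Longrightarrow> u' e = u e" "\<And>k. u' (x' k) = s k" "\<And>k. u' (l' k) = 1 / s k"
      "\<And>k. u' (m' k) = s k" "\<And>k. u' (n' k) = 1 / s k"
    and nz: "\<And>k. c k \<noteq> 0"
    and s: "\<And>k. s k = (c One * c Two + c Two * c Three + c Three * c One) / c (succ3 k)"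
    and f: "f \<in> faces \<Gamma>"
  shows "X f = (\<Prod>e\<in>{e \<in> edges \<Delta>. fc \<Delta> e = face_map f}. u' e)"
proof -
  have X0_x: "X0 (fc \<Gamma> (x k)) = c (succ3 k) / c k" for k
  proof -
    have "fc \<Gamma> (x k) \<in> faces \<Gamma>" by (simp add: faces_def)
    then show ?thesis by (simp add: X0 fibre_x u)
  qed
  note X = mutations_X_eq_Some[OF mut X0_x nz s]
  show ?thesis
  proof (cases rule: face_cases[OF f])
    case (1 e)
    let ?F = "{e' \<in> edges \<Gamma>. fc \<Gamma> e' = fc \<Gamma> e}"
    have fin: "finite ?F" using finite_edges by simp
    let ?r = "\<lambda>e'. (if e' = m1 then c One / s One else 1) * (if e' = m2 then c Two / s Two else 1) *
      (if e' = m3 then c Three / s Three else 1) *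
      (if e' = n1 then s Two / c One else 1) * (if e' = n2 then s Three / c Two else 1) *
      (if e' = n3 then s One / c Three else 1)"
    have r: "?r (m k) = c k / s k" "?r (n k) = s (succ3 k) / c k" "e' \<in> outer \<Longrightarrow> ?r e' = 1" for k e'
      by (cases k; simp)+
    have "(\<Prod>e\<in>{e \<in> edges \<Delta>. fc \<Delta> e = face_map f}. u' e) = (\<Prod>e'\<in>?F. u' (transfer e'))"
      unfolding 1(2) fibre_transfer(1)[OF 1(1)] by (simp add: prod.reindex[OF fibre_transfer(2)[OF 1(1)]])
    also have "\<dots> = (\<Prod>e'\<in>?F. u e' * ?r e')"
    proof (rule prod.cong[OF refl])
      fix e' assume "e' \<in> ?F"
      then have "e' \<in> outer \<union> range m \<union> range n" using fibre_transfer(3)[OF 1(1)] by blast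
      then consider "e' \<in> outer" | k where "e' = m k" | k where "e' = n k" by blast
      then show "u' (transfer e') = u e' * ?r e'"
      proof cases
        case 1
        then show ?thesis using r(3)[OF 1] by (simp only: transfer_simps u' mult_1_right)
      next
        case (2 k)
        then show ?thesis using nz by (simp only: r transfer_simps u u') simp
      next
        case (3 k)
        then show ?thesis using nz by (simp only: r transfer_simps u u') simp
      qed
    qed
    also have "\<dots> = (\<Prod>e'\<in>?F. u e') * (\<Prod>e'\<in>?F. ?r e')"
      by (rule prod.distrib)
    also have "(\<Prod>e'\<in>?F. u e') = X0 f"
      using X0[OF f] 1(2) by simp
    \<comment> \<open>By \<open>prod.delta\<close>, a conditional factor survives exactly when the
      face has the corresponding edge on its boundary, which is the form of the mutated
      coordinate.\<close>
    also have "X0 f * (\<Prod>e'\<in>?F. ?r e') = X f"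
      using X(5)[of f] fc_x_neq_transfer(1)[OF 1(1)]
      unfolding prod.distrib prod.delta[OF fin] by (simp add: 1(2) eq_commute[of "fc \<Gamma> e"] mult.assoc)
    finally show ?thesis by simp
  qed (simp_all add: X(2-4) face_map_x fibre_x' u')
qed

end

text \<open>
  Turning the hexagon twice shifts the indices by one, which is why \<open>pred3\<close> enters the inverse move.
\<close>

fun pred3 :: "three \<Rightarrow> three" where
  "pred3 One = Three" | "pred3 Two = One" | "pred3 Three = Two"

lemma pred3_succ3 [simp]: "pred3 (succ3 k) = k" and succ3_pred3 [simp]: "succ3 (pred3 k) = k"
  by (cases k; simp)+

lemma pred3_eq_iff [simp]: "pred3 j = pred3 k \<longleftrightarrow> j = k"
  by (cases j; cases k) simp_all

lemma range_pred3 [simp]: "range (f \<circ> pred3) = range f"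
  unfolding range_three by auto

lemma hexagon_rotate:
  assumes "hexagon \<Gamma> x l m n"
  shows "hexagon \<Gamma> (x \<circ> pred3) (l \<circ> pred3) (m \<circ> pred3) (n \<circ> pred3)"
proof -
  interpret hexagon \<Gamma> x l m n by fact
  have "brot \<Gamma> (x (pred3 k)) = x k" "brot \<Gamma> (l k) = n (pred3 k)" "brot \<Gamma> (n (pred3 k)) \<noteq> l k" for k
    using brot_x[of "pred3 k"] brot_l[of "pred3 k"] brot_n_neq(1)[of "pred3 k"] by simp_all
  then show ?thesis
    by (intro hexagon.intro wf fc_eq_iff) (simp_all add: wrot_xlmn brot_m_neq brot_n_neq)
qed

lemma (in hexagon_move) hexagon_move_reverse:
  assumes "\<And>k. y k \<notin> edges \<Delta>" "\<And>k. z k \<notin> edges \<Delta>"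
  shows "hexagon_move \<Delta> x' l' m' n' y z \<Gamma> (x \<circ> pred3) (l \<circ> pred3) (m \<circ> pred3) (n \<circ> pred3)"
proof -
  have h: "hexagon \<Gamma> (x \<circ> pred3) (l \<circ> pred3) (m \<circ> pred3) (n \<circ> pred3)"
    by (rule hexagon_rotate) unfold_locales
  have out: "hexagon.outer \<Gamma> (x \<circ> pred3) (l \<circ> pred3) (m \<circ> pred3) (n \<circ> pred3) = outer"
    unfolding hexagon.outer_def[OF h] outer_def by (simp only: range_pred3)
  \<comment> \<open>The inverse substitution: with indices shifted by \<open>pred3\<close>, it takes
    \<open>m' k\<close> back to \<open>l k\<close> and \<open>l' (succ3 k)\<close> back to
    \<open>m k\<close>.\<close>
  let ?inv = "hex_sub l' m' (l \<circ> pred3) (m \<circ> pred3)"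
  have inv: "?inv (m' k) = l k" "?inv (l' (succ3 k)) = m k" "e \<in> outer \<Longrightarrow> ?inv e = e" for k e
    using hex_sub_simps(1,2)[of l' m' "l \<circ> pred3" "m \<circ> pred3"] hex_sub_simps(3)[of l' m' e]
    by simp_all
  have "?inv (hex_sub l m l' m' (brot \<Gamma> e)) = brot \<Gamma> e" if "e \<in> outer \<union> range m \<union> range n" for e
    by (rule brot_cases[OF that]) (simp_all add: inv)
  note inv' = this[symmetric]
  have "brot \<Gamma> e = ?inv (brot \<Delta> e)" if "e \<in> outer" for e
    using inv'[of e] that by (simp add: brot_target)
  moreover have "brot \<Gamma> (n (pred3 k)) = ?inv (brot \<Delta> (m' k))" for k
    using inv'[of "n (pred3 k)"] brot_target(3)[of "pred3 k"] by simp
  moreover have "brot \<Gamma> (m k) = ?inv (brot \<Delta> (n' k))" for k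
    using inv'[of "m k"] brot_target(2)[of k] by simp
  ultimately have "hexagon_move_axioms \<Delta> x' l' m' n' \<Gamma> (x \<circ> pred3) (l \<circ> pred3) (m \<circ> pred3) (n \<circ> pred3)"
    by (intro hexagon_move_axioms.intro) (simp_all add: out outer_target wrot_target)
  moreover have "fresh_hexagon \<Delta> x' l' m' n' y z"
    by (intro fresh_hexagon.intro target.hexagon_axioms fresh_hexagon_axioms.intro) (simp_all add: assms)
  ultimately show ?thesis
    using h by (intro hexagon_move.intro)
qed

section \<open>The bipartite graph of a torus graph\<close>

lemma torus_graphD:
  assumes "torus_graph G"
  shows "finite (darts G)" "rot G permutes darts G" "opp G permutes darts G"
    "d \<in> darts G \<Longrightarrow> opp G d \<noteq> d" "d \<in> darts G \<Longrightarrow> opp G (opp G d) = d"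
    "d \<in> darts G \<Longrightarrow> d' \<in> darts G \<Longrightarrow> vert G d = vert G d' \<longleftrightarrow> d' \<in> orbit (rot G) d"
    "d \<in> darts G \<Longrightarrow> d' \<in> darts G \<Longrightarrow> lface G d = lface G d' \<longleftrightarrow> d' \<in> orbit (face_next G) d"
    "rot G d \<in> darts G \<longleftrightarrow> d \<in> darts G" "opp G d \<in> darts G \<longleftrightarrow> d \<in> darts G"
    "face_next G d \<in> darts G \<longleftrightarrow> d \<in> darts G" "face_next G permutes darts G"
proof -
  show r: "rot G permutes darts G" and o: "opp G permutes darts G" and "finite (darts G)"
    "d \<in> darts G \<Longrightarrow> opp G d \<noteq> d" "d \<in> darts G \<Longrightarrow> opp G (opp G d) = d"
    "d \<in> darts G \<Longrightarrow> d' \<in> darts G \<Longrightarrow> vert G d = vert G d' \<longleftrightarrow> d' \<in> orbit (rot G) d"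
    "d \<in> darts G \<Longrightarrow> d' \<in> darts G \<Longrightarrow> lface G d = lface G d' \<longleftrightarrow> d' \<in> orbit (face_next G) d"
    using assms by (simp_all add: torus_graph_def)
  have "face_next G = inv (rot G) \<circ> opp G"
    by (simp add: fun_eq_iff face_next_def)
  then show f: "face_next G permutes darts G"
    using permutes_compose[OF o permutes_inv[OF r]] by simp
  show "rot G d \<in> darts G \<longleftrightarrow> d \<in> darts G" "opp G d \<in> darts G \<longleftrightarrow> d \<in> darts G" "face_next G d \<in> darts G \<longleftrightarrow> d \<in> darts G"
    using permutes_in_image[OF r] permutes_in_image[OF o] permutes_in_image[OF f] by auto
qed

lemma rot_face_next: "torus_graph G \<Longrightarrow> rot G (face_next G d) = opp G d"
  by (simp add: face_next_def permutes_inverses[OF torus_graphD(2)])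

lemma face_next_eq_iff: "torus_graph G \<Longrightarrow> face_next G d = d' \<longleftrightarrow> rot G d' = opp G d"
  by (auto simp: face_next_def permutes_inv_eq[OF torus_graphD(2)])

lemma gamma_simps [simp]: "brot (gamma G) = gamma_brot G" "wrot (gamma G) = gamma_wrot G"
  "fc (gamma G) = orbit (gamma_wrot G \<circ> gamma_brot G)"
  "edges (gamma G) = VertexEdge ` darts G \<union> FaceEdge ` darts G"
  by (simp_all add: gamma_def)

text \<open>The face permutation is an involution on edges, since \<open>face_next\<close> is
  \<open>opp\<close> followed by the inverse of \<open>rot\<close>.\<close>

lemma gamma_fc:
  assumes G: "torus_graph G" and e: "e \<in> edges (gamma G)"
  shows "fc (gamma G) e = {e, gamma_wrot G (gamma_brot G e)}"
proof -
  let ?\<phi> = "gamma_wrot G \<circ> gamma_brot G"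
  note D = torus_graphD[OF G]
  have "?\<phi> (?\<phi> e) = e"
    using e by (auto simp: D face_next_eq_iff[OF G] rot_face_next[OF G])
  then have "orbit ?\<phi> e = {(?\<phi> ^^ i) e |i. i < 2}"
    by (intro orbit_altdef_bounded) (simp_all add: numeral_2_eq_2)
  also have "\<dots> = {e, ?\<phi> e}"
    by (auto simp: numeral_2_eq_2 less_Suc_eq intro: exI[of _ 0] exI[of _ "Suc 0"])
  finally show ?thesis by simp
qed

lemma gamma_fc_eq_iff:
  assumes G: "torus_graph G" and e: "e \<in> edges (gamma G)" and e': "e' \<in> edges (gamma G)"
  shows "fc (gamma G) e = fc (gamma G) e' \<longleftrightarrow> e' = e \<or> e' = wrot (gamma G) (brot (gamma G) e)"
proof
  show "e' = e \<or> e' = wrot (gamma G) (brot (gamma G) e)" if "fc (gamma G) e = fc (gamma G) e'"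
    using gamma_fc[OF G e] gamma_fc[OF G e'] that by auto
  show "fc (gamma G) e = fc (gamma G) e'" if "e' = e \<or> e' = wrot (gamma G) (brot (gamma G) e)"
    using wf_bip_gamma[OF G] e that unfolding wf_bip_def by metis
qed

lemma gamma_fibre:
  assumes G: "torus_graph G" and f: "f \<in> faces (gamma G)"
  shows "{e \<in> edges (gamma G). fc (gamma G) e = f} = f"
    and "\<exists>d d'. d \<in> darts G \<and> d' \<in> darts G \<and> f = {VertexEdge d, FaceEdge d'}"
proof -
  obtain e where e: "e \<in> edges (gamma G)" "f = fc (gamma G) e"
    using f by (auto simp: faces_def)
  note D = torus_graphD[OF G]
  define g where "g = gamma_wrot G (gamma_brot G e)"
  have g: "g \<in> edges (gamma G)"
    using e(1) by (auto simp: D g_def)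
  have f: "f = {e, g}"
    unfolding e(2) g_def using gamma_fc[OF G e(1)] .
  have "fc (gamma G) e' = f \<longleftrightarrow> e' = e \<or> e' = g" if "e' \<in> edges (gamma G)" for e'
    using gamma_fc_eq_iff[OF G e(1) that] unfolding e(2) g_def gamma_simps(1,2) by metis
  then show "{e \<in> edges (gamma G). fc (gamma G) e = f} = f"
    unfolding f using e(1) g by blast
  consider d where "d \<in> darts G" "e = VertexEdge d" | d where "d \<in> darts G" "e = FaceEdge d"
    using e(1) unfolding gamma_simps by blast
  then show "\<exists>d d'. d \<in> darts G \<and> d' \<in> darts G \<and> f = {VertexEdge d, FaceEdge d'}"
  proof cases
    case 1
    then show ?thesis
      unfolding f g_def by (intro exI[of _ d] exI[of _ "opp G (rot G d)"]) (simp add: D)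
  next
    case 2
    then show ?thesis
      unfolding f g_def by (intro exI[of _ "face_next G d"] exI[of _ d]) (simp add: D insert_commute)
  qed
qed

text \<open>\<open>map_j\<close> multiplies over a set of black vertices. This agrees with a product
  over edges because a face has one vertex edge and one face edge, whose ends lie in different
  summands of the sum type.\<close>

lemma map_j_prod:
  assumes G: "torus_graph G" and f: "f \<in> faces (gamma G)"
  shows "map_j G B f = (\<Prod>e\<in>{e \<in> edges (gamma G). fc (gamma G) e = f}. B (black_end G e))"
proof -
  obtain d d' where "f = {VertexEdge d, FaceEdge d'}"
    using gamma_fibre(2)[OF G f] by blast
  then show ?thesis
    unfolding gamma_fibre(1)[OF G f] map_j_def by simp
qed

text \<open>The contribution of one edge to the monodromy. A face edge gets the reciprocal because
  the edge before it at its white end is a vertex edge of the same edge of the graph.\<close>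

fun conductance_weight :: "('d, 'v, 'f) surface_graph \<Rightarrow> ('d set \<Rightarrow> complex) \<Rightarrow> 'd gedge \<Rightarrow> complex" where
  "conductance_weight G C (VertexEdge d) = C (edge_of G d)"
| "conductance_weight G C (FaceEdge d) = 1 / C (edge_of G d)"
| "conductance_weight G C (NewEdge n) = 1"

lemma edge_of_opp: "torus_graph G \<Longrightarrow> d \<in> darts G \<Longrightarrow> edge_of G (opp G d) = edge_of G d"
  by (auto simp: edge_of_def torus_graphD)

lemma map_i_prod:
  assumes G: "torus_graph G"
  shows "map_i G C f = (\<Prod>e\<in>{e \<in> edges (gamma G). fc (gamma G) e = f}. conductance_weight G C e)"
  unfolding map_i_def monodromy_def
proof (rule prod.cong[OF refl])
  note D = torus_graphD[OF G]
  have w: "wrot (gamma G) permutes edges (gamma G)"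
    using wf_bip_gamma[OF G] by (simp add: wf_bip_def)
  fix e assume "e \<in> {e \<in> edges (gamma G). fc (gamma G) e = f}"
  then consider d where "d \<in> darts G" "e = VertexEdge d" | d where "d \<in> darts G" "e = FaceEdge d"
    by auto
  then show "transport G C e / transport G C (inv (wrot (gamma G)) e) = conductance_weight G C e"
  proof cases
    case 1
    then have "inv (wrot (gamma G)) e = FaceEdge d"
      unfolding permutes_inv_eq[OF w] by simp
    then show ?thesis using 1 by simp
  next
    case 2
    then have "inv (wrot (gamma G)) e = VertexEdge (opp G d)"
      unfolding permutes_inv_eq[OF w] by (simp add: D)
    then show ?thesis using 2 by (simp add: edge_of_opp[OF G])
  qed
qed

text \<open>Every dart contributes its conductance through its vertex edge and the inverse through
  its face edge.\<close>

lemma prod_map_i: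
  assumes G: "torus_graph G" and C: "C \<in> torus_R G"
  shows "(\<Prod>f\<in>faces (gamma G). map_i G C f) = 1"
proof -
  note D = torus_graphD[OF G]
  have fin: "finite (edges (gamma G))" using D(1) by simp
  have nz: "C (edge_of G d) \<noteq> 0" if "d \<in> darts G" for d
    using C that by (auto simp: torus_R_def)
  have "(\<Prod>f\<in>faces (gamma G). map_i G C f) = (\<Prod>e\<in>edges (gamma G). conductance_weight G C e)"
    unfolding map_i_prod[OF G] faces_def by (rule prod.image_gen[OF fin, symmetric])
  also have "\<dots> = (\<Prod>e\<in>VertexEdge ` darts G. conductance_weight G C e) * (\<Prod>e\<in>FaceEdge ` darts G. conductance_weight G C e)"
    unfolding gamma_simps using D(1) by (intro prod.union_disjoint) auto
  also have "\<dots> = (\<Prod>d\<in>darts G. C (edge_of G d)) * (\<Prod>d\<in>darts G. 1 / C (edge_of G d))"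
    by (simp add: prod.reindex inj_on_def)
  also have "\<dots> = 1"
    using nz by (simp add: prod.distrib[symmetric])
  finally show ?thesis .
qed

lemma positive_on_prod:
  assumes "finite S" "positive_on S w"
  shows "\<exists>r>0. (\<Prod>e\<in>S. w e) = complex_of_real r"
  using assms
proof (induction S rule: finite_induct)
  case empty
  then show ?case by (intro exI[of _ 1]) simp
next
  case (insert e S)
  then obtain r r' where "r > 0" "(\<Prod>e\<in>S. w e) = complex_of_real r" "r' > 0" "w e = complex_of_real r'"
    by (auto simp: positive_on_def)
  then show ?case
    using insert.hyps by (intro exI[of _ "r' * r"]) simp
qed

lemma positive_on_map_j:
  assumes G: "torus_graph G" and B: "positive_on (black_vertices G) B"
  shows "positive_on (faces (gamma G)) (map_j G B)"
  unfolding positive_on_def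
proof
  fix f assume f: "f \<in> faces (gamma G)"
  have "positive_on (edges (gamma G)) (\<lambda>e. B (black_end G e))"
    using B by (auto simp: positive_on_def black_vertices_def)
  then have "positive_on {e \<in> edges (gamma G). fc (gamma G) e = f} (\<lambda>e. B (black_end G e))"
    by (simp add: positive_on_def)
  then show "\<exists>r>0. map_j G B f = complex_of_real r"
    unfolding map_j_prod[OF G f] using torus_graphD(1)[OF G] by (intro positive_on_prod) simp_all
qed

lemma positive_on_map_i:
  assumes G: "torus_graph G" and C: "positive_on (edge_of G ` darts G) C"
  shows "positive_on (faces (gamma G)) (map_i G C)"
  unfolding positive_on_def
proof
  fix f assume f: "f \<in> faces (gamma G)"
  have "\<exists>r>0. conductance_weight G C e = complex_of_real r" if e: "e \<in> edges (gamma G)" for e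
  proof -
    obtain d where d: "d \<in> darts G" "e = VertexEdge d \<or> e = FaceEdge d" using e unfolding gamma_simps by blast
    then obtain r where r: "r > 0" "C (edge_of G d) = complex_of_real r"
      using C by (auto simp: positive_on_def)
    then show ?thesis
      using d by (auto intro: exI[of _ r] exI[of _ "1 / r"])
  qed
  then have "positive_on {e \<in> edges (gamma G). fc (gamma G) e = f} (conductance_weight G C)"
    by (simp add: positive_on_def)
  then show "\<exists>r>0. map_i G C f = complex_of_real r"
    unfolding map_i_prod[OF G] using torus_graphD(1)[OF G] by (intro positive_on_prod) simp_all
qed

section \<open>Triangles and stars as hexagons\<close>

fun three_nat :: "three \<Rightarrow> nat" where
  "three_nat One = 1" | "three_nat Two = 2" | "three_nat Three = 3"

lemma three_nat_succ3: "three_nat (succ3 k) = nxt (three_nat k)"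
  by (cases k) (simp_all add: nxt_def)

lemma three_nat_in: "three_nat k \<in> {1, 2, 3}"
  by (cases k) simp_all

locale delta_star_pair =
  fixes G G' :: "('d, 'v, 'f) surface_graph" and a s t :: "nat \<Rightarrow> 'd" and c :: 'v
  assumes G: "torus_graph G" and G': "torus_graph G'" and move: "delta_star G G' a s t c"
    and nondeg: "nondegenerate G a"
begin

definition "ta k = a (three_nat k)"
definition "ts k = s (three_nat k)"
definition "tt k = t (three_nat k)"

definition outer_darts :: "'d set" where
  "outer_darts = darts G - tri_darts G a"

definition dart_sub :: "'d \<Rightarrow> 'd" where
  "dart_sub d = (if d = a 1 then s 1 else if d = a 2 then s 2 else if d = a 3 then s 3 else d)"

lemmas D = torus_graphD[OF G] and D' = torus_graphD[OF G']

lemma tri_darts_eq: "tri_darts G a = range ta \<union> range (\<lambda>k. opp G (ta k))"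
  unfolding tri_darts_def range_three ta_def by auto

lemma ta_in [simp]: "ta k \<in> darts G" "opp G (ta k) \<in> darts G" "opp G (opp G (ta k)) = ta k"
proof -
  have "tri_darts G a \<subseteq> darts G" using move by (simp add: delta_star_def Let_def)
  then show "ta k \<in> darts G" unfolding tri_darts_eq by auto
  then show "opp G (ta k) \<in> darts G" "opp G (opp G (ta k)) = ta k" by (simp_all add: D)
qed

lemma ta_inj [simp]: "ta j = ta k \<longleftrightarrow> j = k" "opp G (ta j) = opp G (ta k) \<longleftrightarrow> j = k"
  "ta j \<noteq> opp G (ta k)" "opp G (ta k) \<noteq> ta j"
proof -
  have "distinct [a 1, a 2, a 3, opp G (a 1), opp G (a 2), opp G (a 3)]"
    using move unfolding delta_star_def Let_def by blast
  then have d: "a 1 \<noteq> a 2" "a 1 \<noteq> a 3" "a 1 \<noteq> opp G (a 1)"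
    "a 1 \<noteq> opp G (a 2)" "a 1 \<noteq> opp G (a 3)" "a 2 \<noteq> a 3"
    "a 2 \<noteq> opp G (a 1)" "a 2 \<noteq> opp G (a 2)" "a 2 \<noteq> opp G (a 3)"
    "a 3 \<noteq> opp G (a 1)" "a 3 \<noteq> opp G (a 2)" "a 3 \<noteq> opp G (a 3)"
    "opp G (a 1) \<noteq> opp G (a 2)" "opp G (a 1) \<noteq> opp G (a 3)" "opp G (a 2) \<noteq> opp G (a 3)"
    by simp_all
  show "ta j = ta k \<longleftrightarrow> j = k" "opp G (ta j) = opp G (ta k) \<longleftrightarrow> j = k" "ta j \<noteq> opp G (ta k)"
    by (cases j; cases k; simp add: ta_def d[unfolded One_nat_def] d[unfolded One_nat_def, symmetric])+
  then show "opp G (ta k) \<noteq> ta j" by metis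
qed

lemma st_inj [simp]: "ts j = ts k \<longleftrightarrow> j = k" "tt j = tt k \<longleftrightarrow> j = k" "ts j \<noteq> tt k" "tt k \<noteq> ts j"
proof -
  have "distinct [s 1, s 2, s 3, t 1, t 2, t 3]"
    using move unfolding delta_star_def Let_def by blast
  then have d: "s 1 \<noteq> s 2" "s 1 \<noteq> s 3" "s 1 \<noteq> t 1"
    "s 1 \<noteq> t 2" "s 1 \<noteq> t 3" "s 2 \<noteq> s 3"
    "s 2 \<noteq> t 1" "s 2 \<noteq> t 2" "s 2 \<noteq> t 3"
    "s 3 \<noteq> t 1" "s 3 \<noteq> t 2" "s 3 \<noteq> t 3"
    "t 1 \<noteq> t 2" "t 1 \<noteq> t 3" "t 2 \<noteq> t 3"
    by simp_all
  show "ts j = ts k \<longleftrightarrow> j = k" "tt j = tt k \<longleftrightarrow> j = k" "ts j \<noteq> tt k"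
    by (cases j; cases k; simp add: ts_def tt_def d[unfolded One_nat_def] d[unfolded One_nat_def, symmetric])+
  then show "tt k \<noteq> ts j" by metis
qed

lemma st_sets: "{s 1, s 2, s 3, t 1, t 2, t 3} = range ts \<union> range tt"
  unfolding range_three ts_def tt_def by auto

lemma darts_G': "darts G' = outer_darts \<union> range ts \<union> range tt"
  using move unfolding delta_star_def Let_def outer_darts_def st_sets Un_assoc by blast

lemma darts_G: "darts G = outer_darts \<union> range ta \<union> range (\<lambda>k. opp G (ta k))"
  using ta_in unfolding outer_darts_def tri_darts_eq by blast

lemma st_not_outer [simp]: "ts k \<notin> outer_darts" "tt k \<notin> outer_darts"
proof -
  have "(range ts \<union> range tt) \<inter> outer_darts = {}"
    using move unfolding delta_star_def Let_def outer_darts_def st_sets by blast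
  then show "ts k \<notin> outer_darts" "tt k \<notin> outer_darts" by blast+
qed

lemma ta_not_outer [simp]: "ta k \<notin> outer_darts" "opp G (ta k) \<notin> outer_darts"
  unfolding outer_darts_def tri_darts_eq by blast+

lemma st_in [simp]: "ts k \<in> darts G'" "tt k \<in> darts G'"
  unfolding darts_G' by blast+

lemma outer_dartD [simp]:
  assumes "d \<in> outer_darts"
  shows "d \<in> darts G" "d \<in> darts G'" "d \<noteq> ta k" "d \<noteq> opp G (ta k)" "d \<noteq> ts k" "d \<noteq> tt k"
    "ta k \<noteq> d" "opp G (ta k) \<noteq> d" "ts k \<noteq> d" "tt k \<noteq> d"
proof -
  show "d \<in> darts G" "d \<in> darts G'"
    using assms darts_G darts_G' by blast+
  show "d \<noteq> ta k" "d \<noteq> opp G (ta k)" "d \<noteq> ts k" "d \<noteq> tt k"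
    "ta k \<noteq> d" "opp G (ta k) \<noteq> d" "ts k \<noteq> d" "tt k \<noteq> d"
    using assms ta_not_outer st_not_outer by metis+
qed

lemma c_new: "c \<notin> vert G ` darts G"
  using move unfolding delta_star_def Let_def by (elim conjE)

lemma spoke:
  shows face_next_ta: "face_next G (ta k) = ta (succ3 k)"
    and opp_st: "opp G' (ts k) = tt k" "opp G' (tt k) = ts k"
    and rot_tt: "rot G' (tt k) = tt (succ3 k)"
    and rot_ts: "rot G' (ts (succ3 k)) = dart_sub (rot G (opp G (ta k)))"
    and vert_st: "vert G' (ts k) = vert G (ta k)" "vert G' (tt k) = c"
    and lface_st: "lface G' (tt k) = lface G (opp G (ta k))" "lface G' (ts (succ3 k)) = lface G (opp G (ta k))"
proof -
  have "\<forall>k\<in>{1, 2, 3}. face_next G (a k) = a (nxt k) \<and>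
         opp G' (s k) = t k \<and> opp G' (t k) = s k \<and>
         rot G' (t k) = t (nxt k) \<and>
         rot G' (s (nxt k)) = dart_sub (rot G (opp G (a k))) \<and>
         vert G' (s k) = vert G (a k) \<and> vert G' (t k) = c \<and>
         lface G' (t k) = lface G (opp G (a k)) \<and> lface G' (s (nxt k)) = lface G (opp G (a k))"
    using move unfolding delta_star_def Let_def dart_sub_def by blast
  note * = bspec[OF this three_nat_in[of k]]
  from * show "face_next G (ta k) = ta (succ3 k)" "opp G' (ts k) = tt k" "opp G' (tt k) = ts k"
    "rot G' (tt k) = tt (succ3 k)" "rot G' (ts (succ3 k)) = dart_sub (rot G (opp G (ta k)))"
    "vert G' (ts k) = vert G (ta k)" "vert G' (tt k) = c"
    "lface G' (tt k) = lface G (opp G (ta k))" "lface G' (ts (succ3 k)) = lface G (opp G (ta k))"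
    unfolding ta_def ts_def tt_def three_nat_succ3 by blast+
qed

lemma outer_move:
  assumes "d \<in> outer_darts"
  shows "opp G' d = opp G d" "rot G' d = dart_sub (rot G d)" "vert G' d = vert G d" "lface G' d = lface G d"
  using assms move unfolding delta_star_def Let_def dart_sub_def outer_darts_def by blast+

lemma dart_sub_simps [simp]: "dart_sub (ta k) = ts k" "(\<And>k. d \<noteq> ta k) \<Longrightarrow> dart_sub d = d"
proof -
  have ta: "ta One = a 1" "ta Two = a 2" "ta Three = a 3" by (simp_all add: ta_def)
  have ts: "ts One = s 1" "ts Two = s 2" "ts Three = s 3" by (simp_all add: ts_def)
  have eq: "dart_sub d = (if d = ta One then ts One else if d = ta Two then ts Two else if d = ta Three then ts Three else d)" for d
    unfolding dart_sub_def ta ts ..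
  show "dart_sub (ta k) = ts k" by (cases k) (simp_all add: eq)
  show "(\<And>k. d \<noteq> ta k) \<Longrightarrow> dart_sub d = d" by (simp add: eq)
qed

lemma rot_ta: "rot G (ta (succ3 k)) = opp G (ta k)"
  using face_next_ta[of k] by (simp add: face_next_eq_iff[OF G])

lemma outer_opp [simp]: "d \<in> outer_darts \<Longrightarrow> opp G d \<in> outer_darts"
proof -
  assume d: "d \<in> outer_darts"
  then have "opp G d \<in> darts G" "opp G (opp G d) = d" by (simp_all add: D)
  then show ?thesis
    using d outer_dartD(3,4)[OF d] ta_in(3) unfolding darts_G by (metis (no_types, lifting) UnE imageE)
qed

text \<open>The counterpart of \<open>dart_sub\<close> for faces: along the face across a side,
  \<open>opp G (ta k)\<close> gives way to two darts of the star, the first being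
  \<open>ts (succ3 k)\<close>.\<close>

definition face_sub :: "'d \<Rightarrow> 'd" where
  "face_sub d = (if d = opp G (ta One) then ts Two else if d = opp G (ta Two) then ts Three
    else if d = opp G (ta Three) then ts One else d)"

lemma face_sub_simps [simp]: "face_sub (opp G (ta k)) = ts (succ3 k)" "(\<And>k. d \<noteq> opp G (ta k)) \<Longrightarrow> face_sub d = d"
  by (cases k; simp add: face_sub_def)+

text \<open>As \<open>face_next\<close> inverts \<open>rot\<close> up to \<open>opp\<close>, this
  identity provides the new face successors without inverting \<open>rot G'\<close>.\<close>

lemma rot_face_sub:
  assumes "e \<in> darts G" "\<And>k. e \<noteq> ta k"
  shows "rot G' (face_sub e) = dart_sub (rot G e)"
proof (cases "e \<in> outer_darts")
  case True
  then show ?thesis by (simp add: outer_move)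
next
  case False
  then obtain k where "e = opp G (ta k)"
    using assms unfolding darts_G by blast
  then show ?thesis by (simp add: rot_ts)
qed

lemma face_next_outer:
  assumes "d \<in> outer_darts"
  shows "face_next G' d = face_sub (face_next G d)"
proof -
  let ?e = "face_next G d"
  have e: "rot G ?e = opp G d" "?e \<in> darts G"
    using assms by (simp_all add: D rot_face_next[OF G])
  \<comment> \<open>\<open>rot\<close> sends \<open>ta k\<close> to a dart of the triangle, but it
    sends \<open>?e\<close> to an outer dart.\<close>
  have "?e \<noteq> ta k" for k
  proof -
    obtain j where "k = succ3 j" by (rule three_succ3_cases)
    then have "rot G (ta k) \<notin> outer_darts" using rot_ta[of j] ta_not_outer(2)[of j] by simp
    then show ?thesis using e(1) outer_opp[OF assms] by metis
  qed
  then have "rot G' (face_sub ?e) = dart_sub (opp G d)"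
    using rot_face_sub[OF e(2)] e(1) by simp
  also have "\<dots> = opp G' d"
    using dart_sub_simps(2)[OF outer_dartD(3)[OF outer_opp[OF assms]]] outer_move(1)[OF assms] by simp
  finally show ?thesis
    by (simp add: face_next_eq_iff[OF G'])
qed

lemma face_next_tt: "face_next G' (tt k) = face_sub (face_next G (opp G (ta k)))"
proof -
  let ?e = "face_next G (opp G (ta k))"
  have e: "rot G ?e = ta k" "?e \<in> darts G"
    by (simp_all add: D rot_face_next[OF G])
  have "?e \<noteq> ta j" for j
  proof -
    obtain i where "j = succ3 i" by (rule three_succ3_cases)
    then have "rot G (ta j) \<noteq> ta k" using rot_ta[of i] by simp
    then show ?thesis using e(1) by metis
  qed
  then have "rot G' (face_sub ?e) = opp G' (tt k)"
    using rot_face_sub[OF e(2)] e(1) by (simp add: opp_st)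
  then show ?thesis
    by (simp add: face_next_eq_iff[OF G'])
qed

lemma face_next_ts: "face_next G' (ts (succ3 k)) = tt k"
  by (simp add: face_next_eq_iff[OF G'] rot_tt opp_st)

text \<open>Otherwise the rotation at the vertex closes up after two darts, against the degree
  condition.\<close>

lemma dart_sub_rot_neq:
  "rot G (opp G (ta k)) \<noteq> ta (succ3 k)"
proof
  assume eq: "rot G (opp G (ta k)) = ta (succ3 k)"
  let ?o = "{ta (succ3 k), opp G (ta k)}"
  have orb: "orbit (rot G) (ta (succ3 k)) \<subseteq> ?o"
  proof
    fix d assume "d \<in> orbit (rot G) (ta (succ3 k))"
    then show "d \<in> ?o" by induction (use eq rot_ta[of k] in auto)
  qed
  have "{d \<in> darts G. vert G d = vert G (ta (succ3 k))} \<subseteq> ?o"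
  proof (intro subsetI)
    fix d assume "d \<in> {d \<in> darts G. vert G d = vert G (ta (succ3 k))}"
    then have "d \<in> darts G" "vert G (ta (succ3 k)) = vert G d" by simp_all
    then have "d \<in> orbit (rot G) (ta (succ3 k))"
      using D(6)[OF ta_in(1)[of "succ3 k"], of d] by blast
    then show "d \<in> ?o" by (rule subsetD[OF orb])
  qed
  then have "card {d \<in> darts G. vert G d = vert G (ta (succ3 k))} \<le> card ?o"
    by (intro card_mono) simp_all
  also have "card ?o \<le> 2"
    by (simp add: card_insert_if)
  finally have "card {d \<in> darts G. vert G d = vert G (ta (succ3 k))} \<le> 2" .
  moreover have "card {d \<in> darts G. vert G d = vert G (ta (succ3 k))} > 2"
    using nondeg three_nat_in[of "succ3 k"] unfolding nondegenerate_def ta_def by blast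
  ultimately show False by linarith
qed

text \<open>Otherwise the face across the side has just one dart on its boundary, which
  nondegeneracy excludes.\<close>

lemma face_next_neq: "face_next G (opp G (ta k)) \<noteq> opp G (ta k)"
proof
  assume eq: "face_next G (opp G (ta k)) = opp G (ta k)"
  then have orb: "orbit (face_next G) (opp G (ta k)) = {opp G (ta k)}"
    by (simp add: orbit_eq_singleton_iff)
  have "{d \<in> darts G. lface G d = lface G (opp G (ta k))} \<subseteq> {opp G (ta k)}"
  proof (intro subsetI)
    fix d assume "d \<in> {d \<in> darts G. lface G d = lface G (opp G (ta k))}"
    then have "d \<in> darts G" "lface G (opp G (ta k)) = lface G d" by simp_all
    then show "d \<in> {opp G (ta k)}"
      using D(7)[OF ta_in(2)[of k], of d] unfolding orb by blast
  qed
  then have "card {d \<in> darts G. lface G d = lface G (opp G (ta k))} \<le> card {opp G (ta k)}"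
    by (intro card_mono) simp_all
  then have "card {d \<in> darts G. lface G d = lface G (opp G (ta k))} \<le> 1" by simp
  moreover have "card {d \<in> darts G. lface G d = lface G (opp G (ta k))} > 1"
    using nondeg three_nat_in[of k] unfolding nondegenerate_def ta_def by blast
  ultimately show False by linarith
qed

end

lemma black_end_in: "e \<in> edges (gamma G) \<Longrightarrow> black_end G e \<in> black_vertices G"
  by (auto simp: black_vertices_def)

lemma vert_rot: "torus_graph G \<Longrightarrow> d \<in> darts G \<Longrightarrow> vert G (rot G d) = vert G d"
  using torus_graphD(6)[of G d "rot G d"] orbit.base[of "rot G" d] by (simp add: torus_graphD(8))

lemma lface_face_next: "torus_graph G \<Longrightarrow> d \<in> darts G \<Longrightarrow> lface G (face_next G d) = lface G d"
  using torus_graphD(7)[of G d "face_next G d"] orbit.base[of "face_next G" d] by (simp add: torus_graphD(10))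

lemma black_end_brot:
  assumes "torus_graph G" "e \<in> edges (gamma G)"
  shows "black_end G (brot (gamma G) e) = black_end G e"
  using assms by (auto simp: vert_rot lface_face_next)

text \<open>The interface between hexagons and graphs: the action on the variables enters only
  through the existence of \<open>p\<close>, \<open>q\<close> and \<open>c\<close>,
  \<open>s\<close>, so one argument serves both directions.\<close>

lemma hexagon_move_spiders:
  fixes G1 G2 :: "('d, 'v, 'f) surface_graph"
    and \<beta> :: "('v + 'f \<Rightarrow> complex) \<rightharpoonup> ('v + 'f \<Rightarrow> complex)"
    and \<rho> :: "('d set \<Rightarrow> complex) \<rightharpoonup> ('d set \<Rightarrow> complex)"
  assumes G1: "torus_graph G1" and G2: "torus_graph G2"
    and hex: "hexagon_move (gamma G1) x l m n y z (gamma G2) x' l' m' n'"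
    and outer: "hexagon.outer (gamma G1) x l m n = Z" and Z: "Z = VertexEdge ` Y \<union> FaceEdge ` Y"
    and \<beta>: "\<And>B B'. B \<in> torus_B G1 \<Longrightarrow> \<beta> B = Some B' \<Longrightarrow> \<exists>b0 p q b7.
      (\<forall>k. B (black_end G1 (x k)) = b0 \<and> B (black_end G1 (l k)) = p k \<and> B (black_end G1 (m k)) = q k \<and>
        B' (black_end G2 (x' k)) = b7 \<and> B' (black_end G2 (l' (succ3 k))) = q k \<and>
        B' (black_end G2 (m' k)) = p k \<and> B' (black_end G2 (n' k)) = q k) \<and>
      (\<forall>e\<in>Z. B' (black_end G2 e) = B (black_end G1 e)) \<and>
      b7 = (p One * q Two + p Two * q Three + p Three * q One) / b0"
    and \<beta>_pos: "\<And>B. positive_on (black_vertices G1) B \<Longrightarrow> \<beta> B \<noteq> None"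
    and \<rho>: "\<And>C C'. C \<in> torus_R G1 \<Longrightarrow> \<rho> C = Some C' \<Longrightarrow> \<exists>c s.
      (\<forall>k. conductance_weight G1 C (x k) = 1 / c k \<and> conductance_weight G1 C (l k) = c k \<and>
        conductance_weight G1 C (m k) = 1 / c k \<and> conductance_weight G1 C (n k) = c k \<and>
        conductance_weight G2 C' (x' k) = s k \<and> conductance_weight G2 C' (l' k) = 1 / s k \<and>
        conductance_weight G2 C' (m' k) = s k \<and> conductance_weight G2 C' (n' k) = 1 / s k \<and> c k \<noteq> 0 \<and>
        s k = (c One * c Two + c Two * c Three + c Three * c One) / c (succ3 k)) \<and>
      (\<forall>e\<in>Z. conductance_weight G2 C' e = conductance_weight G1 C e)"
    and \<rho>_pos: "\<And>C. positive_on (edge_of G1 ` darts G1) C \<Longrightarrow> \<rho> C \<noteq> None"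
  shows "\<exists>ms \<Gamma> h \<theta>.
    length ms = 4 \<and> moves (gamma G1) ms \<Gamma> \<and> bip_iso h \<theta> \<Gamma> (gamma G2) \<and>
    bij_betw \<theta> (faces (gamma G1)) (faces (gamma G2)) \<and>
    (\<forall>d\<in>Y. \<forall>e\<in>{VertexEdge d, FaceEdge d}. \<theta> (fc (gamma G1) e) = fc (gamma G2) e) \<and>
    (\<forall>B\<in>torus_B G1. \<forall>A B'.
       mutations mut_A ms (map_j G1 B) = Some A \<longrightarrow> \<beta> B = Some B' \<longrightarrow>
       (\<forall>f\<in>faces (gamma G1). A f = map_j G2 B' (\<theta> f))) \<and>
    (\<forall>B. positive_on (black_vertices G1) B \<longrightarrow>
       mutations mut_A ms (map_j G1 B) \<noteq> None \<and> \<beta> B \<noteq> None) \<and>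
    (\<forall>C\<in>torus_R G1. \<forall>X C'.
       mutations mut_X ms (map_i G1 C) = Some X \<longrightarrow> \<rho> C = Some C' \<longrightarrow>
       (\<forall>f\<in>faces (gamma G1). X f = map_i G2 C' (\<theta> f))) \<and>
    (\<forall>C. positive_on (edge_of G1 ` darts G1) C \<longrightarrow>
       mutations mut_X ms (map_i G1 C) \<noteq> None \<and> \<rho> C \<noteq> None)"
proof -
  interpret hexagon_move "gamma G1" x l m n y z "gamma G2" x' l' m' n' by (rule hex)
  have A: "A f = map_j G2 B' (face_map f)"
    if B: "B \<in> torus_B G1" and mut: "mutations mut_A spiders (map_j G1 B) = Some A"
      and B': "\<beta> B = Some B'" and f: "f \<in> faces (gamma G1)" for B A B' f
  proof -
    obtain b0 p q b7 where k: "\<And>k. B (black_end G1 (x k)) = b0" "\<And>k. B (black_end G1 (l k)) = p k"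
      "\<And>k. B (black_end G1 (m k)) = q k"
      "\<And>k. B' (black_end G2 (x' k)) = b7" "\<And>k. B' (black_end G2 (l' (succ3 k))) = q k"
      "\<And>k. B' (black_end G2 (m' k)) = p k" "\<And>k. B' (black_end G2 (n' k)) = q k"
      and o: "\<And>e. e \<in> Z \<Longrightarrow> B' (black_end G2 e) = B (black_end G1 e)"
      and b7: "b7 = (p One * q Two + p Two * q Three + p Three * q One) / b0"
      using \<beta>[OF B B'] by blast
    have nz: "B (black_end G1 e) \<noteq> 0" if "e \<in> edges (gamma G1)" for e
      using B black_end_in[OF that] by (simp add: torus_B_def)
    have "A f = (\<Prod>e\<in>{e \<in> edges (gamma G2). fc (gamma G2) e = face_map f}. B' (black_end G2 e))"
    proof (rule mutations_A_face_map[OF mut map_j_prod[OF G1] _ k(1-3) _ k(4-7) _ _ b7 f])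
      show "B (black_end G1 (brot (gamma G1) e)) = B (black_end G1 e)" if "e \<in> edges (gamma G1)" for e
        by (simp only: black_end_brot[OF G1 that])
      show "B' (black_end G2 e) = B (black_end G1 e)" if "e \<in> outer" for e
        using o that outer by blast
      show "b0 \<noteq> 0" "p k \<noteq> 0" for k
        using nz[OF in_edges(1)] nz[OF in_edges(2)] k by metis+
    qed
    also have "\<dots> = map_j G2 B' (face_map f)"
      using bij_face_map f by (intro map_j_prod[OF G2, symmetric]) (auto simp: bij_betw_def)
    finally show ?thesis .
  qed
  have X: "X f = map_i G2 C' (face_map f)"
    if C: "C \<in> torus_R G1" and mut: "mutations mut_X spiders (map_i G1 C) = Some X"
      and C': "\<rho> C = Some C'" and f: "f \<in> faces (gamma G1)" for C X C' f
  proof -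
    obtain c s where k: "\<And>k. conductance_weight G1 C (x k) = 1 / c k" "\<And>k. conductance_weight G1 C (l k) = c k"
        "\<And>k. conductance_weight G1 C (m k) = 1 / c k" "\<And>k. conductance_weight G1 C (n k) = c k"
        "\<And>k. conductance_weight G2 C' (x' k) = s k" "\<And>k. conductance_weight G2 C' (l' k) = 1 / s k"
        "\<And>k. conductance_weight G2 C' (m' k) = s k" "\<And>k. conductance_weight G2 C' (n' k) = 1 / s k" "\<And>k. c k \<noteq> 0"
        "\<And>k. s k = (c One * c Two + c Two * c Three + c Three * c One) / c (succ3 k)"
      and o: "\<And>e. e \<in> Z \<Longrightarrow> conductance_weight G2 C' e = conductance_weight G1 C e"
      using \<rho>[OF C C'] by blast
    show ?thesis
      unfolding map_i_prod[OF G2]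
      by (rule mutations_X_face_map[OF mut map_i_prod[OF G1] k(1-4) _ k(5-10) f]) (use o outer in blast)
  qed
  have posA: "mutations mut_A spiders (map_j G1 B) \<noteq> None \<and> \<beta> B \<noteq> None" if "positive_on (black_vertices G1) B" for B
    using mutations_A_positive[OF positive_on_map_j[OF G1 that]] \<beta>_pos[OF that] by blast
  have posX: "mutations mut_X spiders (map_i G1 C) \<noteq> None \<and> \<rho> C \<noteq> None" if "positive_on (edge_of G1 ` darts G1) C" for C
  proof -
    have "C \<in> torus_R G1"
      using that by (force simp: torus_R_def positive_on_def)
    then show ?thesis
      using mutations_X_positive[OF positive_on_map_i[OF G1 that] prod_map_i[OF G1]] \<rho>_pos[OF that] by blast
  qed
  have "face_map (fc (gamma G1) e) = fc (gamma G2) e" if "d \<in> Y" "e \<in> {VertexEdge d, FaceEdge d}" for d e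
  proof -
    have "e \<in> outer" using that unfolding outer Z by blast
    then show ?thesis using face_map_transfer[of e] by (simp del: gamma_simps)
  qed
  moreover have "length spiders = 4"
    by (simp add: spiders_def)
  ultimately show ?thesis
    by (intro exI[of _ spiders] exI[of _ L3] exI[of _ relabel] exI[of _ face_map] conjI ballI allI impI
        moves_spiders bip_iso_relabel bij_face_map A X) (use posA posX in blast)+
qed

section \<open>The hexagons of the triangle and of the star\<close>

context delta_star_pair
begin

text \<open>The white vertices are the midpoints of the sides, around which one meets the triangular
  face, a vertex, the face across and the next vertex. For the star they are the midpoints of the
  spokes, and one starts at the centre \<open>c\<close>.\<close>

definition "hx k = FaceEdge (ta k)"
definition "hl k = VertexEdge (ta k)"
definition "hm k = FaceEdge (opp G (ta k))"
definition "hn k = VertexEdge (opp G (ta k))"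
definition "hx' k = VertexEdge (tt k)"
definition "hl' k = FaceEdge (ts k)"
definition "hm' k = VertexEdge (ts k)"
definition "hn' k = FaceEdge (tt k)"

lemmas h_defs = hx_def hl_def hm_def hn_def hx'_def hl'_def hm'_def hn'_def

sublocale tri: hexagon "gamma G" hx hl hm hn
  by (intro hexagon.intro wf_bip_gamma G gamma_fc_eq_iff)
    (auto simp: h_defs face_next_ta rot_ta dart_sub_rot_neq face_next_neq)

lemma outer_eq: "tri.outer = VertexEdge ` outer_darts \<union> FaceEdge ` outer_darts"
proof
  show "tri.outer \<subseteq> VertexEdge ` outer_darts \<union> FaceEdge ` outer_darts"
    unfolding tri.outer_def h_defs gamma_simps darts_G by blast
  show "VertexEdge ` outer_darts \<union> FaceEdge ` outer_darts \<subseteq> tri.outer"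
  proof
    fix e assume "e \<in> VertexEdge ` outer_darts \<union> FaceEdge ` outer_darts"
    then obtain d where d: "d \<in> outer_darts" "e = VertexEdge d \<or> e = FaceEdge d" by blast
    then show "e \<in> tri.outer"
      unfolding tri.outer_def h_defs gamma_simps using outer_dartD(1,3,4)[OF d(1)] by blast
  qed
qed

lemma outer_cases:
  assumes "e \<in> tri.outer"
  obtains d where "d \<in> outer_darts" "e = VertexEdge d" | d where "d \<in> outer_darts" "e = FaceEdge d"
  using assms unfolding outer_eq by blast

lemma hex_sub_vertex: "hex_sub hl hm hl' hm' (VertexEdge d) = VertexEdge (dart_sub d)"
proof (cases "d \<in> range ta")
  case True
  then obtain k where "d = ta k" by blast
  then show ?thesis
    using hex_sub_simps(1)[of hl hm hl' hm' k] by (simp add: h_defs)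
next
  case False
  then have d: "d \<noteq> ta k" for k by blast
  have "hex_sub hl hm hl' hm' (VertexEdge d) = VertexEdge d"
    by (rule hex_sub_simps(3)) (simp_all add: h_defs d)
  then show ?thesis by (simp add: d)
qed

lemma hex_sub_face: "hex_sub hl hm hl' hm' (FaceEdge d) = FaceEdge (face_sub d)"
proof (cases "d \<in> range (\<lambda>k. opp G (ta k))")
  case True
  then obtain k where "d = opp G (ta k)" by blast
  then show ?thesis
    using hex_sub_simps(2)[of hl hm hl' hm' k] by (simp add: h_defs)
next
  case False
  then have d: "d \<noteq> opp G (ta k)" for k by blast
  have "hex_sub hl hm hl' hm' (FaceEdge d) = FaceEdge d"
    by (rule hex_sub_simps(3)) (simp_all add: h_defs d)
  then show ?thesis by (simp add: d)
qed

lemma gamma_star_outer: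
  assumes "e \<in> tri.outer"
  shows "e \<in> edges (gamma G')" "brot (gamma G') e = hex_sub hl hm hl' hm' (brot (gamma G) e)"
    "wrot (gamma G') e = wrot (gamma G) e" "black_end G' e = black_end G e"
  by (cases rule: outer_cases[OF assms];
      simp add: outer_move hex_sub_vertex hex_sub_face face_next_outer)+

lemma brot_hn': "brot (gamma G') (hn' k) = hex_sub hl hm hl' hm' (brot (gamma G) (hm k))"
  using hex_sub_face face_next_tt[of k] by (simp add: hn'_def hm_def)

lemma brot_hm': "brot (gamma G') (hm' (succ3 k)) = hex_sub hl hm hl' hm' (brot (gamma G) (hn k))"
  using hex_sub_vertex rot_ts[of k] by (simp add: hm'_def hn_def)

lemma star_not_outer: "hx' k \<notin> tri.outer" "hl' k \<notin> tri.outer" "hm' k \<notin> tri.outer" "hn' k \<notin> tri.outer"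
  unfolding outer_eq h_defs by (simp_all add: image_iff)

lemma star_hexagon: "hexagon (gamma G') hx' hl' hm' hn'"
proof (rule tri.hexagon_targetI)
  show "hl' k \<notin> tri.outer" "hm' k \<notin> tri.outer" for k
    by (fact star_not_outer)+
  show "brot (gamma G') (hn' k) = hex_sub hl hm hl' hm' (brot (gamma G) (hm k))"
    "brot (gamma G') (hm' (succ3 k)) = hex_sub hl hm hl' hm' (brot (gamma G) (hn k))" for k
    by (fact brot_hn' brot_hm')+
qed (use wf_bip_gamma[OF G'] gamma_fc_eq_iff[OF G'] in \<open>auto simp: h_defs face_next_ts rot_tt opp_st\<close>)

text \<open>\<open>NewEdge\<close> never occurs in \<open>gamma\<close>, so the same six names are
  fresh for both graphs.\<close>

definition "hy k = (NewEdge (three_nat k) :: 'd gedge)"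
definition "hz k = (NewEdge (three_nat k + 3) :: 'd gedge)"

lemma hyz: "hy k \<notin> edges (gamma H)" "hz k \<notin> edges (gamma H)"
  by (auto simp: hy_def hz_def)

lemma three_nat_eq_iff: "three_nat j = three_nat k \<longleftrightarrow> j = k" "three_nat j \<noteq> three_nat k + 3"
  by (cases j; cases k; simp)+

lemma star_outer: "hexagon.outer (gamma G') hx' hl' hm' hn' = tri.outer"
proof -
  have "edges (gamma G') = tri.outer \<union> (range hx' \<union> range hl' \<union> range hm' \<union> range hn')"
    unfolding outer_eq h_defs gamma_simps darts_G' by blast
  then show ?thesis
    unfolding hexagon.outer_def[OF star_hexagon] using star_not_outer by blast
qed

lemma hexagon_move_delta_star: "hexagon_move (gamma G) hx hl hm hn hy hz (gamma G') hx' hl' hm' hn'"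
proof (intro hexagon_move.intro fresh_hexagon.intro tri.hexagon_axioms star_hexagon)
  show "fresh_hexagon_axioms (gamma G) hy hz"
    by (intro fresh_hexagon_axioms.intro hyz) (simp_all add: hy_def hz_def three_nat_eq_iff)
  show "hexagon_move_axioms (gamma G) hx hl hm hn (gamma G') hx' hl' hm' hn'"
    by (intro hexagon_move_axioms.intro star_outer gamma_star_outer brot_hn' brot_hm')
qed

lemma hexagon_move_star_delta:
  "hexagon_move (gamma G') hx' hl' hm' hn' hy hz (gamma G) (hx \<circ> pred3) (hl \<circ> pred3) (hm \<circ> pred3) (hn \<circ> pred3)"
  by (rule hexagon_move.hexagon_move_reverse[OF hexagon_move_delta_star]) (fact hyz)+

section \<open>B-variables and conductances of the triangle and the star\<close>

definition "tri_face = lface G (a 1)"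

lemma lface_ta: "lface G (ta k) = tri_face"
proof -
  have "lface G (ta (succ3 k)) = lface G (ta k)" for k
    using lface_face_next[OF G ta_in(1)[of k]] by (simp add: face_next_ta)
  from this[of One] this[of Two] have "lface G (ta k) = lface G (ta One)"
    by (cases k) simp_all
  then show ?thesis by (simp add: ta_def tri_face_def)
qed

lemma lface_neq_ta:
  assumes "d \<in> darts G" "d \<notin> range ta"
  shows "lface G d \<noteq> tri_face"
proof
  assume "lface G d = tri_face"
  then have "lface G (ta One) = lface G d" by (simp add: lface_ta)
  then have "d \<in> orbit (face_next G) (ta One)"
    using D(7)[OF ta_in(1) assms(1)] by blast
  then have "d \<in> range ta"
    by induction (auto simp: face_next_ta)
  then show False using assms(2) by blast
qed

lemma vert_opp_ta: "vert G (opp G (ta k)) = vert G (ta (succ3 k))"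
  using vert_rot[OF G ta_in(1)[of "succ3 k"]] by (simp add: rot_ta)

lemma vert_neq_c: "d \<in> darts G \<Longrightarrow> vert G d \<noteq> c"
  using c_new by blast

lemma a_eq: "a 1 = ta One" "a 2 = ta Two" "a 3 = ta Three" and s_eq: "s 1 = ts One" "s 2 = ts Two" "s 3 = ts Three"
  by (simp_all add: ta_def ts_def)

lemma star_sum_eq: "star_sum G a B =
    B (Inl (vert G (ta One))) * B (Inr (lface G (opp G (ta Two)))) +
    B (Inl (vert G (ta Two))) * B (Inr (lface G (opp G (ta Three)))) +
    B (Inl (vert G (ta Three))) * B (Inr (lface G (opp G (ta One))))"
  unfolding star_sum_def a_eq ..

lemma beta_delta_star_hexagon:
  assumes "beta_delta_star G G' a c B = Some B'"
  shows "\<exists>b0 p q b7.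
      (\<forall>k. B (black_end G (hx k)) = b0 \<and> B (black_end G (hl k)) = p k \<and> B (black_end G (hm k)) = q k \<and>
        B' (black_end G' (hx' k)) = b7 \<and> B' (black_end G' (hl' (succ3 k))) = q k \<and>
        B' (black_end G' (hm' k)) = p k \<and> B' (black_end G' (hn' k)) = q k) \<and>
      (\<forall>e\<in>tri.outer. B' (black_end G' e) = B (black_end G e)) \<and>
      b7 = (p One * q Two + p Two * q Three + p Three * q One) / b0"
proof -
  have B': "B' = B(Inl c := star_sum G a B / B (Inr (tri_face)))"
    using assms by (simp add: beta_delta_star_def into_eq_Some_iff tri_face_def)
  have "B' (black_end G' e) = B (black_end G e)" if e: "e \<in> tri.outer" for e
    by (cases rule: outer_cases[OF e]) (simp_all add: gamma_star_outer(4)[OF e] B' vert_neq_c outer_move)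
  then have out: "\<forall>e\<in>tri.outer. B' (black_end G' e) = B (black_end G e)" by blast
  show ?thesis
    \<comment> \<open>For the triangle, \<open>p\<close> lives on its vertices and \<open>q\<close>
      on the faces across its sides.\<close>
    by (rule exI[of _ "B (Inr tri_face)"], rule exI[of _ "\<lambda>k. B (Inl (vert G (ta k)))"],
        rule exI[of _ "\<lambda>k. B (Inr (lface G (opp G (ta k))))"], rule exI[of _ "star_sum G a B / B (Inr tri_face)"])
      (use out in \<open>simp add: h_defs B' lface_ta vert_st lface_st vert_neq_c star_sum_eq\<close>)
qed

lemma beta_star_delta_hexagon:
  assumes "beta_star_delta G G' a c B = Some B'"
  shows "\<exists>b0 p q b7.
      (\<forall>k. B (black_end G' (hx' k)) = b0 \<and> B (black_end G' (hl' k)) = p k \<and> B (black_end G' (hm' k)) = q k \<and>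
        B' (black_end G ((hx \<circ> pred3) k)) = b7 \<and> B' (black_end G ((hl \<circ> pred3) (succ3 k))) = q k \<and>
        B' (black_end G ((hm \<circ> pred3) k)) = p k \<and> B' (black_end G ((hn \<circ> pred3) k)) = q k) \<and>
      (\<forall>e\<in>tri.outer. B' (black_end G e) = B (black_end G' e)) \<and>
      b7 = (p One * q Two + p Two * q Three + p Three * q One) / b0"
proof -
  have B': "B' = B(Inr (tri_face) := star_sum G a B / B (Inl c))"
    using assms by (simp add: beta_star_delta_def into_eq_Some_iff tri_face_def)
  have "B' (black_end G e) = B (black_end G' e)" if e: "e \<in> tri.outer" for e
  proof (cases rule: outer_cases[OF e])
    case (2 d)
    then have "lface G d \<noteq> tri_face" by (intro lface_neq_ta) auto
    then show ?thesis using 2 gamma_star_outer(4)[OF e] by (simp add: B')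
  qed (use gamma_star_outer(4)[OF e] in \<open>simp add: B'\<close>)
  then have out: "\<forall>e\<in>tri.outer. B' (black_end G e) = B (black_end G' e)" by blast
  have opp: "lface G (opp G (ta k)) \<noteq> tri_face" for k
    by (rule lface_neq_ta) auto
  have ts: "lface G' (ts k) = lface G (opp G (ta (pred3 k)))" for k
    using lface_st(2)[of "pred3 k"] by simp
  show ?thesis
    \<comment> \<open>Now \<open>p\<close> lives on faces and \<open>q\<close> on vertices. The dart
      \<open>ts k\<close> has on its left the face across the preceding side, hence
      \<open>pred3\<close>.\<close>
    by (rule exI[of _ "B (Inl c)"], rule exI[of _ "\<lambda>k. B (Inr (lface G (opp G (ta (pred3 k)))))"],
        rule exI[of _ "\<lambda>k. B (Inl (vert G (ta k)))"], rule exI[of _ "star_sum G a B / B (Inl c)"])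
      (use out in \<open>simp add: h_defs B' lface_ta vert_st opp ts vert_opp_ta star_sum_eq algebra_simps\<close>)
qed

lemma edge_of_outer: "d \<in> outer_darts \<Longrightarrow> edge_of G' d = edge_of G d"
  by (simp add: edge_of_def outer_move)

lemma edge_of_eq [simp]: "edge_of G (ta j) = edge_of G (ta k) \<longleftrightarrow> j = k"
  "edge_of G' (ts j) = edge_of G' (ts k) \<longleftrightarrow> j = k"
  "d \<in> outer_darts \<Longrightarrow> edge_of G d \<noteq> edge_of G (ta k)"
  "d \<in> outer_darts \<Longrightarrow> edge_of G d \<noteq> edge_of G' (ts k)"
  by (auto simp: edge_of_def opp_st doubleton_eq_iff)

lemma edge_of_tt: "edge_of G' (tt k) = edge_of G' (ts k)"
  by (auto simp: edge_of_def opp_st)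

text \<open>The edges \<open>hl k\<close> are vertex edges, so \<open>c k\<close> is the conductance
  itself. The side opposite to vertex \<open>k\<close> is the next one, which explains the
  denominator of \<open>s k\<close>.\<close>

lemma rho_delta_star_hexagon:
  assumes C: "C \<in> torus_R G" and "rho_delta_star G G' a s C = Some C'"
  shows "\<exists>c s.
      (\<forall>k. conductance_weight G C (hx k) = 1 / c k \<and> conductance_weight G C (hl k) = c k \<and>
        conductance_weight G C (hm k) = 1 / c k \<and> conductance_weight G C (hn k) = c k \<and>
        conductance_weight G' C' (hx' k) = s k \<and> conductance_weight G' C' (hl' k) = 1 / s k \<and>
        conductance_weight G' C' (hm' k) = s k \<and> conductance_weight G' C' (hn' k) = 1 / s k \<and> c k \<noteq> 0 \<and>
        s k = (c One * c Two + c Two * c Three + c Three * c One) / c (succ3 k)) \<and>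
      (\<forall>e\<in>tri.outer. conductance_weight G' C' e = conductance_weight G C e)"
proof -
  define c where "c k = C (edge_of G (ta k))" for k
  define S where "S = c One * c Two + c Two * c Three + c Three * c One"
  have C': "C' = C(edge_of G' (ts One) := S / c Two, edge_of G' (ts Two) := S / c Three,
      edge_of G' (ts Three) := S / c One)"
    using assms(2) unfolding rho_delta_star_def Let_def into_eq_Some_iff c_def S_def a_eq s_eq
    by (simp add: algebra_simps)
  have ts: "C' (edge_of G' (ts k)) = S / c (succ3 k)" for k
    by (cases k) (simp_all add: C')
  have "conductance_weight G' C' e = conductance_weight G C e" if "e \<in> tri.outer" for e
    by (cases rule: outer_cases[OF that]) (simp_all add: C' edge_of_outer)
  then have out: "\<forall>e\<in>tri.outer. conductance_weight G' C' e = conductance_weight G C e" by blast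
  have nz: "c k \<noteq> 0" for k
    using C by (simp add: torus_R_def c_def)
  show ?thesis
    by (rule exI[of _ c], rule exI[of _ "\<lambda>k. S / c (succ3 k)"])
      (use out nz in \<open>simp add: h_defs c_def[symmetric] edge_of_opp[OF G] edge_of_tt ts S_def\<close>)
qed

text \<open>In the star the edges \<open>hl' k\<close> are face edges and carry reciprocal
  conductances; in reciprocals the formula from star to triangle takes the shape of the one from
  triangle to star.\<close>

lemma rho_star_delta_hexagon:
  assumes C: "C \<in> torus_R G'" and "rho_star_delta G G' a s C = Some C'"
  shows "\<exists>c s.
      (\<forall>k. conductance_weight G' C (hx' k) = 1 / c k \<and> conductance_weight G' C (hl' k) = c k \<and>
        conductance_weight G' C (hm' k) = 1 / c k \<and> conductance_weight G' C (hn' k) = c k \<and>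
        conductance_weight G C' ((hx \<circ> pred3) k) = s k \<and> conductance_weight G C' ((hl \<circ> pred3) k) = 1 / s k \<and>
        conductance_weight G C' ((hm \<circ> pred3) k) = s k \<and> conductance_weight G C' ((hn \<circ> pred3) k) = 1 / s k \<and> c k \<noteq> 0 \<and>
        s k = (c One * c Two + c Two * c Three + c Three * c One) / c (succ3 k)) \<and>
      (\<forall>e\<in>tri.outer. conductance_weight G C' e = conductance_weight G' C e)"
proof -
  define w where "w k = C (edge_of G' (ts k))" for k
  define S where "S = w One + w Two + w Three"
  have C': "C' = C(edge_of G (ta Two) := w Two * w Three / S, edge_of G (ta Three) := w One * w Three / S,
      edge_of G (ta One) := w One * w Two / S)"
    using assms(2) unfolding rho_star_delta_def Let_def into_eq_Some_iff w_def S_def a_eq s_eq by simp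
  have ta: "C' (edge_of G (ta k)) = w k * w (succ3 k) / S" for k
    by (cases k) (simp_all add: C')
  have nz: "w k \<noteq> 0" for k
    using C by (simp add: torus_R_def w_def)
  define v where "v k = S / (w (pred3 k) * w k)" for k
  have ta': "C' (edge_of G (ta (pred3 k))) = 1 / v k" for k
    by (simp add: ta v_def)
  have s: "v k = (1 / (w One * w Two) + 1 / (w Two * w Three) + 1 / (w Three * w One)) * w (succ3 k)" for k
    using nz by (cases k) (simp_all add: v_def S_def field_simps)
  have "conductance_weight G C' e = conductance_weight G' C e" if "e \<in> tri.outer" for e
    by (cases rule: outer_cases[OF that]) (simp_all add: C' edge_of_outer)
  then have out: "\<forall>e\<in>tri.outer. conductance_weight G C' e = conductance_weight G' C e" by blast
  show ?thesis
    by (rule exI[of _ "\<lambda>k. 1 / w k"], rule exI[of _ v])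
      (use out nz in \<open>simp add: h_defs w_def[symmetric] edge_of_opp[OF G] edge_of_tt ta' s\<close>)
qed

lemma black_vertices_G': "black_vertices G' \<subseteq> insert (Inl c) (black_vertices G)"
proof -
  have "lface G' (ts k) \<in> lface G ` darts G" for k
    using lface_st(2)[of "pred3 k"] by simp
  then show ?thesis
    unfolding black_vertices_def darts_G' by (auto simp: vert_st lface_st outer_move)
qed

lemma black_vertices_G: "black_vertices G \<subseteq> insert (Inr (tri_face)) (black_vertices G')"
proof
  fix b assume "b \<in> black_vertices G"
  then consider d where "d \<in> darts G" "b = Inl (vert G d)" | d where "d \<in> darts G" "b = Inr (lface G d)"
    unfolding black_vertices_def by blast
  moreover have "Inl (vert G (ta k)) \<in> black_vertices G'" "Inr (lface G (opp G (ta k))) \<in> black_vertices G'" for k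
    using vert_st(1)[of k] lface_st(1)[of k] st_in[of k] unfolding black_vertices_def by (metis UnI1 UnI2 imageI)+
  moreover have "Inl (vert G d) \<in> black_vertices G'" "Inr (lface G d) \<in> black_vertices G'" if "d \<in> outer_darts" for d
    using outer_move(3,4)[OF that] outer_dartD(2)[OF that] unfolding black_vertices_def by (metis UnI1 UnI2 imageI)+
  ultimately show "b \<in> insert (Inr (tri_face)) (black_vertices G')"
    by cases (auto simp: darts_G lface_ta vert_opp_ta)
qed

lemma star_sum_positive:
  assumes "positive_on V B" "\<And>k. Inl (vert G (ta k)) \<in> V" "\<And>k. Inr (lface G (opp G (ta k))) \<in> V" "b \<in> V"
  shows "star_sum G a B / B b \<noteq> 0"
proof -
  obtain r where r: "\<And>b. b \<in> V \<Longrightarrow> r b > 0 \<and> B b = complex_of_real (r b)"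
    using assms(1) unfolding positive_on_def by metis
  let ?v = "\<lambda>k. r (Inl (vert G (ta k)))" and ?f = "\<lambda>k. r (Inr (lface G (opp G (ta k))))"
  have "star_sum G a B = complex_of_real (?v One * ?f Two + ?v Two * ?f Three + ?v Three * ?f One)"
    using r assms(2,3) by (simp add: star_sum_eq)
  moreover have "?v One * ?f Two + ?v Two * ?f Three + ?v Three * ?f One > 0"
    using r assms(2,3) by (simp add: add_pos_pos)
  ultimately have "star_sum G a B \<noteq> 0" by (simp only: of_real_eq_0_iff)
  then show ?thesis using r[OF assms(4)] by simp
qed

lemma beta_delta_star_positive:
  assumes "positive_on (black_vertices G) B"
  shows "beta_delta_star G G' a c B \<noteq> None"
proof -
  have "star_sum G a B / B (Inr tri_face) \<noteq> 0"
    by (rule star_sum_positive[OF assms]) (auto simp: black_vertices_def lface_ta[of One, symmetric])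
  moreover have "B b \<noteq> 0" if "b \<in> black_vertices G" for b
    using assms that by (force simp: positive_on_def)
  ultimately have "B(Inl c := star_sum G a B / B (Inr tri_face)) \<in> torus_B G'"
    using black_vertices_G' by (auto simp: torus_B_def)
  then show ?thesis
    by (simp add: beta_delta_star_def into_def tri_face_def)
qed

lemma beta_star_delta_positive:
  assumes "positive_on (black_vertices G') B"
  shows "beta_star_delta G G' a c B \<noteq> None"
proof -
  have "star_sum G a B / B (Inl c) \<noteq> 0"
  proof (rule star_sum_positive[OF assms])
    show "Inl (vert G (ta k)) \<in> black_vertices G'" "Inr (lface G (opp G (ta k))) \<in> black_vertices G'"
      "Inl c \<in> black_vertices G'" for k
      using vert_st(1)[of k] lface_st(1)[of k] vert_st(2)[of k] st_in[of k] unfolding black_vertices_def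
      by (metis UnI1 UnI2 imageI)+
  qed
  moreover have "B b \<noteq> 0" if "b \<in> black_vertices G'" for b
    using assms that by (force simp: positive_on_def)
  ultimately have "B(Inr tri_face := star_sum G a B / B (Inl c)) \<in> torus_B G"
    using black_vertices_G by (auto simp: torus_B_def)
  then show ?thesis
    by (simp add: beta_star_delta_def into_def tri_face_def)
qed

lemma edges_G': "edge_of G' ` darts G' \<subseteq> edge_of G ` darts G \<union> range (\<lambda>k. edge_of G' (ts k))"
  unfolding darts_G' by (auto simp: edge_of_outer edge_of_tt)

lemma edges_G: "edge_of G ` darts G \<subseteq> edge_of G' ` darts G' \<union> range (\<lambda>k. edge_of G (ta k))"
  unfolding darts_G by (auto simp: edge_of_outer[symmetric] edge_of_opp[OF G])

lemma rho_delta_star_positive: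
  assumes C: "positive_on (edge_of G ` darts G) C"
  shows "rho_delta_star G G' a s C \<noteq> None"
proof -
  obtain r where r: "\<And>w. w \<in> edge_of G ` darts G \<Longrightarrow> r w > 0 \<and> C w = complex_of_real (r w)"
    using C unfolding positive_on_def by metis
  define c where "c k = r (edge_of G (ta k))" for k
  have c: "C (edge_of G (ta k)) = complex_of_real (c k)" "c k > 0" for k
    using r by (simp_all add: c_def)
  define S where "S = c Two * c Three + c Three * c One + c One * c Two"
  have "S > 0" using c(2) by (simp add: S_def add_pos_pos)
  define C' where "C' = C(edge_of G' (ts One) := complex_of_real S / c Two,
      edge_of G' (ts Two) := complex_of_real S / c Three, edge_of G' (ts Three) := complex_of_real S / c One)"
  have star: "C' (edge_of G' (ts k)) \<noteq> 0" for k
    using \<open>S > 0\<close> c(2)[of One] c(2)[of Two] c(2)[of Three] by (cases k) (simp_all add: C'_def)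
  \<comment> \<open>A spoke may consist of the same two darts as a former side, so an updated entry
    may be met here too.\<close>
  have old: "C' w \<noteq> 0" if "w \<in> edge_of G ` darts G" for w
    using r[OF that] \<open>S > 0\<close> c(2)[of One] c(2)[of Two] c(2)[of Three] by (auto simp: C'_def)
  have "C' w \<noteq> 0" if w: "w \<in> edge_of G' ` darts G'" for w
    using subsetD[OF edges_G' w] star old by (elim UnE rangeE) simp_all
  then have "C' \<in> torus_R G'"
    by (simp add: torus_R_def)
  moreover have "rho_delta_star G G' a s C = into (torus_R G') C'"
    unfolding rho_delta_star_def Let_def C'_def a_eq s_eq c by (simp add: S_def)
  ultimately show ?thesis
    by (simp add: into_def)
qed

lemma rho_star_delta_positive:
  assumes C: "positive_on (edge_of G' ` darts G') C"
  shows "rho_star_delta G G' a s C \<noteq> None"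
proof -
  obtain r where r: "\<And>w. w \<in> edge_of G' ` darts G' \<Longrightarrow> r w > 0 \<and> C w = complex_of_real (r w)"
    using C unfolding positive_on_def by metis
  define w where "w k = r (edge_of G' (ts k))" for k
  have w: "C (edge_of G' (ts k)) = complex_of_real (w k)" "w k > 0" for k
    using r by (simp_all add: w_def)
  define S where "S = w One + w Two + w Three"
  have "S > 0" using w(2) by (simp add: S_def add_pos_pos)
  define C' where "C' = C(edge_of G (ta Two) := complex_of_real (w Two) * w Three / S,
      edge_of G (ta Three) := complex_of_real (w One) * w Three / S,
      edge_of G (ta One) := complex_of_real (w One) * w Two / S)"
  have tri: "C' (edge_of G (ta k)) \<noteq> 0" for k
    using \<open>S > 0\<close> w(2)[of One] w(2)[of Two] w(2)[of Three] by (cases k) (simp_all add: C'_def)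
  have old: "C' v \<noteq> 0" if "v \<in> edge_of G' ` darts G'" for v
    using r[OF that] \<open>S > 0\<close> w(2)[of One] w(2)[of Two] w(2)[of Three] by (auto simp: C'_def)
  have "C' v \<noteq> 0" if v: "v \<in> edge_of G ` darts G" for v
    using subsetD[OF edges_G v] tri old by (elim UnE rangeE) simp_all
  then have "C' \<in> torus_R G"
    by (simp add: torus_R_def)
  moreover have "rho_star_delta G G' a s C = into (torus_R G) C'"
    unfolding rho_star_delta_def Let_def C'_def a_eq s_eq w by (simp add: S_def)
  ultimately show ?thesis
    by (simp add: into_def)
qed

end

theorem lemma5p11:
  fixes G G' T :: "('d, 'v, 'f) surface_graph"
    and a :: "nat \<Rightarrow> 'd"
    and \<beta> :: "('v + 'f \<Rightarrow> complex) \<rightharpoonup> ('v + 'f \<Rightarrow> complex)"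
    and \<rho> :: "('d set \<Rightarrow> complex) \<rightharpoonup> ('d set \<Rightarrow> complex)"
  assumes "torus_graph G" and "torus_graph G'"
    and "y_delta_move T a G G' \<beta> \<rho>"
    and "nondegenerate T a"
  shows "\<exists>ms \<Gamma> h \<theta>.
    length ms = 4 \<and> moves (gamma G) ms \<Gamma> \<and> bip_iso h \<theta> \<Gamma> (gamma G') \<and>
    bij_betw \<theta> (faces (gamma G)) (faces (gamma G')) \<and>
    (\<forall>d\<in>darts T - tri_darts T a. \<forall>e\<in>{VertexEdge d, FaceEdge d}.
       \<theta> (fc (gamma G) e) = fc (gamma G') e) \<and>
    (\<forall>B\<in>torus_B G. \<forall>A B'.
       mutations mut_A ms (map_j G B) = Some A \<longrightarrow> \<beta> B = Some B' \<longrightarrow>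
       (\<forall>f\<in>faces (gamma G). A f = map_j G' B' (\<theta> f))) \<and>
    (\<forall>B. positive_on (black_vertices G) B \<longrightarrow>
       mutations mut_A ms (map_j G B) \<noteq> None \<and> \<beta> B \<noteq> None) \<and>
    (\<forall>C\<in>torus_R G. \<forall>X C'.
       mutations mut_X ms (map_i G C) = Some X \<longrightarrow> \<rho> C = Some C' \<longrightarrow>
       (\<forall>f\<in>faces (gamma G). X f = map_i G' C' (\<theta> f))) \<and>
    (\<forall>C. positive_on (edge_of G ` darts G) C \<longrightarrow>
       mutations mut_X ms (map_i G C) \<noteq> None \<and> \<rho> C \<noteq> None)"
  using assms(3)
proof cases
  case (delta_to_star s t c)
  interpret delta_star_pair T G' a s t c
    using assms delta_to_star by unfold_locales simp_all
  show ?thesis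
    unfolding delta_to_star(1-3)
    by (rule hexagon_move_spiders[OF G G' hexagon_move_delta_star refl outer_eq[unfolded outer_darts_def]])
      (assumption | rule beta_delta_star_hexagon beta_delta_star_positive rho_delta_star_hexagon rho_delta_star_positive)+
next
  case (star_to_delta s t c)
  \<comment> \<open>The locale takes the graph with the triangle first; the move now starts at the
    star, so the reversed hexagon move is used.\<close>
  interpret delta_star_pair T G a s t c
    using assms star_to_delta by unfold_locales simp_all
  show ?thesis
    unfolding star_to_delta(1-3)
    by (rule hexagon_move_spiders[OF G' G hexagon_move_star_delta star_outer outer_eq[unfolded outer_darts_def]])
      (assumption | rule beta_star_delta_hexagon beta_star_delta_positive rho_star_delta_hexagon rho_star_delta_positive)+
qed

end
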